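(* Let $\varphi$ be a PEB-spline of order $m\in\mathbb{N}$ with support in $[0,m]$. For every $\varepsilon>0$ and every given multiplicity sequence $\mu=(\mu_j)_{j\in\mathbb{Z}}$ with values in $\{0,\dots,m-1\}$, there exists a set $X=(x_j)_{j\in\mathbb{Z}}\subseteq\mathbb{R}$ with multiplicity function $\mu_X$ such that $\mu_X(x_j)=\mu_j$ for all $j\in\mathbb{Z}$, $(X,\mu_X)$ is a sampling set for $V^p(\varphi)$ ($1\le p\le\infty$), and $D^-(X,\mu_X)<1+\varepsilon$.
   Context: PEB-splines. Let $m\in\mathbb{N}=\{1,2,\dots\}$ and $T_yf(x)=f(x-y)$. For $1\le s\le m$ let $\gamma_s\in\mathbb{R}$, let $r_s\in C^{m-s}(\mathbb{R})$ be strictly positive and $1$-periodic, and put $w_s(x)=e^{\gamma_s x}r_s(x)$. Let $u_1=w_1$ and $u_s(x)=w_1(x)\int_0^x w_2(x_2)\int_0^{x_2}w_3(x_3)\cdots\int_0^{x_{s-1}}w_s(x_s)\,dx_s\cdots dx_2$ for $2\le s\le m$, and $\mathcal{U}_m=\mathrm{span}_{\mathbb{C}}(u_1,\dots,u_m)$. The periodic exponential B-spline (PEB-spline) of order $m$ for these weights is the function $\varphi:\mathbb{R}\to\mathbb{R}$, unique up to a positive scalar factor, with $\varphi\in C^{m-2}(\mathbb{R})$ (no condition if $m=1$), $\mathrm{supp}\,\varphi=[0,m]$, $\varphi>0$ on $(0,m)$, and whose restriction to each interval $(\ell,\ell+1)$, $\ell\in\mathbb{Z}$, is the restriction of an element of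 $\mathcal{U}_m$. The function $\varphi^{(m-1)}$ may jump at integers; values of the $(m-1)$-th derivative of $\varphi$ (and of functions in $V^p(\varphi)$) at integers are right-sided limits (for $m=1$, up to a factor, $\varphi=w_1\chi_{[0,1)}$). Shift-invariant space: $V^p(\varphi)=\{\sum_{\ell\in\mathbb{Z}}c_\ell\varphi(\cdot-\ell):(c_\ell)\in\ell^p(\mathbb{Z})\}\subseteq L^p(\mathbb{R})$. Sampling: $X=(x_j)_{j\in\mathbb{Z}}$ is labelled as a strictly increasing sequence. A multiplicity function is a map $\mu_X:X\to\{0,\dots,S\}$. $(X,\mu_X)$ is a sampling set for $V^p(\varphi)$ if there are constants $A_p,B_p>0$ with $A_p\|f\|_p^p\le\sum_{x\in X}\sum_{s=0}^{\mu_X(x)}|f^{(s)}(x)|^p\le B_p\|f\|_p^p$ for all $f\in V^p(\varphi)$ (with suprema in place of sums if $p=\infty$). Weighted lower Beurling density: $D^-(X,\mu_X)=\liminf_{R\to\infty}\inf_{y\in\mathbb{R}}\frac{1}{2R}\sum_{x\in X\cap[y-R,y+R]}(1+\mu_X(x))$. *)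

theory Defs
  imports "HOL-Probability.Essential_Supremum"
begin

definition nderiv :: "nat \<Rightarrow> (real \<Rightarrow> 'a::real_normed_vector) \<Rightarrow> real \<Rightarrow> 'a" where
  "nderiv s f = ((\<lambda>g x. vector_derivative g (at x)) ^^ s) f"

definition Ck :: "nat \<Rightarrow> (real \<Rightarrow> 'a::real_normed_vector) \<Rightarrow> bool" where
  "Ck k f \<longleftrightarrow> (\<forall>i<k. \<forall>x. nderiv i f differentiable (at x)) \<and> continuous_on UNIV (nderiv k f)"

text \<open>Weights are families \<open>w\<close> of which only the members \<open>w 1, \<dots>, w m\<close> matter.\<close>

definition PEB_weights :: "nat \<Rightarrow> (nat \<Rightarrow> real \<Rightarrow> real) \<Rightarrow> bool" where
  "PEB_weights m w \<longleftrightarrow>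
     (\<forall>s\<in>{1..m}. \<exists>(\<gamma>::real) (r :: real \<Rightarrow> real).
        Ck (m - s) r \<and> (\<forall>x. r x > 0) \<and> (\<forall>x. r (x + 1) = r x) \<and>
        (\<forall>x. w s x = exp (\<gamma> * x) * r x))"

text \<open>The \<open>k\<close>-fold iterated integral with outermost weight \<open>w i\<close> and innermost weight
  \<open>w (i + k - 1)\<close>; the integrals are oriented, so \<open>x\<close> may be negative.\<close>

fun iter_int :: "(nat \<Rightarrow> real \<Rightarrow> real) \<Rightarrow> nat \<Rightarrow> nat \<Rightarrow> real \<Rightarrow> real" where
  "iter_int w i 0 x = 1"
| "iter_int w i (Suc k) x = (LBINT t=0..ereal x. w i t * iter_int w (Suc i) k t)"

definition PEB_basis :: "(nat \<Rightarrow> real \<Rightarrow> real) \<Rightarrow> nat \<Rightarrow> real \<Rightarrow> real" where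
  "PEB_basis w s x = w 1 x * iter_int w 2 (s - 1) x"

definition PEB_space :: "nat \<Rightarrow> (nat \<Rightarrow> real \<Rightarrow> real) \<Rightarrow> (real \<Rightarrow> complex) set" where
  "PEB_space m w = {g. \<exists>a :: nat \<Rightarrow> complex. g = (\<lambda>x. \<Sum>s=1..m. a s * complex_of_real (PEB_basis w s x))}"

text \<open>For \<open>m = 1\<close> the function itself may jump at integers; the last condition states that its
  values there are right-sided limits.\<close>

definition PEB_spline :: "nat \<Rightarrow> (nat \<Rightarrow> real \<Rightarrow> real) \<Rightarrow> (real \<Rightarrow> real) \<Rightarrow> bool" where
  "PEB_spline m w \<phi> \<longleftrightarrow>
     (m \<ge> 2 \<longrightarrow> Ck (m - 2) \<phi>) \<and>
     closure {x. \<phi> x \<noteq> 0} = {0..real m} \<and>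
     (\<forall>x\<in>{0<..<real m}. \<phi> x > 0) \<and>
     (\<forall>l::int. \<exists>g\<in>PEB_space m w. \<forall>x\<in>{real_of_int l<..<real_of_int l + 1}. complex_of_real (\<phi> x) = g x) \<and>
     (m = 1 \<longrightarrow> (\<forall>l::int. (\<phi> \<longlongrightarrow> \<phi> (real_of_int l)) (at_right (real_of_int l))))"

text \<open>Exponents \<open>p\<close> with \<open>1 \<le> p \<le> \<infinity>\<close> are modelled in \<^typ>\<open>ennreal\<close>.\<close>

definition lp_seq :: "ennreal \<Rightarrow> (int \<Rightarrow> complex) set" where
  "lp_seq p = (if p = \<infinity> then {c. bounded (range c)}
               else {c. (\<lambda>l. norm (c l) powr enn2real p) summable_on UNIV})"

text \<open>If \<open>\<phi>\<close> has bounded support, then for each \<open>x\<close> only finitely many summands are nonzero.\<close>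

definition Vp :: "ennreal \<Rightarrow> (real \<Rightarrow> real) \<Rightarrow> (real \<Rightarrow> complex) set" where
  "Vp p \<phi> = {f. \<exists>c\<in>lp_seq p.
      f = (\<lambda>x. \<Sum>\<^sub>\<infinity>l\<in>UNIV. c l * complex_of_real (\<phi> (x - real_of_int l)))}"

text \<open>The value \<open>f\<^sup>(\<^sup>s\<^sup>)(x)\<close> for functions built from a spline of order \<open>m\<close>:
  the derivative of order \<open>m - 1\<close> is taken as a right-sided limit at integers.\<close>

definition deriv_val :: "nat \<Rightarrow> nat \<Rightarrow> (real \<Rightarrow> complex) \<Rightarrow> real \<Rightarrow> complex" where
  "deriv_val m s f x =
     (if s = m - 1 \<and> x \<in> \<int> then Lim (at_right x) (nderiv s f) else nderiv s f x)"

definition sampling_set ::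
    "ennreal \<Rightarrow> nat \<Rightarrow> (real \<Rightarrow> real) \<Rightarrow> real set \<Rightarrow> (real \<Rightarrow> nat) \<Rightarrow> bool" where
  "sampling_set p m \<phi> X \<mu>X \<longleftrightarrow>
     (\<exists>A B :: real. A > 0 \<and> B > 0 \<and> (\<forall>f\<in>Vp p \<phi>.
        (if p = \<infinity> then
           (let N = esssup lborel (\<lambda>x. ennreal (norm (f x)));
                M = (SUP x\<in>X. SUP s\<in>{0..\<mu>X x}. ennreal (norm (deriv_val m s f x)))
            in ennreal A * N \<le> M \<and> M \<le> ennreal B * N)
         else
           (let N = (\<integral>\<^sup>+x. ennreal (norm (f x) powr enn2real p) \<partial>lborel);
                M = (\<Sum>\<^sub>\<infinity>x\<in>X. \<Sum>s=0..\<mu>X x. ennreal (norm (deriv_val m s f x) powr enn2real p))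
            in ennreal A * N \<le> M \<and> M \<le> ennreal B * N))))"

definition lower_density :: "real set \<Rightarrow> (real \<Rightarrow> nat) \<Rightarrow> ennreal" where
  "lower_density X \<mu>X =
     Liminf at_top (\<lambda>R::real. INF y::real.
        (\<Sum>\<^sub>\<infinity>x\<in>X \<inter> {y - R..y + R}. of_nat (1 + \<mu>X x)) / ennreal (2 * R))"

end

theory Submission
  imports Defs
begin

text \<open>
  The translates of \<open>\<phi>\<close> that are alive on a unit interval are linearly independent on every
  subinterval: by repeated use of Rolle's theorem for the quasi-derivatives, no nonzero spline has
  support of length less than \<open>m\<close>. Hence finitely many point values in a unit interval determine the
  \<open>m\<close> coefficients alive there, and for every \<open>n < m\<close> some point \<open>y n\<close> of the unit interval has a
  nonsingular Wronskian matrix of \<open>\<phi>, \<phi>(\<cdot> + 1), \<dots>, \<phi>(\<cdot> + n)\<close>. If the coefficients up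
  to an index \<open>L\<close> are known, a sample of multiplicity \<open>n\<close> at \<open>L + n + 1 + y n\<close> therefore determines the
  next \<open>n + 1\<close> coefficients without any waste. This recursion need not be stable, so it is restarted
  after a fixed number \<open>T\<close> of nodes, at the cost of at most \<open>K m\<close> superfluous samples per restart; for
  large \<open>T\<close> the density is close to 1. All estimates are local with uniform constants, which gives the
  sampling inequalities for every \<open>p\<close> at once.
\<close>

subsection \<open>Functions of class C^k on an open set\<close>

text \<open>Periodicity of the weights enters through one fact: an integer shift multiplies each
  weight by a constant. Hence a combination of integer translates of \<open>\<phi>\<close> obeys the
  same system of quasi-derivatives as \<open>\<phi>\<close>, with the original weights, and Rolle's
  argument treats it as a single spline. The restarts are forced by the error propagation. One step
  of the recursion may enlarge the bound on the known coefficients by a fixed factor greater than 1,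
  so an infinite run gives no uniform constant, while a run of length \<open>T\<close> does. A node
  of multiplicity n costs n + 1 samples and moves the window of \<open>m\<close> alive coefficients
  by n + 1; the density exceeds 1 only through the restarts, and \<open>T\<close> of order
  \<open>K\<close> \<open>m\<close> / \<open>\<epsilon>\<close> suffices. The constants are uniform
  although \<open>\<mu>\<close> is arbitrary: the Hermite point depends only on the multiplicity n <
  \<open>m\<close>, and one restart set serves all unit intervals, so the nodes have finitely many
  fractional parts. None of them is an integer, so the jumps of \<open>\<phi>\<close> and of its
  derivatives are never met.\<close>

fun Ck_on :: "nat \<Rightarrow> real set \<Rightarrow> (real \<Rightarrow> 'a::real_normed_vector) \<Rightarrow> bool" where
  "Ck_on 0 S f \<longleftrightarrow> continuous_on S f"
| "Ck_on (Suc k) S f \<longleftrightarrow>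
     (\<exists>f'. (\<forall>x\<in>S. (f has_vector_derivative f' x) (at x)) \<and> Ck_on k S f')"

lemma Ck_on_imp_continuous_on: "Ck_on k S f \<Longrightarrow> continuous_on S f"
  by (cases k)
    (auto intro!: continuous_at_imp_continuous_on dest!: bspec has_vector_derivative_continuous)

lemma Ck_on_Suc_imp: "Ck_on (Suc k) S f \<Longrightarrow> Ck_on k S f"
proof (induction k arbitrary: f)
  case 0
  then show ?case using Ck_on_imp_continuous_on by fastforce
next
  case (Suc k)
  then show ?case by (metis Ck_on.simps(2))
qed

lemma Ck_on_le: "Ck_on k S f \<Longrightarrow> j \<le> k \<Longrightarrow> Ck_on j S f"
  by (induction k) (auto simp del: Ck_on.simps simp: le_Suc_eq dest: Ck_on_Suc_imp)

lemma Ck_on_subset: "Ck_on k S f \<Longrightarrow> T \<subseteq> S \<Longrightarrow> Ck_on k T f"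
  by (induction k arbitrary: f) (auto intro: continuous_on_subset)

lemma has_vector_derivative_cong_open:
  assumes "(f has_vector_derivative D) (at x)" "open S" "x \<in> S" "\<And>y. y \<in> S \<Longrightarrow> f y = g y"
  shows "(g has_vector_derivative D) (at x)"
  using assms has_vector_derivative_transform_within_open by blast

lemma Ck_on_cong:
  assumes "Ck_on k S f" "open S" "\<And>x. x \<in> S \<Longrightarrow> f x = g x"
  shows "Ck_on k S g"
proof (cases k)
  case 0
  then show ?thesis using assms by (simp cong: continuous_on_cong)
next
  case (Suc j)
  then show ?thesis using assms by (auto intro: has_vector_derivative_cong_open)
qed

lemma Ck_on_const [simp]: "Ck_on k S (\<lambda>x. c)"
proof (induction k arbitrary: c)
  case (Suc k)
  show ?case using Suc[of 0] by (auto intro!: exI[of _ "\<lambda>x. 0"])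
qed auto

lemma Ck_on_add: "Ck_on k S f \<Longrightarrow> Ck_on k S g \<Longrightarrow> Ck_on k S (\<lambda>x. f x + g x)"
proof (induction k arbitrary: f g)
  case (Suc k)
  then obtain f' g' where
    "\<forall>x\<in>S. (f has_vector_derivative f' x) (at x)" "\<forall>x\<in>S. (g has_vector_derivative g' x) (at x)"
    "Ck_on k S f'" "Ck_on k S g'" by auto
  then show ?case
    using Suc.IH by (auto intro!: exI[of _ "\<lambda>x. f' x + g' x"] has_vector_derivative_add)
qed (auto intro: continuous_on_add)

lemma Ck_on_sum:
  "finite I \<Longrightarrow> (\<And>i. i \<in> I \<Longrightarrow> Ck_on k S (f i)) \<Longrightarrow> Ck_on k S (\<lambda>x. \<Sum>i\<in>I. f i x)"
  by (induction I rule: finite_induct) (auto intro!: Ck_on_add simp del: Ck_on.simps)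

lemma Ck_on_scaleR:
  fixes h :: "real \<Rightarrow> real"
  shows "Ck_on k S h \<Longrightarrow> Ck_on k S f \<Longrightarrow> Ck_on k S (\<lambda>x. h x *\<^sub>R f x)"
proof (induction k arbitrary: f h)
  case (Suc k)
  then obtain f' h' where *:
    "\<forall>x\<in>S. (f has_vector_derivative f' x) (at x)" "\<forall>x\<in>S. (h has_vector_derivative h' x) (at x)"
    "Ck_on k S f'" "Ck_on k S h'" by auto
  have "Ck_on k S (\<lambda>x. h x *\<^sub>R f' x + h' x *\<^sub>R f x)"
    using Suc.prems[THEN Ck_on_Suc_imp] * by (intro Ck_on_add Suc.IH) auto
  then show ?case
    using * by (auto intro!: exI[of _ "\<lambda>x. h x *\<^sub>R f' x + h' x *\<^sub>R f x"] has_vector_derivative_scaleR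
       simp: has_real_derivative_iff_has_vector_derivative)
qed (auto intro: continuous_on_scaleR)

lemma Ck_on_mult:
  fixes f g :: "real \<Rightarrow> real"
  shows "Ck_on k S f \<Longrightarrow> Ck_on k S g \<Longrightarrow> Ck_on k S (\<lambda>x. f x * g x)"
  using Ck_on_scaleR[of k S f g] by simp

lemma Ck_on_inverse:
  fixes f :: "real \<Rightarrow> real"
  shows "Ck_on k S f \<Longrightarrow> (\<And>x. x \<in> S \<Longrightarrow> f x \<noteq> 0) \<Longrightarrow> Ck_on k S (\<lambda>x. inverse (f x))"
proof (induction k arbitrary: f)
  case (Suc k)
  then obtain f' where *: "\<forall>x\<in>S. (f has_vector_derivative f' x) (at x)" "Ck_on k S f'" by auto
  have inv: "Ck_on k S (\<lambda>x. inverse (f x))" using Suc Ck_on_Suc_imp by blast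
  have "Ck_on k S (\<lambda>x. (-1) * (inverse (f x) * f' x * inverse (f x)))"
    using inv * by (intro Ck_on_mult) auto
  moreover have "\<forall>x\<in>S. ((\<lambda>x. inverse (f x)) has_vector_derivative
      (-1) * (inverse (f x) * f' x * inverse (f x))) (at x)"
    using * Suc.prems by (auto simp flip: has_real_derivative_iff_has_vector_derivative
       intro!: derivative_eq_intros)
  ultimately show ?case unfolding Ck_on.simps by (metis (no_types))
qed (auto intro!: continuous_on_inverse)

lemma Ck_on_exp: "Ck_on k S (\<lambda>x. exp (c * x :: real))"
proof (induction k)
  case (Suc k)
  have "\<forall>x\<in>S. ((\<lambda>x. exp (c * x)) has_vector_derivative c * exp (c * x)) (at x)"
    by (auto simp flip: has_real_derivative_iff_has_vector_derivative intro!: derivative_eq_intros)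
  moreover have "Ck_on k S (\<lambda>x. c * exp (c * x))" by (intro Ck_on_mult Suc Ck_on_const)
  ultimately show ?case unfolding Ck_on.simps by (metis (no_types))
qed (auto intro!: continuous_intros)

lemma Ck_on_translate:
  assumes "Ck_on k S f" "\<And>x. x \<in> T \<Longrightarrow> x + a \<in> S"
  shows "Ck_on k T (\<lambda>x. f (x + a))"
  using assms(1)
proof (induction k arbitrary: f)
  case 0
  then have "continuous_on ((\<lambda>x. x + a) ` T) f"
    using assms(2) by (auto elim: continuous_on_subset)
  then show ?case
    using continuous_on_compose[of T "\<lambda>x. x + a" f] continuous_on_add[OF continuous_on_id continuous_on_const]
    by (auto simp: o_def)
next
  case (Suc k)
  then obtain f' where *: "\<forall>x\<in>S. (f has_vector_derivative f' x) (at x)" "Ck_on k S f'" by auto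
  have "((\<lambda>x. f (x + a)) has_vector_derivative f' (x + a)) (at x)" if "x \<in> T" for x
  proof -
    have 1: "((\<lambda>x. x + a) has_vector_derivative 1) (at x)"
      by (auto intro!: derivative_eq_intros simp flip: has_real_derivative_iff_has_vector_derivative)
    have "(f has_vector_derivative f' (x + a)) (at (x + a))"
      using * assms(2) that by blast
    from vector_diff_chain_at[OF 1 this] show ?thesis by (simp add: o_def)
  qed
  then show ?case unfolding Ck_on.simps using Suc.IH[OF *(2)] by (metis (no_types))
qed

lemma nderiv_0 [simp]: "nderiv 0 f = f"
  by (simp add: nderiv_def)

lemma nderiv_Suc: "nderiv (Suc s) f = nderiv s (\<lambda>x. vector_derivative f (at x))"
  by (simp add: nderiv_def funpow_Suc_right del: funpow.simps)

lemma vector_derivative_cong_open: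
  assumes "open S" "x \<in> S" "\<And>y. y \<in> S \<Longrightarrow> f y = g y"
  shows "vector_derivative f (at x) = vector_derivative g (at x)"
proof -
  have "(f has_vector_derivative D) (at x) \<longleftrightarrow> (g has_vector_derivative D) (at x)" for D
    using has_vector_derivative_cong_open[OF _ assms(1,2), of f D g]
      has_vector_derivative_cong_open[OF _ assms(1,2), of g D f] assms(3) by auto
  then show ?thesis by (simp add: vector_derivative_def)
qed

lemma nderiv_cong_open:
  assumes "open S" "\<And>y. y \<in> S \<Longrightarrow> f y = g y" "x \<in> S"
  shows "nderiv s f x = nderiv s g x"
  using assms(2,3)
proof (induction s arbitrary: f g x)
  case (Suc s)
  show ?case unfolding nderiv_Suc
    using Suc.prems by (intro Suc.IH vector_derivative_cong_open[OF assms(1)]) auto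
qed auto

lemma nderiv_Suc_eq:
  assumes "open S" "\<And>x. x \<in> S \<Longrightarrow> (f has_vector_derivative f' x) (at x)" "x \<in> S"
  shows "nderiv (Suc s) f x = nderiv s f' x"
  unfolding nderiv_Suc using assms by (intro nderiv_cong_open) (auto intro: vector_derivative_at)

lemma continuous_on_nderiv:
  assumes "open S" "Ck_on k S f" "s \<le> k"
  shows "continuous_on S (nderiv s f)"
  using assms(2,3)
proof (induction k arbitrary: f s)
  case (Suc k)
  show ?case
  proof (cases s)
    case 0
    then show ?thesis using Suc Ck_on_imp_continuous_on by (metis nderiv_0)
  next
    case (Suc t)
    from Suc.prems obtain f' where
      *: "\<forall>x\<in>S. (f has_vector_derivative f' x) (at x)" "Ck_on k S f'" by auto
    have "continuous_on S (nderiv t f')" using Suc.IH[OF *(2)] Suc.prems Suc by auto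
    moreover have "nderiv (Suc t) f x = nderiv t f' x" if "x \<in> S" for x
      using * that by (intro nderiv_Suc_eq[OF assms(1)]) auto
    ultimately show ?thesis using Suc by (simp cong: continuous_on_cong)
  qed
qed simp

lemma nderiv_add:
  assumes "open S" "Ck_on k S f" "Ck_on k S g" "s \<le> k" "x \<in> S"
  shows "nderiv s (\<lambda>x. f x + g x) x = nderiv s f x + nderiv s g x"
  using assms(2-5)
proof (induction k arbitrary: f g s)
  case (Suc k)
  show ?case
  proof (cases s)
    case (Suc t)
    from Suc.prems obtain f' g' where *:
      "\<forall>x\<in>S. (f has_vector_derivative f' x) (at x)" "\<forall>x\<in>S. (g has_vector_derivative g' x) (at x)"
      "Ck_on k S f'" "Ck_on k S g'" by auto
    have "nderiv s (\<lambda>x. f x + g x) x = nderiv t (\<lambda>x. f' x + g' x) x"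
      unfolding Suc using * \<open>x \<in> S\<close>
      by (intro nderiv_Suc_eq[OF assms(1)]) (auto intro: has_vector_derivative_add)
    also have "\<dots> = nderiv t f' x + nderiv t g' x"
      using * Suc.prems Suc by (intro Suc.IH) auto
    also have "\<dots> = nderiv s f x + nderiv s g x"
      unfolding Suc using * \<open>x \<in> S\<close> nderiv_Suc_eq[OF assms(1)] by metis
    finally show ?thesis .
  qed simp
qed simp

lemma nderiv_bounded_linear:
  assumes "bounded_linear h" "open S" "Ck_on k S f" "s \<le> k" "x \<in> S"
  shows "nderiv s (\<lambda>x. h (f x)) x = h (nderiv s f x)"
  using assms(3-5)
proof (induction k arbitrary: f s)
  case (Suc k)
  show ?case
  proof (cases s)
    case (Suc t)
    from Suc.prems obtain f' where *:
      "\<forall>x\<in>S. (f has_vector_derivative f' x) (at x)" "Ck_on k S f'" by auto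
    have "nderiv s (\<lambda>x. h (f x)) x = nderiv t (\<lambda>x. h (f' x)) x"
      unfolding Suc using * \<open>x \<in> S\<close>
      by (intro nderiv_Suc_eq[OF assms(2)])
        (auto intro: bounded_linear.has_vector_derivative[OF assms(1)])
    also have "\<dots> = h (nderiv t f' x)"
      using * Suc.prems Suc by (intro Suc.IH) auto
    also have "\<dots> = h (nderiv s f x)"
      unfolding Suc using * \<open>x \<in> S\<close> nderiv_Suc_eq[OF assms(2)] by metis
    finally show ?thesis .
  qed simp
qed simp

lemma Ck_on_bounded_linear:
  assumes "bounded_linear h" "Ck_on k S f"
  shows "Ck_on k S (\<lambda>x. h (f x))"
  using assms(2)
proof (induction k arbitrary: f)
  case 0
  then show ?case using bounded_linear.continuous_on[OF assms(1)] by auto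
next
  case (Suc k)
  then obtain f' where *: "\<forall>x\<in>S. (f has_vector_derivative f' x) (at x)" "Ck_on k S f'" by auto
  then have "\<forall>x\<in>S. ((\<lambda>x. h (f x)) has_vector_derivative h (f' x)) (at x)"
    using bounded_linear.has_vector_derivative[OF assms(1)] by blast
  then show ?case using Suc.IH[OF *(2)] unfolding Ck_on.simps by (metis (no_types))
qed

lemma nderiv_const_0: "nderiv s (\<lambda>x. 0) x = 0"
  by (induction s) (auto simp: nderiv_Suc)

lemma nderiv_sum:
  assumes "open S" "finite I" "\<And>i. i \<in> I \<Longrightarrow> Ck_on k S (f i)" "s \<le> k" "x \<in> S"
  shows "nderiv s (\<lambda>x. \<Sum>i\<in>I. f i x) x = (\<Sum>i\<in>I. nderiv s (f i) x)"
  using assms(2,3)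
proof (induction I rule: finite_induct)
  case (insert i I)
  have "nderiv s (\<lambda>x. f i x + (\<Sum>i\<in>I. f i x)) x
      = nderiv s (f i) x + nderiv s (\<lambda>x. \<Sum>i\<in>I. f i x) x"
    using insert by (intro nderiv_add[OF assms(1) _ _ assms(4,5)] Ck_on_sum) auto
  with insert show ?case by simp
qed (simp add: nderiv_const_0)

text \<open>The Leibniz rule, in the weak form that vanishing jets are preserved by multiplication.\<close>

lemma jets_vanish_scaleR:
  fixes h :: "real \<Rightarrow> real"
  assumes "open S" "Ck_on k S h" "Ck_on k S f" "x \<in> S" "\<forall>s\<le>k. nderiv s f x = 0"
  shows "\<forall>s\<le>k. nderiv s (\<lambda>x. h x *\<^sub>R f x) x = 0"
  using assms(2,3,5)
proof (induction k arbitrary: h f)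
  case (Suc k)
  from Suc.prems obtain f' h' where *:
    "\<forall>x\<in>S. (f has_vector_derivative f' x) (at x)" "\<forall>x\<in>S. (h has_vector_derivative h' x) (at x)"
    "Ck_on k S f'" "Ck_on k S h'" by auto
  have f: "Ck_on k S f" and h: "Ck_on k S h" using Suc.prems Ck_on_Suc_imp by blast+
  have van': "\<forall>s\<le>k. nderiv s f' x = 0"
    using Suc.prems(3) * nderiv_Suc_eq[OF assms(1) _ assms(4), of f f'] by (metis Suc_le_mono)
  have van: "\<forall>s\<le>k. nderiv s f x = 0"
    using Suc.prems(3) by auto
  show ?case
  proof safe
    fix s assume "s \<le> Suc k"
    show "nderiv s (\<lambda>x. h x *\<^sub>R f x) x = 0"
    proof (cases s)
      case 0
      then show ?thesis using Suc.prems(3) by (metis le0 nderiv_0 scaleR_zero_right)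
    next
      case (Suc t)
      with \<open>s \<le> Suc k\<close> have t: "t \<le> k" by simp
      have "nderiv s (\<lambda>x. h x *\<^sub>R f x) x = nderiv t (\<lambda>x. h x *\<^sub>R f' x + h' x *\<^sub>R f x) x"
        unfolding Suc using * assms(4)
        by (intro nderiv_Suc_eq[OF assms(1)])
          (auto intro!: has_vector_derivative_scaleR simp: has_real_derivative_iff_has_vector_derivative)
      also have "\<dots> = nderiv t (\<lambda>x. h x *\<^sub>R f' x) x + nderiv t (\<lambda>x. h' x *\<^sub>R f x) x"
        using * f h by (intro nderiv_add[OF assms(1) _ _ t assms(4)] Ck_on_scaleR)
      also have "\<dots> = 0"
        using Suc.IH[OF h *(3) van'] Suc.IH[OF *(4) f van] t by simp
      finally show ?thesis .
    qed
  qed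
qed auto

text \<open>Links the global smoothness in the definitions to the relative notion. The latter is
  wanted on open unit intervals, where a spline is C^(m-1) although only C^(m-2) on the
  line.\<close>

lemma Ck_iff_Ck_on:
  fixes f :: "real \<Rightarrow> 'a::real_normed_vector"
  shows "Ck k f \<longleftrightarrow> Ck_on k UNIV f"
proof (induction k arbitrary: f)
  case (Suc k)
  have eq: "nderiv (Suc i) f = nderiv i (\<lambda>x. vector_derivative f (at x))" for i
    by (rule nderiv_Suc)
  have "Ck (Suc k) f \<longleftrightarrow>
    (\<forall>x. f differentiable at x) \<and> Ck k (\<lambda>x. vector_derivative f (at x))"
    unfolding Ck_def eq[symmetric] by (force simp: All_less_Suc2)
  also have "\<dots> \<longleftrightarrow> Ck_on (Suc k) UNIV f"
  proof
    assume *: "(\<forall>x. f differentiable at x) \<and> Ck k (\<lambda>x. vector_derivative f (at x))"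
    then have "\<forall>x\<in>UNIV. (f has_vector_derivative vector_derivative f (at x)) (at x)"
      by (simp add: vector_derivative_works)
    then show "Ck_on (Suc k) UNIV f"
      using * Suc unfolding Ck_on.simps by (metis (no_types))
  next
    assume "Ck_on (Suc k) UNIV f"
    then obtain f' where f': "\<forall>x\<in>UNIV. (f has_vector_derivative f' x) (at x)" "Ck_on k UNIV f'"
      by auto
    then have "(\<lambda>x. vector_derivative f (at x)) = f'"
      by (auto intro: vector_derivative_at)
    then show "(\<forall>x. f differentiable at x) \<and> Ck k (\<lambda>x. vector_derivative f (at x))"
      using f' Suc by (auto intro: differentiableI_vector)
  qed
  finally show ?case .
qed (simp add: Ck_def)

subsection \<open>Dual functionals and jets\<close>

text \<open>Independent functions are separated by evaluations, so the dual basis can be found among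
  combinations of finitely many evaluations; the induction is a Gram-Schmidt process. The set of
  evaluation points is abstract: it is used once with points of the unit interval and once with
  derivative orders at a fixed point.\<close>

lemma dual_functionals:
  fixes g :: "'i \<Rightarrow> 'x \<Rightarrow> real"
  assumes "finite I"
    and "\<And>a. \<forall>x\<in>S. (\<Sum>i\<in>I. a i * g i x) = 0 \<Longrightarrow> \<forall>i\<in>I. a i = 0"
  shows "\<exists>Z b. finite Z \<and> Z \<subseteq> S \<and>
           (\<forall>i\<in>I. \<forall>k\<in>I. (\<Sum>z\<in>Z. b i z * g k z) = (if i = k then 1 else 0))"
  using assms
proof (induction I rule: finite_induct)
  case empty
  show ?case by (rule exI[of _ "{}"]) simp
next
  case (insert j I)
  have ind: "\<forall>i\<in>I. a i = 0" if "\<forall>x\<in>S. (\<Sum>i\<in>I. a i * g i x) = 0" for a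
  proof -
    have "(\<Sum>i\<in>I. (if i = j then 0 else a i) * g i x) = (\<Sum>i\<in>I. a i * g i x)" for x
      using insert.hyps by (intro sum.cong) auto
    then have "\<forall>i\<in>insert j I. (if i = j then 0 else a i) = 0"
      using that by (intro insert.prems) (simp add: insert.hyps)
    then show ?thesis using insert.hyps by (metis insertCI)
  qed
  from insert.IH[OF ind] obtain Z b where Z: "finite Z" "Z \<subseteq> S" and
    b: "\<And>i k. i \<in> I \<Longrightarrow> k \<in> I \<Longrightarrow> (\<Sum>z\<in>Z. b i z * g k z) = (if i = k then 1 else 0)"
    by blast
  define L where "L i h = (\<Sum>z\<in>Z. b i z * h z)" for i and h :: "'x \<Rightarrow> real"
  \<comment> \<open>The residual of \<open>g j\<close> after its expansion through the functionals
    already found. Independence prevents it from vanishing on \<open>S\<close>.\<close>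
  define r where "r x = g j x - (\<Sum>i\<in>I. L i (g j) * g i x)" for x
  have "\<exists>x0\<in>S. r x0 \<noteq> 0"
  proof (rule ccontr)
    assume "\<not> ?thesis"
    then have "\<forall>x\<in>S. (\<Sum>i\<in>insert j I. (if i = j then 1 else - L i (g j)) * g i x) = 0"
    proof -
      have "(\<Sum>i\<in>insert j I. (if i = j then 1 else - L i (g j)) * g i x) = r x" for x
      proof -
        have "(\<Sum>i\<in>I. (if i = j then 1 else - L i (g j)) * g i x) = (\<Sum>i\<in>I. - (L i (g j) * g i x))"
          using insert.hyps by (intro sum.cong) auto
        then show ?thesis using insert.hyps by (simp add: r_def sum_negf)
      qed
      then show ?thesis using \<open>\<not> (\<exists>x0\<in>S. r x0 \<noteq> 0)\<close> by simp
    qed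
    from insert.prems[OF this] show False by auto
  qed
  then obtain x0 where x0: "x0 \<in> S" "r x0 \<noteq> 0" by blast
  \<comment> \<open>The old weights extended by zero, which also covers the case that
    \<open>x0\<close> already lies in \<open>Z\<close>.\<close>
  define b0 where "b0 i z = (if z \<in> Z then b i z else 0)" for i z
  define Z' where "Z' = insert x0 Z"
  have finZ': "finite Z'" "Z' \<subseteq> S" using Z x0 by (auto simp: Z'_def)
  have L0: "(\<Sum>z\<in>Z'. b0 i z * h z) = L i h" for i h
    unfolding L_def b0_def using finZ' by (intro sum.mono_neutral_cong_right) (auto simp: Z'_def)
  \<comment> \<open>Evaluation at \<open>x0\<close> of the residual of a function, normalized by
    \<open>r x0\<close>. It kills each \<open>g k\<close> with \<open>k\<close> in \<open>I\<close>,
    because such a function equals its own expansion.\<close>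
  define bj where "bj z = ((if z = x0 then 1 else 0) - (\<Sum>i\<in>I. g i x0 * b0 i z)) / r x0" for z
  have Lj: "(\<Sum>z\<in>Z'. bj z * h z) = (h x0 - (\<Sum>i\<in>I. g i x0 * L i h)) / r x0" for h
  proof -
    have "(\<Sum>z\<in>Z'. bj z * h z) = (\<Sum>z\<in>Z'. (if z
        = x0 then h z else 0) - (\<Sum>i\<in>I. g i x0 * (b0 i z * h z))) / r x0"
      unfolding bj_def sum_divide_distrib
      by (intro sum.cong) (auto simp: algebra_simps sum_distrib_left sum_distrib_right diff_divide_distrib)
    also have "(\<Sum>z\<in>Z'. (if z = x0 then h z else 0) - (\<Sum>i\<in>I. g i x0 * (b0 i z * h z)))
       = h x0 - (\<Sum>z\<in>Z'. \<Sum>i\<in>I. g i x0 * (b0 i z * h z))"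
      using finZ' by (simp add: sum_subtractf Z'_def)
    also have "(\<Sum>z\<in>Z'. \<Sum>i\<in>I. g i x0 * (b0 i z * h z)) = (\<Sum>i\<in>I. g i x0 * L i h)"
      by (subst sum.swap) (simp add: sum_distrib_left flip: L0)
    finally show ?thesis .
  qed
  have LI: "L i (g k) = (if i = k then 1 else 0)" if "i \<in> I" "k \<in> I" for i k
    unfolding L_def using b that by auto
  have Ljk: "(\<Sum>z\<in>Z'. bj z * g k z) = (if k = j then 1 else 0)" if "k \<in> insert j I" for k
  proof (cases "k = j")
    case True
    then show ?thesis unfolding Lj using x0 by (simp add: r_def mult.commute)
  next
    case False
    with that have k: "k \<in> I" by auto
    have "(\<Sum>i\<in>I. g i x0 * L i (g k)) = (\<Sum>i\<in>I. if i = k then g i x0 else 0)"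
      using k LI by (intro sum.cong) auto
    also have "\<dots> = g k x0" using k insert.hyps by simp
    finally show ?thesis unfolding Lj using False by simp
  qed
  \<comment> \<open>The old functionals are corrected by multiples of the new one so that they
    vanish on \<open>g j\<close>.\<close>
  define b' where "b' i z = (if i = j then bj z else b0 i z - L i (g j) * bj z)" for i z
  have "(\<Sum>z\<in>Z'. b' i z * g k z) = (if i = k then 1 else 0)" if "i \<in> insert j I" "k \<in> insert j I" for i k
  proof (cases "i = j")
    case True
    then show ?thesis using Ljk[OF that(2)] by (simp add: b'_def)
  next
    case False
    have "(\<Sum>z\<in>Z'. b' i z * g k z) = (\<Sum>z\<in>Z'. b0 i z * g k z) - L i (g j) * (\<Sum>z\<in>Z'. bj z * g k z)"
      using False by (simp add: b'_def sum_subtractf sum_distrib_left algebra_simps)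
    also have "\<dots> = (if i = k then 1 else 0)"
      unfolding L0 Ljk[OF that(2)] using False that LI[of i k] by auto
    finally show ?thesis .
  qed
  with finZ' show ?case by blast
qed

text \<open>Dividing by a nonvanishing member of the family and differentiating removes one function
  and one derivative, as in the reduction formula for Wronskian determinants.\<close>

lemma jets_independent_at_point:
  fixes g :: "nat \<Rightarrow> real \<Rightarrow> real"
  assumes "a < b"
    and "\<And>i. i < n \<Longrightarrow> Ck_on (n - 1) {a<..<b} (g i)"
    and "\<And>a' b' c. a \<le> a' \<Longrightarrow> a' < b' \<Longrightarrow> b' \<le> b \<Longrightarrow>
           \<forall>x\<in>{a'<..<b'}. (\<Sum>i<n. c i * g i x) = 0 \<Longrightarrow> \<forall>i<n. c i = 0"
  shows "\<exists>y\<in>{a<..<b}. \<forall>c. (\<forall>s<n. nderiv s (\<lambda>x. \<Sum>i<n. c i * g i x) y = 0) \<longrightarrow> (\<forall>i<n. c i = 0)"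
  using assms
proof (induction n arbitrary: a b g)
  case 0
  then show ?case using dense by auto
next
  case (Suc n)
  have "\<exists>y0\<in>{a<..<b}. g 0 y0 \<noteq> 0"
  proof (rule ccontr)
    assume "\<not> ?thesis"
    then have "\<forall>x\<in>{a<..<b}. (\<Sum>i<Suc n. (if i = 0 then 1 else 0) * g i x) = 0"
      by (simp add: if_distrib[of "\<lambda>c. c * _"] cong: if_cong)
    from Suc.prems(3)[OF _ _ _ this] show False using Suc.prems(1) by force
  qed
  then obtain y0 where y0: "y0 \<in> {a<..<b}" "g 0 y0 \<noteq> 0" by blast
  have "continuous_on {a<..<b} (g 0)"
    using Suc.prems(2)[of 0] Ck_on_imp_continuous_on by auto
  then have "open ({x\<in>{a<..<b}. g 0 x \<noteq> 0})"
    using continuous_on_open_vimage[of "{a<..<b}" "g 0"] open_Compl[OF closed_singleton[of "0::real"]]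
    by (auto simp: vimage_def Int_def conj_commute dest!: spec[of _ "- {0}"])
  moreover have "y0 \<in> {x\<in>{a<..<b}. g 0 x \<noteq> 0}" using y0 by auto
  ultimately obtain e where e: "e > 0" "ball y0 e \<subseteq> {x\<in>{a<..<b}. g 0 x \<noteq> 0}"
    using open_contains_ball by meson
  define a1 b1 where "a1 = y0 - e" and "b1 = y0 + e"
  have S1: "{a1<..<b1} = ball y0 e" by (auto simp: a1_def b1_def ball_def dist_real_def abs_less_iff)
  have ab1: "a1 < b1" using e by (simp add: a1_def b1_def)
  have sub: "{a1<..<b1} \<subseteq> {a<..<b}" using e S1 by auto
  then have ab: "a \<le> a1" "b1 \<le> b" using ab1
      by (auto simp: greaterThanLessThan_subseteq_greaterThanLessThan)
  have nz: "g 0 x \<noteq> 0" if "x \<in> {a1<..<b1}" for x using that e S1 by auto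
  have gC: "Ck_on n {a1<..<b1} (g i)" if "i < Suc n" for i
    using Suc.prems(2)[OF that] sub Ck_on_subset by auto
  define q where "q i x = inverse (g 0 x) * g i x" for i x
  have qC: "Ck_on n {a1<..<b1} (q i)" if "i < Suc n" for i
    unfolding q_def using gC nz that by (intro Ck_on_mult Ck_on_inverse) auto
  have "\<exists>h. (\<forall>x\<in>{a1<..<b1}. (q (Suc i) has_vector_derivative h x) (at x)) \<and>
          Ck_on (n - 1) {a1<..<b1} h" if "i < n" for i
    using qC[of "Suc i"] that by (cases n) auto
  then obtain h where h: "\<And>i x. i < n \<Longrightarrow> x \<in> {a1<..<b1} \<Longrightarrow> (q (Suc i) has_vector_derivative h i x) (at x)"
    "\<And>i. i < n \<Longrightarrow> Ck_on (n - 1) {a1<..<b1} (h i)" by metis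
  have q_sum: "(\<Sum>i<Suc n. c i * q i x) = c 0 + (\<Sum>i<n. c (Suc i) * q (Suc i) x)"
    if "x \<in> {a1<..<b1}" for c :: "nat \<Rightarrow> real" and x
    using nz[OF that] by (simp add: sum.lessThan_Suc_shift q_def del: sum.lessThan_Suc)
  have deriv_sum: "((\<lambda>x. \<Sum>i<n. c i * q (Suc i) x) has_vector_derivative (\<Sum>i<n. c i * h i x)) (at x)"
    if "x \<in> {a1<..<b1}" for c :: "nat \<Rightarrow> real" and x
    using h(1) that by (intro has_vector_derivative_sum)
      (auto simp flip: has_real_derivative_iff_has_vector_derivative intro!: DERIV_cmult)
  \<comment> \<open>Independence is assumed on all subintervals, which allows the passage to an
    interval without zeros of \<open>g 0\<close> and is itself inherited by the derivatives
    \<open>h\<close> of the quotients.\<close>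
  have "\<exists>y\<in>{a1<..<b1}. \<forall>c. (\<forall>s<n. nderiv s (\<lambda>x. \<Sum>i<n. c i * h i x) y = 0) \<longrightarrow> (\<forall>i<n. c i = 0)"
  proof (rule Suc.IH[OF ab1 h(2)])
    fix a' b' and c :: "nat \<Rightarrow> real"
    assume *: "a1 \<le> a'" "a' < b'" "b' \<le> b1" "\<forall>x\<in>{a'<..<b'}. (\<Sum>i<n. c i * h i x) = 0"
    have "(\<lambda>x. \<Sum>i<n. c i * q (Suc i) x) constant_on {a'<..<b'}"
    proof (rule has_field_derivative_0_imp_constant_on)
      fix x assume "x \<in> {a'<..<b'}"
      then show "((\<lambda>x. \<Sum>i<n. c i * q (Suc i) x) has_field_derivative 0) (at x)"
        using deriv_sum[of x c] * by (auto simp: has_real_derivative_iff_has_vector_derivative)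
    qed auto
    then obtain C where C: "\<And>x. x \<in> {a'<..<b'} \<Longrightarrow> (\<Sum>i<n. c i * q (Suc i) x) = C"
      by (auto simp: constant_on_def)
    \<comment> \<open>A combination of the \<open>h i\<close> that vanishes makes the combination of
      quotients a constant \<open>C\<close>; multiplied back by \<open>g 0\<close>, this is a linear
      relation in which \<open>g 0\<close> has coefficient \<open>- C\<close>.\<close>
    define c' where "c' i = (case i of 0 \<Rightarrow> - C | Suc i \<Rightarrow> c i)" for i
    have "(\<Sum>i<Suc n. c' i * g i x) = 0" if x: "x \<in> {a'<..<b'}" for x
    proof -
      have x1: "x \<in> {a1<..<b1}" using x * by auto
      have "(\<Sum>i<Suc n. c' i * g i x) = g 0 x * (\<Sum>i<Suc n. c' i * q i x)"
        using nz[OF x1] by (simp add: q_def sum_distrib_left field_simps del: sum.lessThan_Suc)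
      also have "(\<Sum>i<Suc n. c' i * q i x) = 0"
        using q_sum[OF x1] C[OF x] by (simp add: c'_def)
      finally show ?thesis by simp
    qed
    then have "\<forall>i<Suc n. c' i = 0"
      using * ab by (intro Suc.prems(3)[of a' b']) auto
    then show "\<forall>i<n. c i = 0" by (auto simp: c'_def dest: spec[of _ "Suc _"])
  qed
  then obtain y where y: "y \<in> {a1<..<b1}"
    "\<And>c. \<forall>s<n. nderiv s (\<lambda>x. \<Sum>i<n. c i * h i x) y = 0 \<Longrightarrow> \<forall>i<n. c i = 0" by blast
  have "\<forall>i<Suc n. c i = 0" if c: "\<forall>s<Suc n. nderiv s (\<lambda>x. \<Sum>i<Suc n. c i * g i x) y = 0" for c
  proof -
    \<comment> \<open>Division by \<open>g 0\<close> keeps the jet zero and turns the first term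
      into the constant \<open>c 0\<close>, which one differentiation removes.\<close>
    have j1: "\<forall>s\<le>n. nderiv s (\<lambda>x. inverse (g 0 x) *\<^sub>R (\<Sum>i<Suc n. c i * g i x)) y = 0"
      using c gC nz y(1)
      by (intro jets_vanish_scaleR[of "{a1<..<b1}"] Ck_on_sum Ck_on_mult Ck_on_inverse Ck_on_const) auto
    have j2: "nderiv s (\<lambda>x. inverse (g 0 x) *\<^sub>R (\<Sum>i<Suc n. c i * g i x)) y
       = nderiv s (\<lambda>x. c 0 + (\<Sum>i<n. c (Suc i) * q (Suc i) x)) y" for s
    proof (rule nderiv_cong_open[OF open_greaterThanLessThan _ y(1)])
      fix x assume x: "x \<in> {a1<..<b1}"
      show "inverse (g 0 x) *\<^sub>R (\<Sum>i<Suc n. c i * g i x) = c 0 + (\<Sum>i<n. c (Suc i) * q (Suc i) x)"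
        unfolding q_sum[OF x, symmetric]
        by (simp add: q_def sum_distrib_left algebra_simps del: sum.lessThan_Suc)
    qed
    have j3: "nderiv (Suc s) (\<lambda>x. c 0 + (\<Sum>i<n. c (Suc i) * q (Suc i) x)) y
       = nderiv s (\<lambda>x. \<Sum>i<n. c (Suc i) * h i x) y" for s
    proof (rule nderiv_Suc_eq[OF open_greaterThanLessThan _ y(1)])
      fix x assume "x \<in> {a1<..<b1}"
      from has_vector_derivative_add[OF has_vector_derivative_const deriv_sum[OF this]]
      show "((\<lambda>x. c 0 + (\<Sum>i<n. c (Suc i) * q (Suc i) x)) has_vector_derivative
              (\<Sum>i<n. c (Suc i) * h i x)) (at x)" by simp
    qed
    have "\<forall>s<n. nderiv s (\<lambda>x. \<Sum>i<n. c (Suc i) * h i x) y = 0"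
      using j1 unfolding j2 j3[symmetric] by auto
    from y(2)[OF this] have *: "\<forall>i<n. c (Suc i) = 0" .
    then have "c 0 * g 0 y = 0"
      using c[rule_format, of 0] by (simp add: sum.lessThan_Suc_shift del: sum.lessThan_Suc)
    then have "c 0 = 0" using nz y(1) by auto
    with * show ?thesis by (metis less_Suc_eq_0_disj)
  qed
  then show ?case using y(1) sub by blast
qed

subsection \<open>Quasi-derivatives and linear independence of translates\<close>

text \<open>A substitute for the mean value theorem when differentiability may fail at integers: if
  \<open>h\<close> were nonpositive at all other points, the fundamental theorem of calculus with
  finitely many exceptional points would make \<open>g b - g a\<close> nonpositive.\<close>

lemma pos_derivative_point:
  fixes g h v :: "real \<Rightarrow> real"
  assumes "a \<le> b" "continuous_on {a..b} g"
    and deriv: "\<And>x. x \<in> {a<..<b} \<Longrightarrow> x \<notin> \<int> \<Longrightarrow> (g has_real_derivative v x * h x) (at x)"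
    and v: "\<And>x. v x > 0" and less: "g a < g b"
  shows "\<exists>x\<in>{a<..<b}. x \<notin> \<int> \<and> h x > 0"
proof (rule ccontr)
  assume neg: "\<not> ?thesis"
  define G where "G x = (if x \<in> {a<..<b} - \<int> then v x * h x else 0)" for x
  have "finite (real_of_int ` {\<lfloor>a\<rfloor>..\<lceil>b\<rceil>})" by simp
  moreover have "{a<..<b} \<inter> \<int> \<subseteq> real_of_int ` {\<lfloor>a\<rfloor>..\<lceil>b\<rceil>}"
    by (auto elim!: Ints_cases simp: floor_le_iff le_ceiling_iff)
  ultimately have fin: "finite ({a<..<b} \<inter> \<int>)" by (rule finite_subset[rotated])
  have "(G has_integral (g b - g a)) {a..b}"
  proof (rule fundamental_theorem_of_calculus_interior_strong[OF fin assms(1) _ assms(2)])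
    fix x assume "x \<in> {a<..<b} - {a<..<b} \<inter> \<int>"
    then show "(g has_vector_derivative G x) (at x)"
      using deriv[of x] by (simp add: G_def has_real_derivative_iff_has_vector_derivative)
  qed
  moreover have "G x \<le> 0" for x
    using neg v[of x] by (auto simp: G_def not_less intro!: mult_nonneg_nonpos)
  then have "((\<lambda>x. 0) has_integral 0) {a..b}" "\<And>x. x \<in> {a..b} \<Longrightarrow> G x \<le> 0" by auto
  ultimately have "g b - g a \<le> 0" using has_integral_le by blast
  with less show False by simp
qed

text \<open>Rolle's theorem with signs. The n + 1 alternating values of \<open>g\<close> and the two
  zeros at the ends bound n + 2 intervals on which \<open>g\<close> rises and falls in turn; since
  \<open>v\<close> is positive, \<open>h\<close> takes the corresponding signs there.\<close>

lemma alternation_step: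
  fixes g h v :: "real \<Rightarrow> real" and t :: "nat \<Rightarrow> real" and \<sigma> :: real
  assumes cont: "continuous_on UNIV g"
    and deriv: "\<And>x. x \<notin> \<int> \<Longrightarrow> (g has_real_derivative v x * h x) (at x)"
    and v: "\<And>x. v x > 0" and ga: "g a = 0" and gb: "g b = 0"
    and t: "\<And>i. i < n \<Longrightarrow> t i < t (Suc i)" "a < t 0" "t n < b"
    and alt: "\<And>i. i \<le> n \<Longrightarrow> \<sigma> * (-1) ^ i * g (t i) > 0"
  shows "\<exists>u. (\<forall>i<Suc n. u i < u (Suc i)) \<and> a < u 0 \<and> u (Suc n) < b \<and>
           (\<forall>i\<le>Suc n. u i \<notin> \<int> \<and> \<sigma> * (-1) ^ i * h (u i) > 0)"
proof -
  \<comment> \<open>The partition \<open>a\<close>, \<open>t 0\<close>, ..., \<open>t n\<close>,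
    \<open>b\<close>. On its \<open>i\<close>-th interval the function
    \<open>\<sigma> * (-1) ^ i * g\<close> has a larger value at the right end than at the left
    end.\<close>
  define s where "s i = (if i = 0 then a else if i \<le> Suc n then t (i - 1) else b)" for i
  have "\<exists>x\<in>{s i<..<s (Suc i)}. x \<notin> \<int> \<and> \<sigma> * (-1) ^ i * h x > 0" if i: "i \<le> Suc n" for i
  proof (rule pos_derivative_point[where v = v and g = "\<lambda>x. \<sigma> * (-1) ^ i * g x"])
    consider "i = 0" | j where "i = Suc j" "j < n" | "i = Suc n"
      using i by (cases i) (auto simp: le_Suc_eq less_le)
    note cs = this
    show "s i \<le> s (Suc i)"
      using cs by cases (use t in \<open>auto simp: s_def less_imp_le\<close>)
    show "\<sigma> * (-1) ^ i * g (s i) < \<sigma> * (-1) ^ i * g (s (Suc i))"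
      using cs
    proof cases
      case 1
      then show ?thesis using alt[of 0] ga by (simp add: s_def)
    next
      case (2 j)
      then show ?thesis using alt[of j] alt[of "Suc j"] by (simp add: s_def)
    next
      case 3
      then show ?thesis using alt[of n] gb by (simp add: s_def)
    qed
    show "continuous_on {s i..s (Suc i)} (\<lambda>x. \<sigma> * (-1) ^ i * g x)"
      by (intro continuous_intros continuous_on_subset[OF cont]) auto
    show "((\<lambda>x. \<sigma> * (-1) ^ i * g x) has_real_derivative v x * (\<sigma> * (-1) ^ i * h x)) (at x)"
      if "x \<notin> \<int>" for x
      using DERIV_cmult[OF deriv[OF that], of "\<sigma> * (-1) ^ i"] by (simp add: mult_ac)
  qed (rule v)
  then obtain u where u: "\<And>i. i \<le> Suc n \<Longrightarrow> u i \<in> {s i<..<s (Suc i)}"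
    "\<And>i. i \<le> Suc n \<Longrightarrow> u i \<notin> \<int> \<and> \<sigma> * (-1) ^ i * h (u i) > 0" by metis
  have "u i < u (Suc i)" if "i < Suc n" for i
    using u(1)[of i] u(1)[of "Suc i"] that by auto
  moreover have "a < u 0" using u(1)[of 0] by (simp add: s_def)
  moreover have "u (Suc n) < b" using u(1)[of "Suc n"] by (simp add: s_def)
  ultimately show ?thesis using u(2) by blast
qed

section \<open>Quasi-periodic weights and the associated quasi-derivatives\<close>

locale PEB_system =
  fixes m :: nat and w :: "nat \<Rightarrow> real \<Rightarrow> real" and \<kappa> :: "nat \<Rightarrow> real"
  assumes m_pos: "m \<ge> 1"
    and w_smooth: "s \<in> {1..m} \<Longrightarrow> Ck_on (m - s) UNIV (w s)"
    and w_pos: "s \<in> {1..m} \<Longrightarrow> w s x > 0"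
    and w_shift: "s \<in> {1..m} \<Longrightarrow> w s (x + 1) = \<kappa> s * w s x"
begin

lemma w_shift_nat: "s \<in> {1..m} \<Longrightarrow> w s (x + real i) = \<kappa> s ^ i * w s x"
proof (induction i)
  case (Suc i)
  have "w s (x + real (Suc i)) = w s ((x + real i) + 1)" by (simp add: add_ac)
  with Suc w_shift show ?case by simp
qed simp

text \<open>A function \<open>w 1 * H 0\<close> together with its successive quasi-derivatives: divide by the
  current weight, then differentiate.\<close>

definition tower :: "(nat \<Rightarrow> real \<Rightarrow> real) \<Rightarrow> bool" where
  "tower H \<longleftrightarrow>
     (\<forall>j. j + 1 < m \<longrightarrow> continuous_on UNIV (H j) \<and>
        (\<forall>x. x \<notin> \<int> \<longrightarrow> (H j has_real_derivative w (j + 2) x * H (j + 1) x) (at x))) \<and>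
     (\<forall>x y. x \<notin> \<int> \<longrightarrow> y \<notin> \<int> \<longrightarrow> \<lfloor>x\<rfloor> = \<lfloor>y\<rfloor> \<longrightarrow> H (m - 1) x = H (m - 1) y)"

text \<open>Rolle's theorem produces one more sign change for each quasi-derivative, but the last one is
  constant on each of fewer than \<open>m\<close> unit intervals.\<close>

lemma tower_short_support:
  fixes a :: int
  assumes H: "tower H" and k: "k < m"
    and supp: "\<And>j x. j + 1 < m \<Longrightarrow> x \<notin> {real_of_int a<..<real_of_int a + real k} \<Longrightarrow> H j x = 0"
    and supp0: "\<And>x. x \<notin> \<int> \<Longrightarrow> x \<notin> {real_of_int a<..<real_of_int a + real k} \<Longrightarrow> H 0 x = 0"
    and x: "x \<notin> \<int>"
  shows "H 0 x = 0"
proof (rule ccontr)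
  assume nz: "H 0 x \<noteq> 0"
  let ?b = "real_of_int a + real k"
  define \<sigma> where "\<sigma> = sgn (H 0 x)"
  \<comment> \<open>At level \<open>j\<close> there are \<open>j + 1\<close> alternating values. The
    two ends of the support serve as the additional zeros each time, since every level but the last
    vanishes there.\<close>
  have "\<exists>t :: nat \<Rightarrow> real. (\<forall>i<j. t i < t (Suc i)) \<and> a < t 0 \<and> t j < ?b \<and>
           (\<forall>i\<le>j. t i \<notin> \<int> \<and> \<sigma> * (-1) ^ i * H j (t i) > 0)" if "j < m" for j
    using that
  proof (induction j)
    case 0
    have "x \<in> {real_of_int a<..<?b}" using supp0[OF x] nz by blast
    moreover have "\<sigma> * H 0 x > 0" using nz by (simp add: \<sigma>_def sgn_if)
    ultimately show ?case using x by (intro exI[of _ "\<lambda>_. x"]) auto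
  next
    case (Suc j)
    then obtain t :: "nat \<Rightarrow> real" where t: "\<forall>i<j. t i < t (Suc i)" "a < t 0" "t j < ?b"
           "\<forall>i\<le>j. t i \<notin> \<int> \<and> \<sigma> * (-1) ^ i * H j (t i) > 0" by auto
    show ?case
    proof (rule alternation_step[where g = "H j" and v = "w (j + 2)" and t = t])
      show "continuous_on UNIV (H j)" using H Suc.prems by (simp add: tower_def)
      show "(H j has_real_derivative w (j + 2) x * H (Suc j) x) (at x)" if "x \<notin> \<int>" for x
        using H Suc.prems that by (simp add: tower_def)
      show "w (j + 2) x > 0" for x using w_pos Suc.prems by simp
      show "H j a = 0" "H j ?b = 0" using supp[of j] Suc.prems by auto
    qed (use t in auto)
  qed
  from this[of "m - 1"] m_pos obtain t :: "nat \<Rightarrow> real" where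
    t: "\<And>i. i < m - 1 \<Longrightarrow> t i < t (Suc i)" "a < t 0" "t (m - 1) < ?b"
       "\<And>i. i \<le> m - 1 \<Longrightarrow> t i \<notin> \<int>" "\<And>i. i \<le> m - 1 \<Longrightarrow> \<sigma> * (-1) ^ i * H (m - 1) (t i) > 0"
    by auto
  have step_const: "H (m - 1) x = H (m - 1) y" if "x \<notin> \<int>" "y \<notin> \<int>" "\<lfloor>x\<rfloor> = \<lfloor>y\<rfloor>" for x y
    using H that unfolding tower_def by blast
  \<comment> \<open>The last level alternates in sign along the points but is constant on open unit
    intervals, so consecutive points have different integer parts. The points therefore spread over
    \<open>m\<close> unit intervals, one more than fits.\<close>
  have "a + int i \<le> \<lfloor>t i\<rfloor>" if "i \<le> m - 1" for i
    using that
  proof (induction i)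
    case 0
    then show ?case using t(2) by linarith
  next
    case (Suc i)
    have "\<lfloor>t i\<rfloor> \<noteq> \<lfloor>t (Suc i)\<rfloor>"
    proof
      assume "\<lfloor>t i\<rfloor> = \<lfloor>t (Suc i)\<rfloor>"
      then have "H (m - 1) (t i) = H (m - 1) (t (Suc i))"
        using step_const t(4) Suc.prems by (metis Suc_leD)
      moreover have "\<sigma> * (-1) ^ i * z = - (\<sigma> * (-1) ^ Suc i * z)" for z by simp
      moreover have "\<sigma> * (-1) ^ i * H (m - 1) (t i) > 0"
        using Suc.prems by (intro t(5)) simp
      ultimately show False
        using t(5)[OF Suc.prems] by (metis less_asym neg_0_less_iff_less)
    qed
    moreover have "\<lfloor>t i\<rfloor> \<le> \<lfloor>t (Suc i)\<rfloor>"
      using t(1)[of i] Suc.prems by (intro floor_mono) linarith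
    moreover have "a + int i \<le> \<lfloor>t i\<rfloor>" using Suc.IH Suc.prems by linarith
    ultimately show ?case by linarith
  qed
  from this[of "m - 1"] have "a + int (m - 1) \<le> \<lfloor>t (m - 1)\<rfloor>" by simp
  then have "real_of_int (a + int (m - 1)) \<le> t (m - 1)" by (simp only: le_floor_iff)
  moreover have "real k \<le> real (m - 1)" using k by simp
  ultimately show False using t(3) by simp
qed

text \<open>Integration gains one derivative, and the weight \<open>w i\<close> is one order
  smoother than \<open>w (i + 1)\<close>; the two balance, so the order of smoothness depends on the
  outermost index alone.\<close>

lemma iter_int_smooth:
  assumes "1 \<le> i" "i + k \<le> m + 1"
  shows "Ck_on (m + 1 - i) UNIV (iter_int w i k)"
    and "k = Suc l \<Longrightarrow>
      (iter_int w i k has_real_derivative w i x * iter_int w (Suc i) l x) (at x)"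
proof -
  have deriv: "(iter_int w i (Suc l) has_real_derivative w i x * iter_int w (Suc i) l x) (at x)"
    if "continuous_on UNIV (\<lambda>t. w i t * iter_int w (Suc i) l t)" for i l x
  proof -
    \<comment> \<open>An interval with both 0 and \<open>x\<close> in its interior: the fundamental
      theorem gives a derivative relative to the interval, which is then a two-sided one.\<close>
    define A where "A = - \<bar>x\<bar> - 1"
    define B where "B = \<bar>x\<bar> + 1"
    have "((\<lambda>u. LBINT t=0..ereal u. w i t * iter_int w (Suc i) l t) has_vector_derivative
        (w i x * iter_int w (Suc i) l x)) (at x within {A..B})"
      using interval_integral_FTC2[of A 0 B "\<lambda>t. w i t * iter_int w (Suc i) l t" x]
        continuous_on_subset[OF that] by (simp add: A_def B_def zero_ereal_def)
    moreover have "at x within {A..B} = at x"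
      by (rule at_within_interior) (auto simp: A_def B_def)
    moreover have "iter_int w i (Suc l) = (\<lambda>u. LBINT t=0..ereal u. w i t * iter_int w (Suc i) l t)"
      by auto
    ultimately show ?thesis
      by (simp add: has_real_derivative_iff_has_vector_derivative)
  qed
  have smooth: "Ck_on (m + 1 - i) UNIV (iter_int w i k)" if "1 \<le> i" "i + k \<le> m + 1" for i k
    using that
  proof (induction k arbitrary: i)
    case 0
    have "iter_int w i 0 = (\<lambda>x. 1)" by auto
    then show ?case by simp
  next
    case (Suc k)
    have "Ck_on (m - i) UNIV (\<lambda>t. w i t * iter_int w (Suc i) k t)"
      using Suc.IH[of "Suc i"] Suc.prems by (intro Ck_on_mult w_smooth) auto
    then have "Ck_on (Suc (m - i)) UNIV (iter_int w i (Suc k))"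
      using deriv[OF Ck_on_imp_continuous_on[of "m - i"], of i k]
      unfolding Ck_on.simps has_real_derivative_iff_has_vector_derivative
      by (intro exI[of _ "\<lambda>t. w i t * iter_int w (Suc i) k t"]) simp
    moreover have "m + 1 - i = Suc (m - i)" using Suc.prems by simp
    ultimately show ?case by (simp only:)
  qed
  show "Ck_on (m + 1 - i) UNIV (iter_int w i k)" using assms by (rule smooth)
  assume "k = Suc l"
  then have "Ck_on (m - i) UNIV (\<lambda>t. w i t * iter_int w (Suc i) l t)"
    using smooth[of "Suc i" l] assms by (intro Ck_on_mult w_smooth) auto
  from deriv[OF Ck_on_imp_continuous_on[OF this]] \<open>k = Suc l\<close>
  show "(iter_int w i k has_real_derivative w i x * iter_int w (Suc i) l x) (at x)" by simp
qed

text \<open>The \<open>j\<close>-th quasi-derivative of the element of the spline space with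
  coefficients \<open>\<alpha>\<close>, freed from its leading weight \<open>w (j + 1)\<close>. The
  coefficients with index at most \<open>j\<close> have been differentiated away.\<close>

definition quasi :: "(nat \<Rightarrow> real) \<Rightarrow> nat \<Rightarrow> real \<Rightarrow> real" where
  "quasi \<alpha> j x = (\<Sum>k<m - j. \<alpha> (j + 1 + k) * iter_int w (j + 2) k x)"

lemma quasi_smooth: "j < m \<Longrightarrow> Ck_on (m - 1 - j) UNIV (quasi \<alpha> j)"
  unfolding quasi_def
proof (intro Ck_on_sum Ck_on_mult Ck_on_const)
  fix k assume "j < m" "k \<in> {..<m - j}"
  then show "Ck_on (m - 1 - j) UNIV (iter_int w (j + 2) k)"
    using iter_int_smooth(1)[of "j + 2" k] by simp
qed auto

lemma quasi_deriv:
  assumes "j + 1 < m"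
  shows "(quasi \<alpha> j has_real_derivative w (j + 2) x * quasi \<alpha> (j + 1) x) (at x)"
proof -
  have eq: "m - j = Suc (m - (j + 1))" using assms by simp
  have "quasi \<alpha> j = (\<lambda>x. \<alpha> (j + 1) + (\<Sum>k<m - (j + 1). \<alpha> (j + 2 + k) * iter_int w (j + 2) (Suc k) x))"
    unfolding quasi_def eq sum.lessThan_Suc_shift by (simp del: iter_int.simps(2))
  moreover have "((\<lambda>x. \<alpha> (j + 1) + (\<Sum>k<m - (j + 1). \<alpha> (j + 2 + k) * iter_int w (j + 2) (Suc k) x))
     has_real_derivative 0 + (\<Sum>k<m - (j + 1). \<alpha> (j + 2 + k) * (w (j + 2) x * iter_int w (Suc (j + 2)) k x))) (at x)"
    using assms by (intro DERIV_add DERIV_const DERIV_sum DERIV_cmult iter_int_smooth(2)) auto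
  ultimately show ?thesis
    by (simp add: quasi_def sum_distrib_left mult_ac)
qed

lemma quasi_last: "quasi \<alpha> (m - 1) x = \<alpha> m"
  using m_pos by (simp add: quasi_def)

lemma quasi_0: "(\<Sum>s=1..m. \<alpha> s * PEB_basis w s x) = w 1 x * quasi \<alpha> 0 x"
proof -
  have "(\<Sum>s=1..m. \<alpha> s * PEB_basis w s x) = (\<Sum>k<m. \<alpha> (Suc k) * PEB_basis w (Suc k) x)"
    by (rule sum.reindex_bij_witness[of _ Suc "\<lambda>s. s - 1"]) auto
  then show ?thesis
    by (simp add: quasi_def PEB_basis_def sum_distrib_left mult_ac numeral_2_eq_2)
qed

lemma quasi_diff: "quasi (\<lambda>s. \<alpha> s - \<beta> s) j x = quasi \<alpha> j x - quasi \<beta> j x"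
  by (simp add: quasi_def sum_subtractf algebra_simps)

lemma quasi_zero_coeffs: "quasi (\<lambda>s. 0) j x = 0"
  by (simp add: quasi_def)

lemma w_quasi_smooth: "Ck_on (m - 1) UNIV (\<lambda>x. w 1 x * quasi \<alpha> 0 x)"
  using w_smooth[of 1] quasi_smooth[of 0] m_pos by (intro Ck_on_mult) auto

text \<open>Translates ordinary smoothness at a knot into the language of quasi-derivatives:
  division by a weight preserves vanishing jets and each differentiation costs one order, so at
  level \<open>j\<close> the jet of order \<open>m - 2 - j\<close> still vanishes.\<close>

lemma quasi_vanish:
  assumes m2: "m \<ge> 2" and van: "\<And>s. s \<le> m - 2 \<Longrightarrow> nderiv s (\<lambda>x. w 1 x * quasi \<alpha> 0 x) x = 0"
    and "j + 2 \<le> m"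
  shows "quasi \<alpha> j x = 0"
proof -
  have winv: "Ck_on (m - s) UNIV (\<lambda>x. inverse (w s x))" if "s \<in> {1..m}" for s
    using w_smooth[OF that] w_pos[OF that] by (intro Ck_on_inverse) (auto simp: less_le)
  have nz: "w s x \<noteq> 0" if "s \<in> {1..m}" for s x using w_pos[OF that, of x] by simp
  have "\<forall>s\<le>m - 2 - j. nderiv s (quasi \<alpha> j) x = 0" if "j + 2 \<le> m" for j
    using that
  proof (induction j)
    case 0
    have "\<forall>s\<le>m - 2. nderiv s (\<lambda>x. inverse (w 1 x) *\<^sub>R (w 1 x * quasi \<alpha> 0 x)) x = 0"
      using van m2 Ck_on_le[OF winv[of 1], of "m - 2"] Ck_on_le[OF w_quasi_smooth, of "m - 2"]
      by (intro jets_vanish_scaleR[OF open_UNIV]) auto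
    moreover have "(\<lambda>x. inverse (w 1 x) *\<^sub>R (w 1 x * quasi \<alpha> 0 x)) = quasi \<alpha> 0"
      using nz[of 1] m2 by auto
    ultimately show ?case by simp
  next
    case (Suc j)
    define D where "D x = w (j + 2) x * quasi \<alpha> (j + 1) x" for x
    have D: "nderiv (Suc s) (quasi \<alpha> j) x = nderiv s D x" for s
      using quasi_deriv[of j \<alpha>] Suc.prems
      by (intro nderiv_Suc_eq[OF open_UNIV])
        (auto simp: D_def has_real_derivative_iff_has_vector_derivative)
    have "\<forall>s\<le>m - 2 - Suc j. nderiv s (\<lambda>x. inverse (w (j + 2) x) *\<^sub>R D x) x = 0"
    proof (rule jets_vanish_scaleR[OF open_UNIV])
      show "Ck_on (m - 2 - Suc j) UNIV (\<lambda>x. inverse (w (j + 2) x))"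
        using winv[of "j + 2"] Suc.prems by (auto intro: Ck_on_le)
      have "Ck_on (m - 2 - j) UNIV D"
        unfolding D_def using w_smooth[of "j + 2"] quasi_smooth[of "j + 1" \<alpha>] Suc.prems
        by (intro Ck_on_mult) auto
      then show "Ck_on (m - 2 - Suc j) UNIV D" by (rule Ck_on_le) auto
      have "Suc s \<le> m - 2 - j" if "s \<le> m - 2 - Suc j" for s
        using that Suc.prems by simp
      then show "\<forall>s\<le>m - 2 - Suc j. nderiv s D x = 0"
        using Suc.IH Suc.prems by (auto simp flip: D)
    qed simp
    moreover have "(\<lambda>x. inverse (w (j + 2) x) *\<^sub>R D x) = quasi \<alpha> (Suc j)"
      using nz[of "j + 2"] Suc.prems by (auto simp: D_def)
    ultimately show ?case by simp
  qed
  from this[OF assms(3)] show ?thesis by (auto dest: spec[of _ 0])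
qed

end

section \<open>Gluing the pieces of a spline at the integers\<close>

lemma isCont_eq_of_eventually_eq:
  fixes f g :: "'a::t2_space \<Rightarrow> 'b::t2_space"
  assumes "F \<noteq> bot" "F \<le> at x" "isCont f x" "isCont g x" "eventually (\<lambda>y. f y = g y) F"
  shows "f x = g x"
proof -
  have "(f \<longlongrightarrow> f x) F" "(g \<longlongrightarrow> g x) F"
    using assms(2-4) by (auto simp: isCont_def intro: tendsto_mono)
  moreover have "(f \<longlongrightarrow> g x) F"
    using \<open>(g \<longlongrightarrow> g x) F\<close> assms(5) by (auto intro: Lim_transform_eventually simp: eq_commute)
  ultimately show ?thesis using tendsto_unique assms(1) by blast
qed

lemma floor_eq_piece: "x \<in> {real_of_int l<..<real_of_int l + 1} \<Longrightarrow> \<lfloor>x\<rfloor> = l \<and> x \<notin> \<int>"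
  by (auto simp: floor_unique elim!: Ints_cases)

lemma noninteger_piece: "x \<notin> \<int> \<Longrightarrow> x \<in> {real_of_int \<lfloor>x\<rfloor><..<real_of_int \<lfloor>x\<rfloor> + 1}"
  using of_int_floor_le[of x] floor_correct[of x] by (auto simp: less_le)

text \<open>The representation by pieces is required only off the integers, because for
  \<open>m = 1\<close> the values at integers are fixed by a convention. The coefficients of the
  pieces outside the support are normalized to zero.\<close>

locale PEB_spline_pieces = PEB_system +
  fixes \<phi> :: "real \<Rightarrow> real" and \<alpha> :: "int \<Rightarrow> nat \<Rightarrow> real"
  assumes spline_smooth: "m \<ge> 2 \<Longrightarrow> Ck_on (m - 2) UNIV \<phi>"
    and zero_outside: "x \<notin> {0..real m} \<Longrightarrow> \<phi> x = 0"
    and positive: "x \<in> {0<..<real m} \<Longrightarrow> \<phi> x > 0"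
    and coeffs_outside: "l \<notin> {0..<int m} \<Longrightarrow> \<alpha> l = (\<lambda>s. 0)"
    and pieces: "x \<notin> \<int> \<Longrightarrow> \<phi> x = w 1 x * quasi (\<alpha> \<lfloor>x\<rfloor>) 0 x"
begin

definition spline_quasi :: "nat \<Rightarrow> real \<Rightarrow> real" where
  "spline_quasi j x = quasi (\<alpha> \<lfloor>x\<rfloor>) j x"

text \<open>Derivatives up to order \<open>m - 2\<close> are continuous for \<open>\<phi>\<close>
  and for both adjacent pieces, so one-sided limits identify them at the knot.\<close>

lemma nderiv_limit:
  assumes "s \<le> m - 2" "m \<ge> 2"
  shows "nderiv s \<phi> (real_of_int l) = nderiv s (\<lambda>x. w 1 x * quasi (\<alpha> l) 0 x) (real_of_int l)"
    and "nderiv s \<phi> (real_of_int l) = nderiv s (\<lambda>x. w 1 x * quasi (\<alpha> (l - 1)) 0 x) (real_of_int l)"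
proof -
  let ?l = "real_of_int l"
  have c1: "isCont (nderiv s \<phi>) ?l"
    using continuous_on_nderiv[OF open_UNIV spline_smooth assms(1)] assms(2)
    by (simp add: continuous_on_eq_continuous_at)
  have c2: "isCont (nderiv s (\<lambda>x. w 1 x * quasi (\<alpha> k) 0 x)) ?l" for k
    using continuous_on_nderiv[OF open_UNIV w_quasi_smooth, of s "\<alpha> k"] assms
    by (simp add: continuous_on_eq_continuous_at)
  have eq: "nderiv s \<phi> x = nderiv s (\<lambda>x. w 1 x * quasi (\<alpha> k) 0 x) x"
    if "x \<in> {real_of_int k<..<real_of_int k + 1}" for x k
    by (rule nderiv_cong_open[OF open_greaterThanLessThan _ that])
      (metis pieces floor_eq_piece)
  have "eventually (\<lambda>x. nderiv s \<phi> x = nderiv s (\<lambda>x. w 1 x * quasi (\<alpha> l) 0 x) x) (at_right ?l)"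
    using eq[of _ l] eventually_at_right[of ?l "?l + 1"] by (auto intro!: exI[of _ "?l + 1"])
  with c1 c2[of l] show "nderiv s \<phi> ?l = nderiv s (\<lambda>x. w 1 x * quasi (\<alpha> l) 0 x) ?l"
    by (intro isCont_eq_of_eventually_eq[of "at_right ?l"]) (auto simp: at_le)
  have "eventually (\<lambda>x. nderiv s \<phi> x = nderiv s (\<lambda>x. w 1 x * quasi (\<alpha> (l - 1)) 0 x) x) (at_left ?l)"
    using eq[of _ "l - 1"] eventually_at_left[of "?l - 1" ?l] by (auto intro!: exI[of _ "?l - 1"])
  with c1 c2[of "l - 1"] show "nderiv s \<phi> ?l = nderiv s (\<lambda>x. w 1 x * quasi (\<alpha> (l - 1)) 0 x) ?l"
    by (intro isCont_eq_of_eventually_eq[of "at_left ?l"]) (auto simp: at_le)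
qed

text \<open>The difference of two adjacent pieces lies in the same space and has a vanishing jet of
  order \<open>m - 2\<close> at the common knot; hence its quasi-derivatives vanish there, except
  the last one, which may jump.\<close>

lemma quasi_match:
  assumes "j + 2 \<le> m"
  shows "quasi (\<alpha> (l - 1)) j (real_of_int l) = quasi (\<alpha> l) j (real_of_int l)"
proof -
  let ?d = "\<lambda>s. \<alpha> l s - \<alpha> (l - 1) s"
  have m2: "m \<ge> 2" using assms by simp
  have neg: "bounded_linear (uminus :: real \<Rightarrow> real)"
    by (intro bounded_linear_minus bounded_linear_ident)
  have "nderiv s (\<lambda>x. w 1 x * quasi ?d 0 x) (real_of_int l) = 0" if "s \<le> m - 2" for s
  proof -
    let ?f = "\<lambda>l x. w 1 x * quasi (\<alpha> l) 0 x"
    have "(\<lambda>x. w 1 x * quasi ?d 0 x) = (\<lambda>x. ?f l x + - ?f (l - 1) x)"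
      by (simp add: quasi_diff algebra_simps)
    moreover have "nderiv s (\<lambda>x. ?f l x + - ?f (l - 1) x) (real_of_int l) =
        nderiv s (?f l) (real_of_int l) + nderiv s (\<lambda>x. - ?f (l - 1) x) (real_of_int l)"
      using that by (intro nderiv_add[OF open_UNIV w_quasi_smooth]
        Ck_on_bounded_linear[OF neg] w_quasi_smooth) auto
    moreover have "nderiv s (\<lambda>x. - ?f (l - 1) x) (real_of_int l) =
        - nderiv s (?f (l - 1)) (real_of_int l)"
      using that by (intro nderiv_bounded_linear[OF neg open_UNIV w_quasi_smooth]) auto
    moreover have "nderiv s (?f l) (real_of_int l) = nderiv s (?f (l - 1)) (real_of_int l)"
      using nderiv_limit[OF that m2, of l] by (rule trans[OF sym])
    ultimately show ?thesis by (simp only: add.right_inverse)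
  qed
  then have "quasi ?d j (real_of_int l) = 0"
    using assms by (intro quasi_vanish) auto
  then show ?thesis by (simp add: quasi_diff)
qed

lemma spline_quasi_outside:
  assumes "x \<notin> {0..<real m}"
  shows "spline_quasi j x = 0"
proof -
  have "\<lfloor>x\<rfloor> \<notin> {0..<int m}" using assms by (auto simp: le_floor_iff floor_less_iff)
  then show ?thesis by (simp add: spline_quasi_def coeffs_outside quasi_zero_coeffs)
qed

text \<open>Only the limit from the left at an integer needs an argument: it is governed by the
  preceding piece, which has the same value at the knot.\<close>

lemma spline_quasi_continuous:
  assumes "j + 1 < m"
  shows "continuous_on UNIV (spline_quasi j)"
proof -
  have qc: "isCont (quasi \<beta> j) x" for \<beta> x
    using Ck_on_imp_continuous_on[OF quasi_smooth[of j \<beta>]] assms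
    by (simp add: continuous_on_eq_continuous_at)
  have qt: "(quasi \<beta> j \<longlongrightarrow> quasi \<beta> j x) (at_left x)" "(quasi \<beta> j \<longlongrightarrow> quasi \<beta> j x) (at_right x)" for \<beta> x
    using tendsto_mono[OF _ qc[unfolded isCont_def]] by (simp_all add: at_le)
  have "isCont (spline_quasi j) x" for x
  proof -
    let ?l = "\<lfloor>x\<rfloor>"
    have right: "(spline_quasi j \<longlongrightarrow> spline_quasi j x) (at_right x)"
    proof (rule Lim_transform_eventually)
      show "(quasi (\<alpha> ?l) j \<longlongrightarrow> spline_quasi j x) (at_right x)"
        unfolding spline_quasi_def by (rule qt)
      have "\<lfloor>y\<rfloor> = ?l" if "x < y" "y < real_of_int ?l + 1" for y
        using that of_int_floor_le[of x] by (intro floor_unique) linarith+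
      then show "eventually (\<lambda>y. quasi (\<alpha> ?l) j y = spline_quasi j y) (at_right x)"
        using floor_correct[of x] unfolding eventually_at_right_field spline_quasi_def
        by (intro exI[of _ "real_of_int ?l + 1"]) simp
    qed
    have left: "(spline_quasi j \<longlongrightarrow> spline_quasi j x) (at_left x)"
    proof (cases "x \<in> \<int>")
      case True
      then obtain l where l: "x = real_of_int l" by (elim Ints_cases)
      show ?thesis
      proof (rule Lim_transform_eventually)
        have "spline_quasi j x = quasi (\<alpha> (l - 1)) j x"
          using quasi_match[of j l] assms by (simp add: spline_quasi_def l)
        then show "(quasi (\<alpha> (l - 1)) j \<longlongrightarrow> spline_quasi j x) (at_left x)"
          using qt(1)[of "\<alpha> (l - 1)" x] by simp
        have "\<lfloor>y\<rfloor> = l - 1" if "x - 1 < y" "y < x" for y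
          using that l by (intro floor_unique) auto
        then show "eventually (\<lambda>y. quasi (\<alpha> (l - 1)) j y = spline_quasi j y) (at_left x)"
          unfolding eventually_at_left_field spline_quasi_def by (intro exI[of _ "x - 1"]) simp
      qed
    next
      case False
      note piece = noninteger_piece[OF False]
      show ?thesis
      proof (rule Lim_transform_eventually)
        show "(quasi (\<alpha> ?l) j \<longlongrightarrow> spline_quasi j x) (at_left x)"
          unfolding spline_quasi_def by (rule qt)
        have "\<lfloor>y\<rfloor> = ?l" if "real_of_int ?l < y" "y < x" for y
          using that floor_correct[of x] by (intro floor_unique) linarith+
        then show "eventually (\<lambda>y. quasi (\<alpha> ?l) j y = spline_quasi j y) (at_left x)"
          using piece unfolding eventually_at_left_field spline_quasi_def
          by (intro exI[of _ "real_of_int ?l"]) simp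
      qed
    qed
    show ?thesis unfolding isCont_def using left right by (simp add: filterlim_split_at)
  qed
  then show ?thesis by (simp add: continuous_on_eq_continuous_at)
qed

lemma spline_quasi_deriv:
  assumes "j + 1 < m" "x \<notin> \<int>"
  shows "(spline_quasi j has_real_derivative w (j + 2) x * spline_quasi (j + 1) x) (at x)"
proof -
  note p = noninteger_piece[OF assms(2)]
  have eq: "quasi (\<alpha> \<lfloor>x\<rfloor>) j y = spline_quasi j y"
    if "y \<in> {real_of_int \<lfloor>x\<rfloor><..<real_of_int \<lfloor>x\<rfloor> + 1}" for y
    using floor_eq_piece[OF that] by (simp add: spline_quasi_def)
  show ?thesis
    using has_vector_derivative_cong_open[OF _ open_greaterThanLessThan p eq]
      quasi_deriv[OF assms(1), of "\<alpha> \<lfloor>x\<rfloor>" x] spline_quasi_def[of "j + 1" x]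
    unfolding has_real_derivative_iff_has_vector_derivative by auto
qed

text \<open>A vanishing combination on a subinterval vanishes on the whole unit interval. Cutting it
  off to the right of 0 then leaves a spline supported in an interval of length
  \<open>m - 1\<close>, which must be zero. To the left of 0 the translates enter one after another,
  and the one with the largest active index is alone on its first unit interval, where it is
  positive.\<close>

lemma translates_independent:
  assumes ab: "0 \<le> a" "a < b" "b \<le> 1"
    and zero: "\<forall>x\<in>{a<..<b}. (\<Sum>i<m. c i * \<phi> (x + real i)) = 0"
  shows "\<forall>i<m. c i = 0"
proof -
  \<comment> \<open>The factor that a unit shift produces in the first \<open>j + 1\<close> weights
    together. With the powers \<open>K j ^ i\<close> absorbed, the translated quasi-derivatives form
    one tower with the unshifted weights.\<close>
  define K where "K j = (\<Prod>s=1..j + 1. \<kappa> s)" for j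
  define H where "H j x = (\<Sum>i<m. c i * K j ^ i * spline_quasi j (x + real i))" for j x
  have int_shift: "x + real i \<in> \<int> \<longleftrightarrow> x \<in> \<int>" for x i
    by (metis Ints_add Ints_diff Ints_of_nat add_diff_cancel_right')
  have F: "(\<Sum>i<m. c i * \<phi> (x + real i)) = w 1 x * H 0 x" if "x \<notin> \<int>" for x
  proof -
    have "\<phi> (x + real i) = w 1 x * (K 0 ^ i * spline_quasi 0 (x + real i))" for i
      using pieces[of "x + real i"] int_shift[of x i] that w_shift_nat[of 1 x i] m_pos
      by (simp add: spline_quasi_def K_def)
    then show ?thesis by (simp add: H_def sum_distrib_left mult_ac)
  qed
  have Hcont: "continuous_on UNIV (H j)" if "j + 1 < m" for j
  proof -
    have "continuous_on UNIV (\<lambda>x. spline_quasi j (x + real i))" for i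
      by (rule continuous_on_compose2[OF spline_quasi_continuous[OF that]])
        (auto intro!: continuous_intros)
    then show ?thesis unfolding H_def by (intro continuous_on_sum continuous_on_mult_left)
  qed
  have Hderiv: "(H j has_real_derivative w (j + 2) x * H (j + 1) x) (at x)"
    if j: "j + 1 < m" and x: "x \<notin> \<int>" for j x
  proof -
    have "((\<lambda>x. spline_quasi j (x + real i)) has_real_derivative
             w (j + 2) (x + real i) * spline_quasi (j + 1) (x + real i)) (at x)" for i
      using spline_quasi_deriv[of j "x + real i"] j x int_shift[of x i] DERIV_shift by blast
    then have "(H j has_real_derivative (\<Sum>i<m. c i * K j ^ i *
        (w (j + 2) (x + real i) * spline_quasi (j + 1) (x + real i)))) (at x)"
      unfolding H_def by (intro DERIV_sum DERIV_cmult)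
    also have "(\<Sum>i<m. c i * K j ^ i * (w (j + 2) (x + real i) * spline_quasi (j + 1) (x + real i)))
        = w (j + 2) x * H (j + 1) x"
      using w_shift_nat[of "j + 2" x] j
      by (simp add: H_def K_def sum_distrib_left power_mult_distrib mult_ac)
    finally show ?thesis .
  qed
  have Hlast: "H (m - 1) x = H (m - 1) y" if "\<lfloor>x\<rfloor> = \<lfloor>y\<rfloor>" for x y
  proof -
    have "spline_quasi (m - 1) (x + real i) = spline_quasi (m - 1) (y + real i)" for i
    proof -
      have "\<lfloor>z + real i\<rfloor> = \<lfloor>z\<rfloor> + int i" for z :: real by linarith
      then show ?thesis using that quasi_last by (simp add: spline_quasi_def)
    qed
    then show ?thesis by (simp add: H_def)
  qed
  have nonint: "x \<notin> \<int>" if "x \<in> {0<..<1}" for x :: real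
    using floor_eq_piece[of x 0] that by simp
  have sub0: "H j x = 0" if "j < m" "x \<in> {a<..<b}" for j x
    using that
  proof (induction j arbitrary: x)
    case 0
    then have "x \<notin> \<int>" using ab nonint by auto
    then show ?case using F[of x] zero 0 w_pos[of 1 x] m_pos by simp
  next
    case (Suc j)
    then have x: "x \<notin> \<int>" using ab nonint by auto
    have "(H j has_real_derivative 0) (at x)"
      using has_vector_derivative_cong_open[of "\<lambda>_. 0" 0 x "{a<..<b}" "H j"] Suc
      by (simp add: has_real_derivative_iff_has_vector_derivative)
    with Hderiv[of j x] Suc.prems(1) x have "w (j + 2) x * H (j + 1) x = 0"
      by (intro DERIV_unique) auto
    moreover have "w (j + 2) x > 0" using Suc.prems(1) by (intro w_pos) auto
    ultimately show ?case by simp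
  qed
  \<comment> \<open>By descent in the level: the last one is constant on the unit interval and
    vanishes somewhere in it; each lower one then has derivative zero and also vanishes
    somewhere.\<close>
  have unit0: "H j x = 0" if "j < m" "x \<in> {0<..<1}" for j x
    using that
  proof (induction "m - 1 - j" arbitrary: j x)
    case 0
    obtain y where y: "y \<in> {a<..<b}" using ab dense by auto
    then have "\<lfloor>x\<rfloor> = \<lfloor>y\<rfloor>" using 0 ab floor_eq_piece[of x 0] floor_eq_piece[of y 0] by auto
    then show ?case using Hlast[of x y] sub0[of j y] 0 y by (cases "j = m - 1") auto
  next
    case (Suc n)
    have "H j constant_on {0<..<1}"
    proof (rule has_field_derivative_0_imp_constant_on)
      fix y :: real assume y: "y \<in> {0<..<1}"
      have "H (j + 1) y = 0" using Suc.hyps(1)[of "j + 1" y] Suc.hyps(2) y by simp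
      then show "(H j has_field_derivative 0) (at y)"
        using Hderiv[of j y] nonint[OF y] Suc.hyps(2) by simp
    qed auto
    moreover obtain y where "y \<in> {a<..<b}" using ab dense by auto
    ultimately show ?case using Suc.prems sub0[of j y] ab unfolding constant_on_def
      by (metis greaterThanLessThan_iff less_le_trans le_less_trans)
  qed
  \<comment> \<open>The cut at 0 destroys neither continuity nor the derivative relations, because
    every level except the last vanishes at 0 by continuity from the right.\<close>
  define H' where "H' j x = (if x < 0 then H j x else 0)" for j x
  have H0: "H j 0 = 0" if "j + 1 < m" for j
  proof (rule tendsto_unique[of "at_right 0" "H j"])
    show "(H j \<longlongrightarrow> H j 0) (at_right 0)"
      using Hcont[OF that] by (auto simp: continuous_on_def intro: tendsto_mono[OF at_le])
    have "eventually (\<lambda>x. 0 = H j x) (at_right 0)"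
      unfolding eventually_at_right_field using unit0[of j] that by (intro exI[of _ 1]) auto
    then show "(H j \<longlongrightarrow> 0) (at_right 0)" by (rule Lim_transform_eventually[OF tendsto_const])
  qed simp
  have "tower H'"
    unfolding tower_def
  proof (intro conjI allI impI)
    fix j assume j: "j + 1 < m"
    have "continuous_on ({..0} \<union> {0..}) (\<lambda>x. if x \<le> 0 then H j x else 0)"
      using H0[OF j] continuous_on_subset[OF Hcont[OF j]]
      by (intro continuous_on_cases) auto
    moreover have "(\<lambda>x. if x \<le> 0 then H j x else 0) = H' j"
      using H0[OF j] by (auto simp: H'_def)
    moreover have "{..0} \<union> {0..} = (UNIV :: real set)" by auto
    ultimately show "continuous_on UNIV (H' j)" by (simp only:)
    fix x :: real assume x: "x \<notin> \<int>"
    then consider "x < 0" | "x > 0" by (metis Ints_0 linorder_neqE_linordered_idom)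
    then show "(H' j has_real_derivative w (j + 2) x * H' (j + 1) x) (at x)"
    proof cases
      case 1
      then show ?thesis
        using has_vector_derivative_cong_open[of "H j" _ x "{..<0}" "H' j"] Hderiv[OF j x]
        by (simp add: H'_def has_real_derivative_iff_has_vector_derivative)
    next
      case 2
      then show ?thesis
        using has_vector_derivative_cong_open[of "\<lambda>_. 0" 0 x "{0<..}" "H' j"]
        by (simp add: H'_def has_real_derivative_iff_has_vector_derivative)
    qed
  next
    fix x y :: real assume xy: "\<lfloor>x\<rfloor> = \<lfloor>y\<rfloor>"
    then have "x < 0 \<longleftrightarrow> y < 0" by (metis floor_less_zero)
    with Hlast[OF xy] show "H' (m - 1) x = H' (m - 1) y" by (simp only: H'_def)
  qed
  have H'_out: "H' j x = 0" if "x \<notin> {- real (m - 1)<..<0}" "j + 1 < m \<or> x \<notin> \<int>" for j x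
  proof (cases "x < 0")
    case True
    with that have x: "x \<le> - real (m - 1)" by auto
    have "spline_quasi j (x + real i) = 0" if "i < m" for i
    \<comment> \<open>The left end of the support is delicate: the piece starting at 0 vanishes
      there only through the matching with the zero piece to its left, which is available below the
      last level.\<close>
    proof (cases "x + real i = 0")
      case True
      then have "j + 1 < m"
        using \<open>j + 1 < m \<or> x \<notin> \<int>\<close> int_shift[of x i] by auto
      then show ?thesis using True quasi_match[of j 0] 
        by (simp add: spline_quasi_def coeffs_outside quasi_zero_coeffs)
    next
      case False
      have "real i \<le> real (m - 1)" using that by simp
      with False x have "x + real i < 0" by linarith
      then show ?thesis by (intro spline_quasi_outside) auto
    qed
    then show ?thesis by (simp add: H'_def H_def)
  qed (simp add: H'_def)
  have left0: "(\<Sum>i<m. c i * \<phi> (x + real i)) = 0" if "x < 0" "x \<notin> \<int>" for x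
  proof -
    have "H' 0 x = 0"
    proof (rule tower_short_support[OF \<open>tower H'\<close>, of "m - 1" "- int (m - 1)"])
      have set_eq: "{real_of_int (- int (m - 1))<..<real_of_int (- int (m - 1)) + real (m - 1)}
          = {- real (m - 1)<..<0}" by simp
      show "H' j x = 0" if "j + 1 < m"
        "x \<notin> {real_of_int (- int (m - 1))<..<real_of_int (- int (m - 1)) + real (m - 1)}" for j x
        using that unfolding set_eq by (blast intro: H'_out)
      show "H' 0 x = 0" if "x \<notin> \<int>"
        "x \<notin> {real_of_int (- int (m - 1))<..<real_of_int (- int (m - 1)) + real (m - 1)}" for x
        using that unfolding set_eq by (blast intro: H'_out)
    qed (use m_pos that in auto)
    then show "(\<Sum>i<m. c i * \<phi> (x + real i)) = 0" using F[OF that(2)] that by (simp add: H'_def)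
  qed
  show ?thesis
  proof (rule ccontr)
    assume nonzero: "\<not> (\<forall>i<m. c i = 0)"
    define N where "N = {i. i < m \<and> c i \<noteq> 0}"
    have N: "finite N" "N \<noteq> {}" using nonzero by (auto simp: N_def)
    define k where "k = Max N"
    have k: "k < m" "c k \<noteq> 0" using Max_in[OF N] by (auto simp: N_def k_def)
    have above: "c i = 0" if "k < i" "i < m" for i
    proof (rule ccontr)
      assume "c i \<noteq> 0"
      then have "i \<in> N" using that by (simp add: N_def)
      then have "i \<le> k" unfolding k_def by (rule Max_ge[OF N(1)])
      then show False using that by simp
    qed
    \<comment> \<open>A point where the combination is zero and the \<open>k\<close>-th translate is
      in its first unit interval. For \<open>k = 0\<close> it comes from the given subinterval,
      otherwise from the negative axis.\<close>
    obtain x where x: "x + real k \<in> {0<..<1}" "(\<Sum>i<m. c i * \<phi> (x + real i)) = 0"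
    proof (cases "k = 0")
      case True
      obtain y where "y \<in> {a<..<b}" using ab dense by auto
      then show ?thesis using zero ab True by (intro that[of y]) auto
    next
      case False
      have *: "- real k + 1 / 2 + real k \<in> {0<..<1}" by simp
      then have "- real k + 1 / 2 \<notin> \<int>" using nonint int_shift by blast
      then show ?thesis using False by (intro that[OF * left0]) auto
    qed
    have "(\<Sum>i<m. c i * \<phi> (x + real i)) = (\<Sum>i\<in>{k}. c i * \<phi> (x + real i))"
    proof (rule sum.mono_neutral_right)
      show "\<forall>i\<in>{..<m} - {k}. c i * \<phi> (x + real i) = 0"
      proof
        fix i assume i: "i \<in> {..<m} - {k}"
        show "c i * \<phi> (x + real i) = 0"
        proof (cases "i < k")
          case True
          then have "real i \<le> real k - 1" by linarith
          with x have "x + real i < 0" by simp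
          then show ?thesis using zero_outside[of "x + real i"] by simp
        qed (use i above in auto)
      qed
    qed (use k in auto)
    moreover have "\<phi> (x + real k) > 0" using x m_pos by (intro positive) auto
    ultimately show False using x k by simp
  qed
qed

end

text \<open>The interface between the spline theory and the sampling argument; weights and pieces no
  longer appear. Independence on every subinterval, rather than on the unit interval only, is what
  the choice of a point with independent jets consumes.\<close>

locale shift_generator =
  fixes m :: nat and \<phi> :: "real \<Rightarrow> real"
  assumes m_pos: "m \<ge> 1"
    and zero_outside: "x \<notin> {0..real m} \<Longrightarrow> \<phi> x = 0"
    and smooth: "i < m \<Longrightarrow> Ck_on (m - 1) {real i<..<real i + 1} \<phi>"
    and bounded: "\<exists>B. \<forall>x. x \<notin> \<int> \<longrightarrow> \<bar>\<phi> x\<bar> \<le> B"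
    and independent: "0 \<le> a \<Longrightarrow> a < b \<Longrightarrow> b \<le> 1 \<Longrightarrow>
      \<forall>x\<in>{a<..<b}. (\<Sum>i<m. c i * \<phi> (x + real i)) = 0 \<Longrightarrow> i < m \<Longrightarrow> c i = 0"

context PEB_spline_pieces begin

lemma is_shift_generator: "shift_generator m \<phi>"
proof
  let ?g = "\<lambda>l x. w 1 x * quasi (\<alpha> l) 0 x"
  have g: "continuous_on UNIV (?g l)" for l
    using w_quasi_smooth by (rule Ck_on_imp_continuous_on)
  show "Ck_on (m - 1) {real i<..<real i + 1} \<phi>" if "i < m" for i
  proof (rule Ck_on_cong)
    show "Ck_on (m - 1) {real i<..<real i + 1} (?g (int i))"
      using w_quasi_smooth by (rule Ck_on_subset) simp
    show "?g (int i) x = \<phi> x" if "x \<in> {real i<..<real i + 1}" for x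
      using floor_eq_piece[of x "int i"] that pieces[of x] by auto
  qed simp
  have "\<exists>B. \<forall>x\<in>{0..real m}. \<bar>?g l x\<bar> \<le> B" for l
  proof -
    have "bounded (?g l ` {0..real m})"
      using continuous_on_subset[OF g] by (intro compact_imp_bounded compact_continuous_image) auto
    then show ?thesis by (auto simp: bounded_iff)
  qed
  then obtain B where B: "\<And>l x. x \<in> {0..real m} \<Longrightarrow> \<bar>?g l x\<bar> \<le> B l" by metis
  have "\<bar>\<phi> x\<bar> \<le> (\<Sum>l\<in>{0..<int m}. \<bar>B l\<bar>)" if x: "x \<notin> \<int>" for x
  proof (cases "x \<in> {0..real m}")
    case True
    moreover have "x \<noteq> real m" using x by auto
    ultimately have "0 \<le> x" "x < real m" by auto
    then have "0 \<le> \<lfloor>x\<rfloor>" "\<lfloor>x\<rfloor> < int m" by linarith+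
    then have "\<lfloor>x\<rfloor> \<in> {0..<int m}" by simp
    then have "\<bar>B \<lfloor>x\<rfloor>\<bar> \<le> (\<Sum>l\<in>{0..<int m}. \<bar>B l\<bar>)" by (intro member_le_sum) auto
    then show ?thesis using B[OF True, of "\<lfloor>x\<rfloor>"] pieces[OF x] by linarith
  qed (simp add: zero_outside sum_nonneg)
  then show "\<exists>B. \<forall>x. x \<notin> \<int> \<longrightarrow> \<bar>\<phi> x\<bar> \<le> B" by blast
qed (use m_pos zero_outside translates_independent in blast)+

end

lemma PEB_spline_shift_generator:
  assumes m: "m \<ge> 1" and weights: "PEB_weights m w" and spline: "PEB_spline m w \<phi>"
  shows "shift_generator m \<phi>"
proof -
  from weights obtain \<gamma> :: "nat \<Rightarrow> real" and r :: "nat \<Rightarrow> real \<Rightarrow> real" where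
    r: "\<And>s. s \<in> {1..m} \<Longrightarrow> Ck (m - s) (r s) \<and> (\<forall>x. r s x > 0) \<and> (\<forall>x. r s (x + 1) = r s x) \<and>
        (\<forall>x. w s x = exp (\<gamma> s * x) * r s x)"
    unfolding PEB_weights_def by metis
  interpret PEB_system m w "\<lambda>s. exp (\<gamma> s)"
  proof
    fix s x assume s: "s \<in> {1..m}"
    have ws: "w s = (\<lambda>x. exp (\<gamma> s * x) * r s x)" using r[OF s] by auto
    show "Ck_on (m - s) UNIV (w s)"
      unfolding ws using r[OF s] by (intro Ck_on_mult Ck_on_exp) (simp add: Ck_iff_Ck_on)
    show "w s x > 0" using r[OF s] by simp
    show "w s (x + 1) = exp (\<gamma> s) * w s x"
      using r[OF s] by (simp add: exp_add ring_distribs)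
  qed (rule m)
  have cl: "closure {x. \<phi> x \<noteq> 0} = {0..real m}" using spline by (simp add: PEB_spline_def)
  have out: "\<phi> x = 0" if "x \<notin> {0..real m}" for x
    using that closure_subset[of "{x. \<phi> x \<noteq> 0}"] unfolding cl by blast
  have "\<exists>a. \<forall>x\<in>{real_of_int l<..<real_of_int l + 1}. \<phi> x = w 1 x * quasi a 0 x" for l
  proof -
    from spline obtain a where
      "\<And>x. x \<in> {real_of_int l<..<real_of_int l + 1} \<Longrightarrow>
         complex_of_real (\<phi> x) = (\<Sum>s=1..m. a s * complex_of_real (PEB_basis w s x))"
      unfolding PEB_spline_def PEB_space_def by fastforce
    \<comment> \<open>The spline space has complex coefficients, but \<open>\<phi>\<close> and the
      basis are real, so the real parts represent the same function.\<close>
    then have "\<phi> x = (\<Sum>s=1..m. Re (a s) * PEB_basis w s x)"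
      if "x \<in> {real_of_int l<..<real_of_int l + 1}" for x
      using arg_cong[of _ _ Re, OF \<open>\<And>x. _ \<Longrightarrow> complex_of_real (\<phi> x) = _\<close>[OF that]] by simp
    then show ?thesis unfolding quasi_0 by blast
  qed
  then obtain a where a: "\<And>l x. x \<in> {real_of_int l<..<real_of_int l + 1} \<Longrightarrow> \<phi> x = w 1 x * quasi (a l) 0 x"
    by metis
  \<comment> \<open>Outside the support the chosen coefficients are replaced by zero, which is
    legitimate since \<open>\<phi>\<close> vanishes there.\<close>
  define \<alpha> where "\<alpha> l = (if l \<in> {0..<int m} then a l else (\<lambda>s. 0))" for l
  interpret PEB_spline_pieces m w "\<lambda>s. exp (\<gamma> s)" \<phi> \<alpha>
  proof
    show "Ck_on (m - 2) UNIV \<phi>" if "2 \<le> m"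
      using spline that by (simp add: PEB_spline_def Ck_iff_Ck_on)
    show "\<phi> x > 0" if "x \<in> {0<..<real m}" for x
      using spline that by (simp add: PEB_spline_def)
    fix x :: real assume "x \<notin> \<int>"
    then have x: "x \<in> {real_of_int \<lfloor>x\<rfloor><..<real_of_int \<lfloor>x\<rfloor> + 1}"
      using of_int_floor_le[of x] floor_correct[of x] by (auto simp: less_le)
    show "\<phi> x = w 1 x * quasi (\<alpha> \<lfloor>x\<rfloor>) 0 x"
    proof (cases "\<lfloor>x\<rfloor> \<in> {0..<int m}")
      case True
      then show ?thesis using a[OF x] by (simp add: \<alpha>_def)
    next
      case False
      then consider "\<lfloor>x\<rfloor> < 0" | "\<lfloor>x\<rfloor> \<ge> int m" by fastforce
      then have "x < 0 \<or> x \<ge> real m" by cases linarith+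
      moreover have "x \<noteq> real m" using \<open>x \<notin> \<int>\<close> by auto
      ultimately have "\<phi> x = 0" by (intro out) auto
      then show ?thesis using False by (auto simp: \<alpha>_def quasi_zero_coeffs)
    qed
  qed (auto simp: out \<alpha>_def)
  show ?thesis by (rule is_shift_generator)
qed

subsection \<open>Shift-invariant series and norm equivalences\<close>

lemma nderiv_translate: "nderiv s (\<lambda>x. f (x + a)) x = nderiv s f (x + a)"
proof (induction s arbitrary: f)
  case (Suc s)
  have shift: "((\<lambda>x. f (x + a)) has_vector_derivative D) (at x) \<longleftrightarrow>
      (f has_vector_derivative D) (at (x + a))" for x D
  proof -
    have tr: "((\<lambda>x. h (x + b)) has_vector_derivative D) (at y)"
      if "(h has_vector_derivative D) (at (y + b))" for h :: "real \<Rightarrow> 'a" and b y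
    proof -
      have "((\<lambda>x. x + b) has_vector_derivative 1) (at y)"
        by (auto intro!: derivative_eq_intros simp flip: has_real_derivative_iff_has_vector_derivative)
      from vector_diff_chain_at[OF this that] show ?thesis by (simp add: o_def)
    qed
    show ?thesis using tr[of f x a] tr[of "\<lambda>x. f (x + a)" "x + a" "- a"] by auto
  qed
  have "(\<lambda>x. vector_derivative (\<lambda>x. f (x + a)) (at x)) = (\<lambda>x. vector_derivative f (at (x + a)))"
    by (simp add: vector_derivative_def shift)
  then show ?case unfolding nderiv_Suc using Suc[of "\<lambda>x. vector_derivative f (at x)"] by simp
qed simp

lemma noninteger_decompose:
  assumes "x \<notin> \<int>"
  obtains L t where "x = real_of_int L + t" "t \<in> {0<..<1::real}"
proof (rule that[of "\<lfloor>x\<rfloor>" "frac x"])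
  show "frac x \<in> {0<..<1}"
    using assms frac_lt_1[of x] frac_gt_0_iff[of x] by simp
qed (simp add: frac_def)

section \<open>Local reconstruction of coefficients from point values and from jets\<close>

context shift_generator begin

lemma translate_smooth:
  assumes "i < m"
  shows "Ck_on (m - 1) {0<..<1} (\<lambda>x. \<phi> (x + real i))"
  using smooth[OF assms] by (rule Ck_on_translate) auto

text \<open>The value of a series at \<open>L + z r\<close> is the sum over \<open>k\<close> of
  \<open>c (L - k) * \<phi> (z r + k)\<close>, so the weights \<open>b i\<close> applied to the
  \<open>K\<close> values return the coefficient \<open>c (L - i)\<close>. The points are ordered
  because they become consecutive nodes.\<close>

definition restart_points :: "nat \<Rightarrow> (nat \<Rightarrow> real) \<Rightarrow> (nat \<Rightarrow> nat \<Rightarrow> real) \<Rightarrow> bool" where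
  "restart_points K z b \<longleftrightarrow> K \<ge> 1 \<and> (\<forall>r<K. z r \<in> {0<..<1}) \<and>
     (\<forall>r s. r < s \<longrightarrow> s < K \<longrightarrow> z r < z s) \<and>
     (\<forall>i<m. \<forall>k<m. (\<Sum>r<K. b i r * \<phi> (z r + real k)) = (if i = k then 1 else 0))"

lemma ex_restart_points: "\<exists>K z b. restart_points K z b"
proof -
  have "\<exists>Z b. finite Z \<and> Z \<subseteq> {0<..<1::real} \<and>
      (\<forall>i\<in>{..<m}. \<forall>k\<in>{..<m}. (\<Sum>z\<in>Z. b i z * \<phi> (z + real k)) = (if i = k then 1 else 0))"
    by (rule dual_functionals) (use independent[of 0 1] in auto)
  then obtain Z b where Z: "finite Z" "Z \<subseteq> {0<..<1::real}"
    and b: "\<And>i k. i < m \<Longrightarrow> k < m \<Longrightarrow> (\<Sum>z\<in>Z. b i z * \<phi> (z + real k)) = (if i = k then 1 else 0)"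
    by blast
  define z where "z r = sorted_list_of_set Z ! r" for r
  have bij: "bij_betw z {..<card Z} Z"
    unfolding z_def using Z(1)
    by (intro bij_betw_nth) (simp_all add: distinct_sorted_list_of_set)
  have "Z \<noteq> {}" using b[of 0 0] m_pos by auto
  then have "card Z \<ge> 1" using Z(1) by (simp add: Suc_le_eq card_gt_0_iff)
  moreover have "z r \<in> {0<..<1}" if "r < card Z" for r
    using bij_betwE[OF bij] Z(2) that by auto
  moreover have "z r < z s" if "r < s" "s < card Z" for r s
    unfolding z_def using that sorted_wrt_nth_less[OF strict_sorted_list_of_set[of Z]] Z(1) by simp
  moreover have "(\<Sum>r<card Z. b i (z r) * \<phi> (z r + real k)) = (if i = k then 1 else 0)"
    if "i < m" "k < m" for i k
    using b[OF that] sum.reindex_bij_betw[OF bij, of "\<lambda>z. b i z * \<phi> (z + real k)"] by simp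
  ultimately have "restart_points (card Z) z (\<lambda>i r. b i (z r))"
    unfolding restart_points_def by simp
  then show ?thesis by blast
qed

lemma hermite_point:
  assumes "n < m"
  shows "\<exists>y b. y \<in> {0<..<1} \<and> (\<forall>i\<le>n. \<forall>k\<le>n.
     (\<Sum>s\<le>n. b i s * nderiv s \<phi> (y + real k)) = (if i = k then 1 else 0))"
proof -
  have C: "Ck_on n {0<..<1} (\<lambda>x. \<phi> (x + real i))" if "i < Suc n" for i
    using that assms Ck_on_le[OF translate_smooth[of i], of n] by auto
  have "\<exists>y\<in>{0<..<1}. \<forall>c. (\<forall>s<Suc n. nderiv s (\<lambda>x. \<Sum>i<Suc n. c i * \<phi> (x + real i)) y = 0) \<longrightarrow>
      (\<forall>i<Suc n. c i = 0)"
  proof (rule jets_independent_at_point)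
    show "Ck_on (Suc n - 1) {0<..<1} (\<lambda>x. \<phi> (x + real i))" if "i < Suc n" for i
      using C[OF that] by simp
    fix a b :: real and c :: "nat \<Rightarrow> real"
    assume *: "0 \<le> a" "a < b" "b \<le> 1" "\<forall>x\<in>{a<..<b}. (\<Sum>i<Suc n. c i * \<phi> (x + real i)) = 0"
    have "(\<Sum>i<m. (if i < Suc n then c i else 0) * \<phi> (x + real i))
        = (\<Sum>i<Suc n. c i * \<phi> (x + real i))" for x
      using assms by (intro sum.mono_neutral_cong_right) auto
    then have "(if i < Suc n then c i else 0) = 0" if "i < m" for i
      using independent[OF *(1-3) _ that, of "\<lambda>i. if i < Suc n then c i else 0"] *(4) by simp
    then show "\<forall>i<Suc n. c i = 0" using assms by (metis Suc_leI order_less_le_trans)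
  qed simp
  then obtain y where y: "y \<in> {0<..<1}"
    "\<And>c. \<forall>s<Suc n. nderiv s (\<lambda>x. \<Sum>i<Suc n. c i * \<phi> (x + real i)) y = 0 \<Longrightarrow> \<forall>i<Suc n. c i = 0"
    by blast
  have expand: "nderiv s (\<lambda>x. \<Sum>i<Suc n. c i * \<phi> (x + real i)) y
      = (\<Sum>i<Suc n. c i * nderiv s \<phi> (y + real i))"
    if "s < Suc n" for s c
  proof -
    have "nderiv s (\<lambda>x. \<Sum>i<Suc n. c i * \<phi> (x + real i)) y
       = (\<Sum>i<Suc n. nderiv s (\<lambda>x. c i * \<phi> (x + real i)) y)"
      using that C by (intro nderiv_sum[OF open_greaterThanLessThan _ _ _ y(1), of _ n] Ck_on_mult Ck_on_const) auto
    also have "\<dots> = (\<Sum>i<Suc n. c i * nderiv s (\<lambda>x. \<phi> (x + real i)) y)"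
      using that C by (intro sum.cong nderiv_bounded_linear[OF bounded_linear_mult_right open_greaterThanLessThan _ _ y(1)]) auto
    finally show ?thesis by (simp only: nderiv_translate)
  qed
  have "\<exists>Z b. finite Z \<and> Z \<subseteq> {..n} \<and> (\<forall>i\<in>{..n}. \<forall>k\<in>{..n}.
     (\<Sum>s\<in>Z. b i s * nderiv s \<phi> (y + real k)) = (if i = k then 1 else 0))"
  proof (rule dual_functionals)
    fix c assume c: "\<forall>s\<in>{..n}. (\<Sum>i\<in>{..n}. c i * nderiv s \<phi> (y + real i)) = 0"
    have "\<forall>s<Suc n. nderiv s (\<lambda>x. \<Sum>i<Suc n. c i * \<phi> (x + real i)) y = 0"
      using c expand[of _ c] by (simp add: lessThan_Suc_atMost less_Suc_eq_le)
    from y(2)[OF this] show "\<forall>i\<in>{..n}. c i = 0" by auto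
  qed simp
  then obtain Z b where Z: "Z \<subseteq> {..n}"
    "\<forall>i\<in>{..n}. \<forall>k\<in>{..n}. (\<Sum>s\<in>Z. b i s * nderiv s \<phi> (y + real k)) = (if i = k then 1 else 0)"
    by blast
  have "(\<Sum>s\<le>n. (if s \<in> Z then b i s else 0) * nderiv s \<phi> (y + real k))
      = (\<Sum>s\<in>Z. b i s * nderiv s \<phi> (y + real k))" for i k
    using Z(1) by (intro sum.mono_neutral_cong_right) auto
  then show ?thesis
    using y(1) Z(2) by (intro exI[of _ y] exI[of _ "\<lambda>i s. if s \<in> Z then b i s else 0"]) simp
qed

definition series :: "(int \<Rightarrow> complex) \<Rightarrow> real \<Rightarrow> complex" where
  "series c x = (\<Sum>\<^sub>\<infinity>l\<in>UNIV. c l * complex_of_real (\<phi> (x - real_of_int l)))"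

lemma series_local:
  assumes "t \<in> {0<..<1}"
  shows "series c (real_of_int L + t) = (\<Sum>i<m. c (L - int i) * complex_of_real (\<phi> (t + real i)))"
proof -
  have "series c (real_of_int L + t) =
      (\<Sum>\<^sub>\<infinity>l\<in>(\<lambda>i. L - int i) ` {..<m}. c l * complex_of_real (\<phi> (real_of_int L + t - real_of_int l)))"
    unfolding series_def
  proof (rule infsum_cong_neutral)
    fix l assume l: "l \<in> UNIV - (\<lambda>i. L - int i) ` {..<m}"
    have "real_of_int L + t - real_of_int l \<notin> {0..real m}"
    proof
      assume "real_of_int L + t - real_of_int l \<in> {0..real m}"
      then have "0 \<le> L - l" "L - l < int m" using assms by auto
      then have "l = L - int (nat (L - l))" "nat (L - l) < m" by auto
      with l show False by blast
    qed
    then show "c l * complex_of_real (\<phi> (real_of_int L + t - real_of_int l)) = 0"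
      by (simp add: zero_outside)
  qed auto
  also have "\<dots> = (\<Sum>i<m. c (L - int i) * complex_of_real (\<phi> (t + real i)))"
    by (subst infsum_finite, simp, subst sum.reindex) (auto simp: inj_on_def algebra_simps)
  finally show ?thesis .
qed

lemma series_local':
  assumes "x \<in> {real_of_int L<..<real_of_int L + 1}"
  shows "series c x = (\<Sum>i<m. \<phi> (x + (real i - real_of_int L)) *\<^sub>R c (L - int i))"
  using series_local[of "x - real_of_int L" c L] assms
  by (simp add: scaleR_conv_of_real algebra_simps)

lemma series_nderiv:
  assumes "t \<in> {0<..<1}" "s < m"
  shows "nderiv s (series c) (real_of_int L + t) =
     (\<Sum>i<m. c (L - int i) * complex_of_real (nderiv s \<phi> (t + real i)))"
    and "isCont (series c) (real_of_int L + t)"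
proof -
  let ?S = "{real_of_int L<..<real_of_int L + 1}" and ?x = "real_of_int L + t"
  let ?g = "\<lambda>i x. \<phi> (x + (real i - real_of_int L))"
  have x: "?x \<in> ?S" using assms by auto
  have C: "Ck_on (m - 1) ?S (?g i)" if "i < m" for i
    using smooth[OF that] by (rule Ck_on_translate) auto
  have bl: "bounded_linear (\<lambda>r::real. r *\<^sub>R v)" for v :: complex
    by (rule bounded_linear_scaleR_left)
  have CR: "Ck_on (m - 1) ?S (\<lambda>x. ?g i x *\<^sub>R c (L - int i))" if "i < m" for i
    using Ck_on_bounded_linear[OF bl C[OF that]] .
  have "nderiv s (series c) ?x = nderiv s (\<lambda>x. \<Sum>i<m. ?g i x *\<^sub>R c (L - int i)) ?x"
    by (rule nderiv_cong_open[OF open_greaterThanLessThan series_local' x])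
  also have "\<dots> = (\<Sum>i<m. nderiv s (\<lambda>x. ?g i x *\<^sub>R c (L - int i)) ?x)"
    using assms CR by (intro nderiv_sum[OF open_greaterThanLessThan _ _ _ x]) auto
  also have "\<dots> = (\<Sum>i<m. nderiv s (?g i) ?x *\<^sub>R c (L - int i))"
    using assms C by (intro sum.cong nderiv_bounded_linear[OF bl open_greaterThanLessThan _ _ x]) auto
  also have "\<dots> = (\<Sum>i<m. c (L - int i) * complex_of_real (nderiv s \<phi> (t + real i)))"
    by (intro sum.cong refl) (simp add: nderiv_translate scaleR_conv_of_real add_ac)
  finally show "nderiv s (series c) ?x
      = (\<Sum>i<m. c (L - int i) * complex_of_real (nderiv s \<phi> (t + real i)))" .
  have "Ck_on (m - 1) ?S (\<lambda>x. \<Sum>i<m. ?g i x *\<^sub>R c (L - int i))"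
    using CR by (intro Ck_on_sum) auto
  then have "Ck_on (m - 1) ?S (series c)"
    by (rule Ck_on_cong) (auto simp: series_local')
  then show "isCont (series c) ?x"
    using Ck_on_imp_continuous_on x by (metis continuous_on_eq_continuous_at open_greaterThanLessThan)
qed

lemma series_measurable: "series c \<in> borel_measurable borel"
proof (rule borel_measurable_continuous_countable_exceptions)
  show "countable (\<int> :: real set)" by (simp add: Ints_def)
  have "isCont (series c) x" if "x \<notin> \<int>" for x
    using noninteger_decompose[OF that] series_nderiv(2)[of _ 0] m_pos
        by (metis One_nat_def Suc_le_lessD)
  then show "continuous_on (- \<int>) (series c)"
    by (intro continuous_at_imp_continuous_on) auto
qed

lemma series_bounded:
  obtains B where "B \<ge> 0"
    "\<And>c L t. t \<in> {0<..<1} \<Longrightarrow> norm (series c (real_of_int L + t)) \<le> B * (\<Sum>i<m. norm (c (L - int i)))"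
proof -
  from bounded obtain B where B: "\<And>x. x \<notin> \<int> \<Longrightarrow> \<bar>\<phi> x\<bar> \<le> B" by blast
  have "norm (series c (real_of_int L + t)) \<le> \<bar>B\<bar> * (\<Sum>i<m. norm (c (L - int i)))"
    if t: "t \<in> {0<..<1}" for c L t
  proof -
    have "\<lfloor>t + real i\<rfloor> = int i" for i
      using t by (intro floor_unique) auto
    then have "t + real i \<notin> \<int>" for i
      using t by (metis Ints_cases floor_of_int greaterThanLessThan_iff add.commute less_add_same_cancel1
          order_less_irrefl of_int_of_nat_eq)
    then have "\<bar>\<phi> (t + real i)\<bar> \<le> \<bar>B\<bar>" for i using B by (meson abs_ge_self order_trans)
    then have "norm (c (L - int i) * complex_of_real (\<phi> (t + real i)))
        \<le> \<bar>B\<bar> * norm (c (L - int i))" for i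
      by (subst mult.commute) (auto simp: norm_mult intro!: mult_right_mono)
    then show ?thesis
      unfolding series_local[OF t] sum_distrib_left by (intro sum_norm_le)
  qed
  then show ?thesis using that[of "\<bar>B\<bar>"] by simp
qed

text \<open>The point evaluations that determine \<open>m\<close> coefficients may be moved simultaneously by any
  small \<open>t\<close>; integrating over \<open>t\<close> then bounds the coefficients by the \<open>L\<^sup>p\<close> norm.\<close>

lemma coefficient_bound:
  "\<exists>(K::nat) z \<delta> B. \<delta> > 0 \<and> B \<ge> 0 \<and> (\<forall>r<K. \<forall>t. \<bar>t\<bar> < \<delta> \<longrightarrow> z r + t \<in> {0<..<1}) \<and>
     (\<forall>c L t. \<bar>t\<bar> < \<delta> \<longrightarrow> norm (c L) \<le> B * (\<Sum>r<K. norm (series c (real_of_int L + (z r + t)))))"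
proof -
  from ex_restart_points obtain K z b where "restart_points K z b" by blast
  then have z: "\<And>r. r < K \<Longrightarrow> z r \<in> {0<..<1}" and
    b: "\<And>i k. i < m \<Longrightarrow> k < m \<Longrightarrow> (\<Sum>r<K. b i r * \<phi> (z r + real k)) = (if i = k then 1 else 0)"
    by (auto simp: restart_points_def)
  \<comment> \<open>The matrix of the dual weights against the moved points; at \<open>t = 0\<close>
    it is the identity.\<close>
  define E where "E i k t = (\<Sum>r<K. b i r * \<phi> (z r + t + real k))" for i k t
  \<comment> \<open>Chosen so that the deviations from the identity, summed over \<open>m\<close>
    rows, contribute at most half of \<open>D\<close>.\<close>
  define \<eta> where "\<eta> = 1 / (2 * real m)"
  have \<eta>: "\<eta> > 0" using m_pos by (simp add: \<eta>_def)
  have cont: "isCont (\<lambda>t. E i k t) 0" if "k < m" for i k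
    unfolding E_def
  proof (intro continuous_intros)
    fix r assume "r \<in> {..<K}"
    then have "isCont (\<lambda>x. \<phi> (x + real k)) (z r + 0)"
      using Ck_on_imp_continuous_on[OF translate_smooth[OF that]] z
      by (simp add: continuous_on_eq_continuous_at)
    then show "isCont (\<lambda>t. \<phi> (z r + t + real k)) 0"
      by (rule isCont_o2[rotated]) (intro continuous_intros)
  qed
  have "eventually (\<lambda>t. \<forall>i\<in>{..<m}. \<forall>k\<in>{..<m}. \<bar>E i k t - (if i = k then 1 else 0)\<bar> < \<eta>) (nhds 0)"
  proof (intro eventually_ball_finite ballI)
    fix i k assume ik: "i \<in> {..<m}" "k \<in> {..<m}"
    have "E i k 0 = (if i = k then 1 else 0)" using b ik by (simp add: E_def)
    moreover have "(E i k \<longlongrightarrow> E i k 0) (nhds 0)"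
      using cont[of k i] ik by (auto simp: continuous_at_imp_continuous_within isCont_def tendsto_at_iff_tendsto_nhds)
    ultimately show "eventually (\<lambda>t. \<bar>E i k t - (if i = k then 1 else 0)\<bar> < \<eta>) (nhds 0)"
      using \<eta> by (auto simp: tendsto_iff dist_real_def)
  qed auto
  moreover have "eventually (\<lambda>t. \<forall>r\<in>{..<K}. z r + t \<in> {0<..<1}) (nhds 0)"
  proof (intro eventually_ball_finite ballI)
    fix r assume "r \<in> {..<K}"
    then have "z r \<in> {0<..<1}" using z by simp
    moreover have "((\<lambda>t. z r + t) \<longlongrightarrow> z r + 0) (nhds 0)"
      by (intro tendsto_intros filterlim_ident)
    ultimately show "eventually (\<lambda>t. z r + t \<in> {0<..<1}) (nhds 0)"
      by (intro topological_tendstoD) auto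
  qed auto
  ultimately have "eventually (\<lambda>t. (\<forall>i\<in>{..<m}. \<forall>k\<in>{..<m}. \<bar>E i k t - (if i = k then 1 else 0)\<bar> < \<eta>) \<and>
      (\<forall>r\<in>{..<K}. z r + t \<in> {0<..<1})) (nhds 0)" by (rule eventually_conj)
  then obtain \<delta> where \<delta>: "\<delta> > 0"
    "\<And>t i k. \<bar>t\<bar> < \<delta> \<Longrightarrow> i < m \<Longrightarrow> k < m \<Longrightarrow> \<bar>E i k t - (if i = k then 1 else 0)\<bar> < \<eta>"
    "\<And>t r. \<bar>t\<bar> < \<delta> \<Longrightarrow> r < K \<Longrightarrow> z r + t \<in> {0<..<1}"
    unfolding eventually_nhds_metric by (auto simp: dist_real_def)
  define B where "B = 2 * (\<Sum>i<m. \<Sum>r<K. \<bar>b i r\<bar>)"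
  have B: "B \<ge> 0" unfolding B_def by (auto intro!: sum_nonneg mult_nonneg_nonneg)
  have main: "norm (c L) \<le> B * (\<Sum>r<K. norm (series c (real_of_int L + (z r + t))))"
    if t: "\<bar>t\<bar> < \<delta>" for c L t
  proof -
    define d where "d i = c (L - int i)" for i
    define F where "F r = series c (real_of_int L + (z r + t))" for r
    define D where "D = (\<Sum>i<m. norm (d i))"
    define N where "N = (\<Sum>r<K. norm (F r))"
    have F: "F r = (\<Sum>k<m. d k * complex_of_real (\<phi> (z r + t + real k)))" if "r < K" for r
      unfolding F_def d_def using \<delta>(3)[OF t that] by (rule series_local)
    have di: "norm (d i) \<le> (\<Sum>r<K. \<bar>b i r\<bar>) * N + \<eta> * D" if i: "i < m" for i
    proof -
      have "(\<Sum>r<K. of_real (b i r) * F r)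
          = (\<Sum>r<K. \<Sum>k<m. of_real (b i r) * (d k * of_real (\<phi> (z r + t + real k))))"
        by (intro sum.cong refl) (simp add: F sum_distrib_left)
      also have "\<dots> = (\<Sum>k<m. d k * of_real (E i k t))"
        unfolding E_def by (subst sum.swap) (simp add: sum_distrib_left mult_ac)
      also have "\<dots> = (\<Sum>k<m. d k * of_real (if i = k then 1 else 0)) +
          (\<Sum>k<m. d k * of_real (E i k t - (if i = k then 1 else 0)))"
        unfolding sum.distrib[symmetric] by (intro sum.cong refl) (simp add: algebra_simps)
      also have "(\<Sum>k<m. d k * of_real (if i = k then 1 else 0)) = (\<Sum>k<m. if i = k then d k else 0)"
        by (intro sum.cong refl) auto
      also have "\<dots> = d i" using i by simp
      finally have "d i = (\<Sum>r<K. of_real (b i r) * F r) - (\<Sum>k<m. d k * of_real (E i k t - (if i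
          = k then 1 else 0)))"
        by simp
      then have "norm (d i) \<le> norm (\<Sum>r<K. of_real (b i r) * F r)
          + norm (\<Sum>k<m. d k * of_real (E i k t - (if i = k then 1 else 0)))"
        by (metis norm_triangle_ineq4)
      also have "norm (\<Sum>r<K. of_real (b i r) * F r) \<le> (\<Sum>r<K. \<bar>b i r\<bar> * N)"
      proof (intro sum_norm_le)
        fix r assume "r \<in> {..<K}"
        then have "norm (F r) \<le> N" unfolding N_def by (intro member_le_sum) auto
        then show "norm (of_real (b i r) * F r) \<le> \<bar>b i r\<bar> * N" by (simp add: norm_mult mult_left_mono)
      qed
      also have "norm (\<Sum>k<m. d k * of_real (E i k t - (if i = k then 1 else 0)))
          \<le> (\<Sum>k<m. \<eta> * norm (d k))"
      proof (intro sum_norm_le)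
        fix k assume "k \<in> {..<m}"
        then have "\<bar>E i k t - (if i = k then 1 else 0)\<bar> \<le> \<eta>" using \<delta>(2)[OF t i, of k] by simp
        then have "\<bar>E i k t - (if i = k then 1 else 0)\<bar> * norm (d k) \<le> \<eta> * norm (d k)"
          by (intro mult_right_mono) auto
        then show "norm (d k * of_real (E i k t - (if i = k then 1 else 0))) \<le> \<eta> * norm (d k)"
          by (simp only: norm_mult norm_of_real mult.commute)
      qed
      finally show ?thesis by (simp add: D_def sum_distrib_left sum_distrib_right)
    qed
    \<comment> \<open>Summing over \<open>i\<close> gives \<open>D \<le> B * N / 2 + D / 2\<close>.
      Absorbing the last term on the left accounts for the factor 2 in \<open>B\<close>.\<close>
    have "D \<le> (\<Sum>i<m. (\<Sum>r<K. \<bar>b i r\<bar>) * N + \<eta> * D)"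
      unfolding D_def[of] by (intro sum_mono) (use di in \<open>simp add: D_def\<close>)
    also have "\<dots> = B * N / 2 + D / 2"
      using m_pos by (simp add: sum.distrib B_def \<eta>_def sum_distrib_right)
    finally have "D \<le> B * N" by simp
    moreover have "norm (d 0) \<le> D" unfolding D_def using m_pos by (intro member_le_sum) auto
    ultimately show ?thesis by (simp add: d_def N_def F_def)
  qed
  have "\<delta> > 0 \<and> B \<ge> 0 \<and> (\<forall>r<K. \<forall>t. \<bar>t\<bar> < \<delta> \<longrightarrow> z r + t \<in> {0<..<1}) \<and>
     (\<forall>c L t. \<bar>t\<bar> < \<delta> \<longrightarrow> norm (c L) \<le> B * (\<Sum>r<K. norm (series c (real_of_int L + (z r + t)))))"
    using \<delta>(1) B \<delta>(3) main by simp
  then show ?thesis by blast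
qed

end

section \<open>Discrete and continuous sizes for all exponents, and a domination principle\<close>

lemma summable_on_ennreal [simp]: "(f :: 'a \<Rightarrow> ennreal) summable_on A"
  by (rule nonneg_summable_on_complete) simp

lemma sum_le_infsum_ennreal:
  fixes f :: "'a \<Rightarrow> ennreal"
  assumes "finite F" "F \<subseteq> A"
  shows "sum f F \<le> infsum f A"
  unfolding infsum_finite[OF assms(1), symmetric]
  by (rule infsum_mono_neutral) (use assms in auto)

lemma infsum_le_ennreal:
  fixes f :: "'a \<Rightarrow> ennreal"
  assumes "\<And>F. finite F \<Longrightarrow> F \<subseteq> A \<Longrightarrow> sum f F \<le> b"
  shows "infsum f A \<le> b"
  by (rule infsum_le_finite_sums) (use assms in auto)

lemma infsum_le_cmult_ennreal:
  fixes f g :: "'a \<Rightarrow> ennreal"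
  assumes "\<And>a. f a \<le> C * g a"
  shows "(\<Sum>\<^sub>\<infinity>a\<in>UNIV. f a) \<le> C * (\<Sum>\<^sub>\<infinity>a\<in>UNIV. g a)"
proof (rule infsum_le_ennreal)
  fix F :: "'a set" assume F: "finite F"
  have "sum f F \<le> C * sum g F"
    unfolding sum_distrib_left using assms by (rule sum_mono)
  also have "\<dots> \<le> C * (\<Sum>\<^sub>\<infinity>a\<in>UNIV. g a)"
    using F by (intro mult_left_mono sum_le_infsum_ennreal) auto
  finally show "sum f F \<le> C * (\<Sum>\<^sub>\<infinity>a\<in>UNIV. g a)" .
qed

text \<open>A crude form of the power mean inequality: the sum is at most its number of terms times
  its largest term.\<close>

lemma sum_powr_le:
  fixes u :: "'a \<Rightarrow> real"
  assumes "finite A" "\<And>a. a \<in> A \<Longrightarrow> 0 \<le> u a" "0 \<le> p"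
  shows "(\<Sum>a\<in>A. u a) powr p \<le> real (card A) powr p * (\<Sum>a\<in>A. u a powr p)"
proof (cases "A = {}")
  case False
  define M where "M = Max (u ` A)"
  have "M \<in> u ` A" unfolding M_def using assms(1) False by (intro Max_in) auto
  then obtain a where a: "a \<in> A" "M = u a" by auto
  have "u b \<le> M" if "b \<in> A" for b unfolding M_def using assms(1) that by (intro Max_ge) auto
  then have "(\<Sum>a\<in>A. u a) \<le> real (card A) * M"
    using sum_bounded_above[of A u M] by simp
  then have "(\<Sum>a\<in>A. u a) powr p \<le> (real (card A) * M) powr p"
    using assms by (intro powr_mono2 sum_nonneg) auto
  also have "\<dots> = real (card A) powr p * M powr p"
    by (rule powr_mult)
  also have "M powr p \<le> (\<Sum>a\<in>A. u a powr p)"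
    unfolding a(2) using a assms(1) by (intro member_le_sum) auto
  finally show ?thesis by (simp add: mult_left_mono)
qed simp

text \<open>For finite \<open>p\<close> no root is taken, in agreement with
  \<open>sampling_set\<close>; constants in comparisons therefore depend on
  \<open>p\<close>.\<close>

definition lp_size :: "ennreal \<Rightarrow> ('a \<Rightarrow> real) \<Rightarrow> ennreal" where
  "lp_size p u = (if p = \<infinity> then (SUP a. ennreal (u a))
                  else (\<Sum>\<^sub>\<infinity>a\<in>UNIV. ennreal (u a powr enn2real p)))"

definition Lp_size :: "ennreal \<Rightarrow> (real \<Rightarrow> complex) \<Rightarrow> ennreal" where
  "Lp_size p f = (if p = \<infinity> then esssup lborel (\<lambda>x. ennreal (norm (f x)))
                  else (\<integral>\<^sup>+x. ennreal (norm (f x) powr enn2real p) \<partial>lborel))"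

text \<open>A Schur test for finitely overlapping index sets. It turns one pointwise estimate into
  an estimate for every exponent: \<open>K1\<close> bounds the number of terms that dominate a given
  \<open>v b\<close>, and \<open>K2\<close> counts how often a given \<open>u a\<close> is used. The
  summand 1 in the constants keeps them positive.\<close>

lemma lp_size_local_bound:
  fixes R :: "'b \<Rightarrow> 'a set" and C :: real and K1 K2 :: nat
  assumes C: "C \<ge> 0"
    and R: "\<And>b. finite (R b)" "\<And>b. card (R b) \<le> K1"
      "\<And>a. finite {b. a \<in> R b}" "\<And>a. card {b. a \<in> R b} \<le> K2"
  shows "\<exists>D>0. \<forall>u v. (\<forall>a. 0 \<le> u a) \<longrightarrow> (\<forall>b. 0 \<le> v b) \<longrightarrow> (\<forall>b. v b \<le> C * (\<Sum>a\<in>R b. u a)) \<longrightarrow>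
       lp_size p v \<le> ennreal D * lp_size p u"
proof (cases "p = \<infinity>")
  case True
  have "lp_size p v \<le> ennreal (C * K1 + 1) * lp_size p u"
    if u: "\<And>a. 0 \<le> u a" and v: "\<And>b. 0 \<le> v b" and dom: "\<And>b. v b \<le> C * (\<Sum>a\<in>R b. u a)"
    for u :: "'a \<Rightarrow> real" and v :: "'b \<Rightarrow> real"
  proof -
    have "ennreal (v b) \<le> ennreal (C * K1 + 1) * (SUP a. ennreal (u a))" for b
    proof -
      have "ennreal (v b) \<le> ennreal (C * (\<Sum>a\<in>R b. u a))" using dom by (intro ennreal_leI)
      also have "\<dots> = ennreal C * (\<Sum>a\<in>R b. ennreal (u a))"
        using C u by (simp add: ennreal_mult sum_nonneg sum_ennreal)
      also have "\<dots> \<le> ennreal C * (\<Sum>a\<in>R b. (SUP a. ennreal (u a)))"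
        by (intro mult_left_mono sum_mono SUP_upper) auto
      also have "\<dots> \<le> ennreal C * (of_nat K1 * (SUP a. ennreal (u a)))"
        using R(2)[of b] by (auto intro!: mult_left_mono mult_right_mono)
      also have "\<dots> = ennreal (C * K1) * (SUP a. ennreal (u a))"
        using C by (simp add: ennreal_mult ennreal_of_nat_eq_real_of_nat mult.assoc)
      also have "\<dots> \<le> ennreal (C * K1 + 1) * (SUP a. ennreal (u a))"
        by (intro mult_right_mono ennreal_leI) auto
      finally show ?thesis .
    qed
    then show ?thesis using True by (auto simp: lp_size_def intro!: SUP_least)
  qed
  moreover have "C * K1 + 1 > 0" using C by (simp add: add_nonneg_pos)
  ultimately show ?thesis by blast
next
  case False
  define r where "r = enn2real p"
  have r: "r \<ge> 0" by (simp add: r_def)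
  define G where "G = (C * K1) powr r"
  have G: "G \<ge> 0" by (simp add: G_def)
  have "lp_size p v \<le> ennreal (G * K2 + 1) * lp_size p u"
    if u: "\<And>a. 0 \<le> u a" and v: "\<And>b. 0 \<le> v b" and dom: "\<And>b. v b \<le> C * (\<Sum>a\<in>R b. u a)"
    for u :: "'a \<Rightarrow> real" and v :: "'b \<Rightarrow> real"
  proof -
    let ?U = "\<Sum>\<^sub>\<infinity>a. ennreal (u a powr r)"
    have point: "v b powr r \<le> G * (\<Sum>a\<in>R b. u a powr r)" for b
    proof -
      have "v b powr r \<le> (C * (\<Sum>a\<in>R b. u a)) powr r"
        using v dom r by (intro powr_mono2) auto
      also have "\<dots> = C powr r * (\<Sum>a\<in>R b. u a) powr r"
        by (rule powr_mult)
      also have "\<dots> \<le> C powr r * (real (card (R b)) powr r * (\<Sum>a\<in>R b. u a powr r))"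
        using R(1) u r by (intro mult_left_mono sum_powr_le) auto
      also have "\<dots> \<le> C powr r * (real K1 powr r * (\<Sum>a\<in>R b. u a powr r))"
        using R(2)[of b] r by (intro mult_left_mono mult_right_mono powr_mono2 sum_nonneg) auto
      finally show ?thesis using C by (simp add: G_def powr_mult mult.assoc)
    qed
    have "(\<Sum>b\<in>F. ennreal (v b powr r)) \<le> ennreal (G * K2 + 1) * ?U" if F: "finite F" for F
    proof -
      let ?A = "\<Union>b\<in>F. R b"
      have A: "finite ?A" using F R(1) by auto
      have "(\<Sum>b\<in>F. v b powr r) \<le> (\<Sum>b\<in>F. G * (\<Sum>a\<in>R b. u a powr r))"
        using point by (intro sum_mono)
      also have "\<dots> = G * (\<Sum>b\<in>F. \<Sum>a\<in>?A. if a \<in> R b then u a powr r else 0)"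
        unfolding sum_distrib_left[symmetric] using A
        by (intro arg_cong[where f = "\<lambda>x. G * x"] sum.cong refl sum.mono_neutral_cong_left) auto
      also have "\<dots> = G * (\<Sum>a\<in>?A. real (card {b\<in>F. a \<in> R b}) * u a powr r)"
        using F by (subst sum.swap) (simp add: sum.If_cases Int_def)
      also have "\<dots> \<le> G * (\<Sum>a\<in>?A. K2 * u a powr r)"
      proof (intro mult_left_mono[OF _ G] sum_mono mult_right_mono of_nat_mono)
        fix a show "card {b\<in>F. a \<in> R b} \<le> K2"
          by (rule order_trans[OF card_mono[OF R(3)] R(4)]) auto
      qed auto
      also have "\<dots> \<le> (G * K2 + 1) * (\<Sum>a\<in>?A. u a powr r)"
        by (simp add: sum_distrib_left[symmetric] distrib_right sum_nonneg)
      finally have "ennreal (\<Sum>b\<in>F. v b powr r) \<le> ennreal ((G * K2 + 1) * (\<Sum>a\<in>?A. u a powr r))"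
        by (rule ennreal_leI)
      then have "(\<Sum>b\<in>F. ennreal (v b powr r)) \<le> ennreal (G * K2 + 1) * (\<Sum>a\<in>?A. ennreal (u a powr r))"
        using G by (simp add: ennreal_mult sum_nonneg sum_ennreal del: ennreal_plus)
      also have "\<dots> \<le> ennreal (G * K2 + 1) * ?U"
        using A by (intro mult_left_mono sum_le_infsum_ennreal) auto
      finally show ?thesis .
    qed
    then show ?thesis using False by (auto simp: lp_size_def r_def intro!: infsum_le_ennreal)
  qed
  moreover have "G * K2 + 1 > 0" using G by (simp add: add_nonneg_pos)
  ultimately show ?thesis by blast
qed

text \<open>Integrates a step function with unit steps by exhausting the line with finitely many of
  them.\<close>

lemma nn_integral_floor_le:
  fixes h :: "int \<Rightarrow> ennreal"
  shows "(\<integral>\<^sup>+x. h \<lfloor>x::real\<rfloor> \<partial>lborel) \<le> (\<Sum>\<^sub>\<infinity>L\<in>UNIV. h L)"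
proof -
  define g where "g n x = (\<Sum>L\<in>{- int n..<int n}. h L * indicator {real_of_int L..<real_of_int L + 1} x)"
    for n and x :: real
  have ind: "indicator {real_of_int L..<real_of_int L + 1} x = (if L
      = \<lfloor>x\<rfloor> then 1 else (0::ennreal))" for L x
    by (auto simp: indicator_def floor_unique dest: floor_unique)
  have g: "g n x = (if \<lfloor>x\<rfloor> \<in> {- int n..<int n} then h \<lfloor>x\<rfloor> else 0)" for n x
    unfolding g_def ind by (simp add: if_distrib[of "\<lambda>t. h _ * t"] cong: if_cong)
  have SUP: "h \<lfloor>x\<rfloor> = (SUP n. g n x)" for x :: real
  proof (rule antisym)
    have "\<lfloor>x\<rfloor> \<in> {- int (nat \<bar>\<lfloor>x\<rfloor>\<bar> + 1)..<int (nat \<bar>\<lfloor>x\<rfloor>\<bar> + 1)}" by auto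
    then have "h \<lfloor>x\<rfloor> = g (nat \<bar>\<lfloor>x\<rfloor>\<bar> + 1) x" unfolding g by simp
    then show "h \<lfloor>x\<rfloor> \<le> (SUP n. g n x)" by (metis SUP_upper UNIV_I)
    show "(SUP n. g n x) \<le> h \<lfloor>x\<rfloor>"
      by (rule SUP_least) (simp add: g)
  qed
  have int: "(\<integral>\<^sup>+x. g n x \<partial>lborel) = (\<Sum>L\<in>{- int n..<int n}. h L)" for n
    unfolding g_def by (subst nn_integral_sum) (auto simp: nn_integral_cmult_indicator)
  have "(\<integral>\<^sup>+x. h \<lfloor>x::real\<rfloor> \<partial>lborel) = (SUP n. (\<integral>\<^sup>+x. g n x \<partial>lborel))"
    unfolding SUP
  proof (rule nn_integral_monotone_convergence_SUP)
    show "incseq g" by (auto simp: incseq_def le_fun_def g)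
    show "g n \<in> borel_measurable lborel" for n unfolding g_def by measurable
  qed
  also have "\<dots> \<le> (\<Sum>\<^sub>\<infinity>L\<in>UNIV. h L)"
    unfolding int by (intro SUP_least sum_le_infsum_ennreal) auto
  finally show ?thesis .
qed

lemma AE_lborel_not_Ints: "AE x in lborel. x \<notin> (\<int> :: real set)"
  by (intro AE_not_in countable_imp_null_set_lborel) (simp add: Ints_def)

lemma AE_lborel_in_interval:
  fixes a b :: real
  assumes "AE x in lborel. P x" "a < b"
  shows "\<exists>x\<in>{a<..<b}. P x"
proof (rule ccontr)
  assume neg: "\<not> ?thesis"
  from AE_E[OF assms(1)] obtain N where
    N: "{x \<in> space lborel. \<not> P x} \<subseteq> N" "emeasure lborel N = 0" "N \<in> sets lborel" by metis
  then have "{a<..<b} \<subseteq> N" using neg by auto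
  then have "emeasure lborel {a<..<b} \<le> emeasure lborel N" using N(3) by (intro emeasure_mono)
  then show False using N(2) assms(2) by simp
qed

section \<open>Equivalence of the size of a series and the size of its coefficients\<close>

context shift_generator begin

text \<open>Off the integers the series is dominated by a step function whose value on a unit
  interval is a multiple of the sum of the \<open>m\<close> coefficients alive there.\<close>

lemma Lp_upper:
  "\<exists>D>0. \<forall>c. Lp_size p (series c) \<le> ennreal D * lp_size p (\<lambda>l. norm (c l))"
proof -
  obtain B where B: "B \<ge> 0"
    "\<And>c L t. t \<in> {0<..<1} \<Longrightarrow> norm (series c (real_of_int L + t)) \<le> B * (\<Sum>i<m. norm (c (L - int i)))"
    using series_bounded by blast
  define R where "R L = (\<lambda>i. L - int i) ` {..<m}" for L
  have R': "{L. l \<in> R L} = (\<lambda>i. l + int i) ` {..<m}" for l by (auto simp: R_def)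
  have "\<exists>D>0. \<forall>u v. (\<forall>a. 0 \<le> u a) \<longrightarrow> (\<forall>b. 0 \<le> v b) \<longrightarrow> (\<forall>b. v b \<le> B * (\<Sum>a\<in>R b. u a)) \<longrightarrow>
       lp_size p v \<le> ennreal D * lp_size p u"
  proof (rule lp_size_local_bound[OF B(1), of R m m])
    show "card (R L) \<le> m" for L unfolding R_def using card_image_le[of "{..<m}"] by simp
    show "card {L. l \<in> R L} \<le> m" for l unfolding R' using card_image_le[of "{..<m}"] by simp
    show "finite {L. l \<in> R L}" for l unfolding R' by simp
  qed (auto simp: R_def)
  then obtain D where D: "D > 0" "\<forall>u v. (\<forall>a. 0 \<le> u a) \<longrightarrow> (\<forall>b. 0 \<le> v b) \<longrightarrow>
       (\<forall>b. v b \<le> B * (\<Sum>a\<in>R b. u a)) \<longrightarrow> lp_size p v \<le> ennreal D * lp_size p u" by blast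
  have "Lp_size p (series c) \<le> ennreal D * lp_size p (\<lambda>l. norm (c l))" for c
  proof -
    define v where "v L = B * (\<Sum>l\<in>R L. norm (c l))" for L
    have v0: "v L \<ge> 0" for L using B(1) by (simp add: v_def sum_nonneg)
    have point: "norm (series c x) \<le> v \<lfloor>x\<rfloor>" if "x \<notin> \<int>" for x
    proof -
      from noninteger_decompose[OF that] obtain L t where x: "x
          = real_of_int L + t" "t \<in> {0<..<1}" by blast
      then have "\<lfloor>x\<rfloor> = L" by (intro floor_unique) auto
      moreover have "(\<Sum>l\<in>R L. norm (c l)) = (\<Sum>i<m. norm (c (L - int i)))"
        unfolding R_def by (subst sum.reindex) (auto simp: inj_on_def)
      ultimately show ?thesis using B(2)[OF x(2), of c L] x(1) by (simp add: v_def)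
    qed
    have "Lp_size p (series c) \<le> lp_size p v"
    proof (cases "p = \<infinity>")
      case True
      have "esssup lborel (\<lambda>x. ennreal (norm (series c x))) \<le> (SUP L. ennreal (v L))"
      proof (rule esssup_I)
        show "(\<lambda>x. ennreal (norm (series c x))) \<in> borel_measurable lborel"
          using series_measurable[of c] by measurable
        show "AE x in lborel. ennreal (norm (series c x)) \<le> (SUP L. ennreal (v L))"
          using AE_lborel_not_Ints
        proof eventually_elim
          case (elim x)
          then have "ennreal (norm (series c x)) \<le> ennreal (v \<lfloor>x\<rfloor>)" using point by (intro ennreal_leI)
          also have "\<dots> \<le> (SUP L. ennreal (v L))" by (rule SUP_upper) simp
          finally show ?case .
        qed
      qed
      then show ?thesis using True by (simp add: Lp_size_def lp_size_def)
    next
      case False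
      have "(\<integral>\<^sup>+x. ennreal (norm (series c x) powr enn2real p) \<partial>lborel)
          \<le> (\<integral>\<^sup>+x. ennreal (v \<lfloor>x::real\<rfloor> powr enn2real p) \<partial>lborel)"
      proof (rule nn_integral_mono_AE)
        show "AE x in lborel. ennreal (norm (series c x) powr enn2real p)
            \<le> ennreal (v \<lfloor>x\<rfloor> powr enn2real p)"
          using AE_lborel_not_Ints
          by eventually_elim (auto intro!: ennreal_leI powr_mono2 point)
      qed
      also have "\<dots> \<le> (\<Sum>\<^sub>\<infinity>L\<in>UNIV. ennreal (v L powr enn2real p))"
        by (rule nn_integral_floor_le)
      finally show ?thesis using False by (simp add: Lp_size_def lp_size_def)
    qed
    also have "\<dots> \<le> ennreal D * lp_size p (\<lambda>l. norm (c l))"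
      by (rule D(2)[rule_format]) (use v0 in \<open>auto simp: v_def\<close>)
    finally show ?thesis .
  qed
  with D(1) show ?thesis by blast
qed

text \<open>Point values mean nothing in \<open>L^p\<close>, so the estimate at shifted points is
  used for many shifts at once: for infinite \<open>p\<close> some shift avoids all exceptional null
  sets, and for finite \<open>p\<close> the estimate is integrated over the shifts.\<close>

lemma Lp_lower:
  "\<exists>D>0. \<forall>c. lp_size p (\<lambda>l. norm (c l)) \<le> ennreal D * Lp_size p (series c)"
proof -
  from coefficient_bound obtain K z \<delta> B where main: "\<delta> > 0 \<and> B \<ge> 0 \<and>
     (\<forall>r<(K::nat). \<forall>t. \<bar>t\<bar> < \<delta> \<longrightarrow> z r + t \<in> {0<..<1}) \<and>
     (\<forall>c L t. \<bar>t\<bar> < \<delta> \<longrightarrow> norm (c L) \<le> B * (\<Sum>r<K. norm (series c (real_of_int L + (z r + t)))))"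
    by blast
  then have \<delta>: "\<delta> > 0" and B: "B \<ge> 0" by auto
  have z: "z r + t \<in> {0<..<1}" if "r < K" "\<bar>t\<bar> < \<delta>" for r t
    using main that by blast
  have bound: "norm (c L) \<le> B * (\<Sum>r<K. norm (series c (real_of_int L + (z r + t))))"
    if "\<bar>t\<bar> < \<delta>" for c L t
    using main that by blast
  show ?thesis
  proof (cases "p = \<infinity>")
    case True
    have "ennreal (norm (c L)) \<le> ennreal (B * K + 1) * esssup lborel (\<lambda>x. ennreal (norm (series c x)))" for c L
    proof -
      let ?N = "esssup lborel (\<lambda>x. ennreal (norm (series c x)))"
      have meas: "Measurable.pred borel (\<lambda>x. ennreal (norm (series c x)) \<le> ?N)"
        using series_measurable[of c] by measurable
      have "AE t in lborel. ennreal (norm (series c (real_of_int L + (z r + t)))) \<le> ?N" for r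
        \<comment> \<open>The essential bound holds almost everywhere, and this survives the
          translation to each of the finitely many points.\<close>
        using AE_borel_affine[OF _ meas esssup_AE, of 1 "real_of_int L + z r"] by (simp add: add.assoc)
      then have "AE t in lborel. \<forall>r\<in>{..<K}. ennreal (norm (series c (real_of_int L + (z r + t)))) \<le> ?N"
        by (subst AE_ball_countable) auto
      then have "\<exists>t\<in>{- \<delta><..<\<delta>}. \<forall>r\<in>{..<K}. ennreal (norm (series c (real_of_int L + (z r + t)))) \<le> ?N"
        using \<delta> by (intro AE_lborel_in_interval) auto
      then obtain t where "t \<in> {- \<delta><..<\<delta>}" and
        le: "\<forall>r\<in>{..<K}. ennreal (norm (series c (real_of_int L + (z r + t)))) \<le> ?N" by blast
      then have t: "\<bar>t\<bar> < \<delta>" by auto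
      have "ennreal (norm (c L)) \<le> ennreal (B * (\<Sum>r<K. norm (series c (real_of_int L + (z r + t)))))"
        using bound[OF t] by (rule ennreal_leI)
      also have "\<dots> = ennreal B * (\<Sum>r<K. ennreal (norm (series c (real_of_int L + (z r + t)))))"
        using B by (simp add: ennreal_mult sum_nonneg sum_ennreal)
      also have "\<dots> \<le> ennreal B * (\<Sum>r<K. ?N)"
        using le by (intro mult_left_mono sum_mono) auto
      also have "\<dots> = ennreal (B * K) * ?N"
        using B by (simp add: ennreal_mult ennreal_of_nat_eq_real_of_nat mult.assoc)
      also have "\<dots> \<le> ennreal (B * K + 1) * ?N"
        by (intro mult_right_mono ennreal_leI) auto
      finally show ?thesis .
    qed
    then have "lp_size p (\<lambda>l. norm (c l)) \<le> ennreal (B * K + 1) * Lp_size p (series c)" for c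
      using True by (auto simp: lp_size_def Lp_size_def intro!: SUP_least)
    moreover have "B * K + 1 > 0" using B by (simp add: add_nonneg_pos)
    ultimately show ?thesis by blast
  next
    case False
    define q where "q = enn2real p"
    have q: "q \<ge> 0" by (simp add: q_def)
    define G where "G = B powr q * real K powr q"
    have G: "G \<ge> 0" by (simp add: G_def)
    have "(\<Sum>l\<in>F. ennreal (norm (c l) powr q)) \<le> ennreal (G * K / (2 * \<delta>) + 1) *
        (\<integral>\<^sup>+x. ennreal (norm (series c x) powr q) \<partial>lborel)" if F: "finite F" for F c
    proof -
      define h where "h x = ennreal (norm (series c x) powr q)" for x
      have [measurable]: "h \<in> borel_measurable borel"
        unfolding h_def using series_measurable[of c] by measurable
      define J where "J L = (\<integral>\<^sup>+x. h x * indicator {real_of_int L<..<real_of_int L + 1} x \<partial>lborel)" for L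
      have loc: "ennreal (2 * \<delta>) * ennreal (norm (c L) powr q) \<le> ennreal (G * K) * J L" for L
      proof -
        \<comment> \<open>The shifted points stay in the unit interval of index \<open>L\<close>, so
          the indicator may be inserted; this later allows summation over \<open>L\<close>.\<close>
        have pt: "ennreal (norm (c L) powr q) * indicator {- \<delta><..<\<delta>} t
            \<le> ennreal G * (\<Sum>r<K. h ((real_of_int L + z r) + t) *
                indicator {real_of_int L<..<real_of_int L + 1} ((real_of_int L + z r) + t))" for t
        proof (cases "\<bar>t\<bar> < \<delta>")
          case True
          have "norm (c L) powr q \<le> (B * (\<Sum>r<K. norm (series c (real_of_int L + (z r + t))))) powr q"
            using bound[OF True, of c L] q by (intro powr_mono2) auto
          also have "\<dots> = B powr q * (\<Sum>r<K. norm (series c (real_of_int L + (z r + t)))) powr q"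
            by (rule powr_mult)
          also have "\<dots> \<le> B powr q * (real (card {..<K}) powr q * (\<Sum>r<K. norm (series c (real_of_int L + (z r + t))) powr q))"
            using q by (intro mult_left_mono sum_powr_le) auto
          finally have "norm (c L) powr q
              \<le> G * (\<Sum>r<K. norm (series c (real_of_int L + (z r + t))) powr q)"
            by (simp add: G_def mult.assoc)
          then have "ennreal (norm (c L) powr q)
              \<le> ennreal (G * (\<Sum>r<K. norm (series c (real_of_int L + (z r + t))) powr q))"
            by (rule ennreal_leI)
          also have "\<dots> = ennreal G * (\<Sum>r<K. h (real_of_int L + (z r + t)))"
            using G by (simp add: ennreal_mult sum_nonneg sum_ennreal h_def)
          also have "\<dots> = ennreal G * (\<Sum>r<K. h ((real_of_int L + z r) + t) *
                indicator {real_of_int L<..<real_of_int L + 1} ((real_of_int L + z r) + t))"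
          proof (intro arg_cong[where f = "\<lambda>x. ennreal G * x"] sum.cong refl)
            fix r assume "r \<in> {..<K}"
            then have "z r + t \<in> {0<..<1}" using z True by auto
            then have "(real_of_int L + z r) + t \<in> {real_of_int L<..<real_of_int L + 1}" by auto
            then show "h (real_of_int L + (z r + t)) = h ((real_of_int L + z r) + t) *
                indicator {real_of_int L<..<real_of_int L + 1} ((real_of_int L + z r) + t)"
              by (simp add: add.assoc)
          qed
          finally show ?thesis using True by (simp add: abs_less_iff)
        qed (auto simp: indicator_def abs_less_iff)
        have "ennreal (2 * \<delta>) * ennreal (norm (c L) powr q) =
            (\<integral>\<^sup>+t. ennreal (norm (c L) powr q) * indicator {- \<delta><..<\<delta>} t \<partial>lborel)"
          using \<delta> by (simp add: nn_integral_cmult_indicator mult.commute)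
        also have "\<dots> \<le> (\<integral>\<^sup>+t. ennreal G * (\<Sum>r<K. h ((real_of_int L + z r) + t) *
                indicator {real_of_int L<..<real_of_int L + 1} ((real_of_int L + z r) + t)) \<partial>lborel)"
          by (intro nn_integral_mono pt)
        also have "\<dots> = ennreal G * (\<Sum>r<K. \<integral>\<^sup>+t. h ((real_of_int L + z r) + t) *
                indicator {real_of_int L<..<real_of_int L + 1} ((real_of_int L + z r) + t) \<partial>lborel)"
          by (subst nn_integral_cmult, measurable, subst nn_integral_sum) measurable
        also have "\<dots> = ennreal G * (\<Sum>r<K. J L)"
        proof (intro arg_cong[where f = "\<lambda>x. ennreal G * x"] sum.cong refl)
          fix r
          show "(\<integral>\<^sup>+t. h ((real_of_int L + z r) + t) *
                indicator {real_of_int L<..<real_of_int L + 1} ((real_of_int L + z r) + t) \<partial>lborel)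
                    = J L"
            unfolding J_def
            using nn_integral_real_affine[of "\<lambda>x. h x * indicator {real_of_int L<..<real_of_int L + 1} x" 1 "real_of_int L + z r"]
            by simp
        qed
        also have "\<dots> = ennreal (G * K) * J L"
          using G by (simp add: ennreal_mult ennreal_of_nat_eq_real_of_nat mult.assoc)
        finally show ?thesis .
      qed
      \<comment> \<open>The unit intervals are disjoint, hence the local integrals add up to at most
        the full one.\<close>
      have "(\<Sum>L\<in>F. J L) = (\<integral>\<^sup>+x. (\<Sum>L\<in>F. h x * indicator {real_of_int L<..<real_of_int L + 1} x) \<partial>lborel)"
        unfolding J_def by (subst nn_integral_sum) measurable
      also have "\<dots> \<le> (\<integral>\<^sup>+x. h x \<partial>lborel)"
      proof (rule nn_integral_mono)
        fix x :: real
        have "(\<Sum>L\<in>F. h x * indicator {real_of_int L<..<real_of_int L + 1} x)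
            \<le> (\<Sum>L\<in>F. if L = \<lfloor>x\<rfloor> then h x else 0)"
        proof (intro sum_mono)
          fix L
          show "h x * indicator {real_of_int L<..<real_of_int L + 1} x \<le> (if L = \<lfloor>x\<rfloor> then h x else 0)"
          proof (cases "x \<in> {real_of_int L<..<real_of_int L + 1}")
            case True
            then have "\<lfloor>x\<rfloor> = L" by (intro floor_unique) auto
            with True show ?thesis by simp
          next
            case False
            then show ?thesis by (subst indicator_simps(2)) auto
          qed
        qed
        also have "\<dots> \<le> h x" using F by simp
        finally show "(\<Sum>L\<in>F. h x * indicator {real_of_int L<..<real_of_int L + 1} x) \<le> h x" .
      qed
      finally have J: "(\<Sum>L\<in>F. J L) \<le> (\<integral>\<^sup>+x. h x \<partial>lborel)" .
      have one: "ennreal (1 / (2 * \<delta>)) * (ennreal (2 * \<delta>) * x) = x" for x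
        using \<delta> by (simp add: mult.assoc[symmetric] ennreal_mult[symmetric])
      have "(\<Sum>L\<in>F. ennreal (norm (c L) powr q))
          = (\<Sum>L\<in>F. ennreal (1 / (2 * \<delta>)) * (ennreal (2 * \<delta>) * ennreal (norm (c L) powr q)))"
        unfolding one ..
      also have "\<dots> \<le> (\<Sum>L\<in>F. ennreal (1 / (2 * \<delta>)) * (ennreal (G * K) * J L))"
        by (intro sum_mono mult_left_mono loc) auto
      also have "\<dots> = ennreal (G * K / (2 * \<delta>)) * (\<Sum>L\<in>F. J L)"
        using \<delta> G by (simp add: sum_distrib_left mult.assoc[symmetric] ennreal_mult[symmetric])
      also have "\<dots> \<le> ennreal (G * K / (2 * \<delta>) + 1) * (\<integral>\<^sup>+x. h x \<partial>lborel)"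
        using \<delta> G by (intro mult_mono J ennreal_leI) auto
      finally show ?thesis by (simp add: h_def)
    qed
    then have "lp_size p (\<lambda>l. norm (c l)) \<le> ennreal (G * K / (2 * \<delta>) + 1) * Lp_size p (series c)" for c
      using False by (auto simp: lp_size_def Lp_size_def q_def intro!: infsum_le_ennreal)
    moreover have "G * K / (2 * \<delta>) + 1 > 0" using G \<delta> by (simp add: add_nonneg_pos)
    ultimately show ?thesis by blast
  qed
qed

end

subsection \<open>The sampling scheme\<close>

text \<open>Each period has \<open>K\<close> restart nodes and \<open>T\<close> further nodes. The
  point \<open>y n\<close> and the weights \<open>\<beta> n\<close> depend on the multiplicity
  \<open>n\<close> alone, not on the node.\<close>

locale sampling_scheme = shift_generator +
  fixes K T :: nat and z :: "nat \<Rightarrow> real" and b :: "nat \<Rightarrow> nat \<Rightarrow> real"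
    and y :: "nat \<Rightarrow> real" and \<beta> :: "nat \<Rightarrow> nat \<Rightarrow> nat \<Rightarrow> real" and \<mu> :: "int \<Rightarrow> nat"
  assumes restart: "restart_points K z b"
    and T_pos: "T \<ge> 1"
    and mult: "\<mu> j < m"
    and y_unit: "n < m \<Longrightarrow> y n \<in> {0<..<1}"
    and y_dual: "n < m \<Longrightarrow> i \<le> n \<Longrightarrow> k \<le> n \<Longrightarrow>
      (\<Sum>s\<le>n. \<beta> n i s * nderiv s \<phi> (y n + real k)) = (if i = k then 1 else 0)"
begin

lemma K_pos: "K \<ge> 1"
  and z_unit: "r < K \<Longrightarrow> z r \<in> {0<..<1}"
  and z_less: "r < s \<Longrightarrow> s < K \<Longrightarrow> z r < z s"
  and z_dual: "i < m \<Longrightarrow> k < m \<Longrightarrow> (\<Sum>r<K. b i r * \<phi> (z r + real k)) = (if i = k then 1 else 0)"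
  using restart by (simp_all add: restart_points_def)

definition period :: nat where "period = K + T"

definition phase :: "int \<Rightarrow> nat" where "phase j = nat (j mod int period)"

text \<open>The number of unit intervals between a node and its predecessor. The first restart node
  moves by one interval and the others by none, whatever their multiplicities: at these nodes only
  the function values are used for the reconstruction.\<close>

definition step :: "int \<Rightarrow> int" where
  "step j = (if phase j = 0 then 1 else if phase j < K then 0 else int (\<mu> j) + 1)"

text \<open>An antiderivative of \<open>step\<close> on all integers with value 0 at 0, hence the
  negative sign on the left half.\<close>

definition step_sum :: "int \<Rightarrow> int" where
  "step_sum j = (if j \<ge> 0 then (\<Sum>i\<in>{0..<j}. step i) else - (\<Sum>i\<in>{j..<0}. step i))"

text \<open>The shift of the argument makes \<open>step j\<close> the increment leading to node
  \<open>j\<close>; in particular the level of node -1 is 0.\<close>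

definition level :: "int \<Rightarrow> int" where "level j = step_sum (j + 1)"

definition offset :: "int \<Rightarrow> real" where
  "offset j = (if phase j < K then z (phase j) else y (\<mu> j))"

text \<open>In every period, \<open>K\<close> nodes in a unit interval first determine the \<open>m\<close> coefficients alive there.
  Each later node then lies \<open>\<mu> j + 1\<close> intervals further to the right, so its \<open>\<mu> j + 1\<close> samples
  determine exactly the coefficients that became alive in between.\<close>

definition node :: "int \<Rightarrow> real" where "node j = real_of_int (level j) + offset j"

section \<open>Order and growth of the nodes\<close>

lemma period_pos: "period > 0" using K_pos by (simp add: period_def)

lemma phase_less: "phase j < period"
  using period_pos by (simp add: phase_def nat_less_iff)

lemma phase_eq: "r < period \<Longrightarrow> phase (q * int period + int r) = r"
  by (simp add: phase_def mod_pos_pos_trivial)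

lemma decompose: "\<exists>q. j = q * int period + int (phase j)"
  using period_pos div_mult_mod_eq[of j "int period"]
      by (auto simp: phase_def intro!: exI[of _ "j div int period"])

lemma step_sum_succ: "step_sum (j + 1) = step_sum j + step j"
proof -
  consider "j \<ge> 0" | "j = -1" | "j < -1" by linarith
  then show ?thesis
  proof cases
    case 1
    then have "{0..<j + 1} = insert j {0..<j}" by auto
    with 1 show ?thesis by (simp add: step_sum_def)
  next
    case 2
    have "{-1..<0::int} = {-1}" by auto
    with 2 show ?thesis by (simp add: step_sum_def)
  next
    case 3
    then have "{j..<0} = insert j {j + 1..<0}" by auto
    with 3 show ?thesis by (simp add: step_sum_def)
  qed
qed

lemma level_succ: "level (j + 1) = level j + step (j + 1)"
  using step_sum_succ[of "j + 1"] by (simp add: level_def add.commute add.left_commute)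

lemma step_nonneg: "step j \<ge> 0"
  by (simp add: step_def)

lemma step_le: "step j \<le> int m"
  using mult[of j] m_pos by (simp add: step_def)

lemma level_add:
  shows "level j \<le> level (j + int n)" and "level (j + int n) \<le> level j + int n * int m"
proof (induction n)
  case (Suc n)
  have eq: "level (j + int (Suc n)) = level (j + int n) + step (j + int n + 1)"
    using level_succ[of "j + int n"] by (simp add: add_ac)
  {
    case 1
    then show ?case using Suc eq step_nonneg[of "j + int n + 1"] by simp
  next
    case 2
    then show ?case using Suc eq step_le[of "j + int n + 1"] by (simp add: algebra_simps)
  }
qed auto

lemma level_mono: "i \<le> j \<Longrightarrow> level i \<le> level j"
  using level_add(1)[of i "nat (j - i)"] by simp

lemma level_diff:
  assumes "\<bar>i - j\<bar> \<le> int n"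
  shows "\<bar>level i - level j\<bar> \<le> int n * int m"
proof -
  have *: "\<bar>level i - level j\<bar> \<le> int n * int m" if "i \<le> j" "\<bar>i - j\<bar> \<le> int n" for i j
  proof -
    have "level j \<le> level i + (j - i) * int m" "level i \<le> level j"
      using that level_add(2)[of i "nat (j - i)"] level_mono by auto
    moreover have "(j - i) * int m \<le> int n * int m" using that by (intro mult_right_mono) auto
    ultimately show ?thesis by linarith
  qed
  from assms *[of i j] *[of j i] show ?thesis by (cases "i \<le> j") (auto simp: abs_minus_commute)
qed

lemma level_block_start: "level (q * int period) = level (q * int period - 1) + 1"
  using level_succ[of "q * int period - 1"] phase_eq[of 0 q] period_pos by (simp add: step_def)

text \<open>Every stretch of one period contains the start of a block, where the level rises by 1.
  This prevents nodes from accumulating and yields bounded overlap.\<close>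

lemma level_growth: "level j + int n \<le> level (j + int n * int period)"
proof (induction n)
  case (Suc n)
  let ?i = "j + int n * int period"
  obtain q where q: "?i = q * int period + int (phase ?i)" using decompose by blast
  have "level ?i \<le> level ((q + 1) * int period - 1)"
    using q phase_less[of ?i] by (intro level_mono) (simp add: algebra_simps)
  also have "\<dots> + 1 = level ((q + 1) * int period)" using level_block_start[of "q + 1"] by simp
  also have "\<dots> \<le> level (?i + int period)"
    using q by (intro level_mono) (simp add: algebra_simps)
  finally have "level ?i + 1 \<le> level (?i + int period)" by simp
  then show ?case using Suc by (simp add: algebra_simps)
qed simp

lemma offset_unit: "offset j \<in> {0<..<1}"
  using z_unit y_unit[OF mult] by (simp add: offset_def)

text \<open>Makes the sampled derivatives ordinary ones, even of order \<open>m - 1\<close>, since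
  the right-sided limits in \<open>deriv_val\<close> occur only at integers.\<close>

lemma node_not_Ints: "node j \<notin> \<int>"
proof
  assume "node j \<in> \<int>"
  then obtain k where "node j = real_of_int k" by (elim Ints_cases)
  then have "offset j = real_of_int (k - level j)" by (simp add: node_def)
  then obtain i where "offset j = real_of_int i" by blast
  then have "0 < i" "i < 1" using offset_unit[of j] by simp_all
  then show False by simp
qed

lemma phase_succ:
  assumes "0 < phase (j + 1)"
  shows "phase (j + 1) = Suc (phase j)"
proof -
  obtain q where q: "j + 1 = q * int period + int (phase (j + 1))" using decompose by blast
  then have "j = q * int period + int (phase (j + 1) - 1)" using assms by simp
  then show ?thesis using phase_eq[of "phase (j + 1) - 1" q] phase_less[of "j + 1"] assms by simp
qed

text \<open>Without a step, both nodes belong to one restart and are ordered by \<open>z\<close>;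
  with a step, the second lies in a later unit interval.\<close>

lemma node_less_succ: "node j < node (j + 1)"
proof (cases "step (j + 1) = 0")
  case True
  then have ph: "0 < phase (j + 1)" "phase (j + 1) < K"
    by (auto simp: step_def split: if_splits)
  then have "z (phase j) < z (phase (j + 1))" using phase_succ[OF ph(1)] by (intro z_less) simp_all
  then show ?thesis
    using True ph phase_succ[OF ph(1)] level_succ[of j] by (simp add: node_def offset_def)
next
  case False
  then have "level j + 1 \<le> level (j + 1)" using level_succ[of j] step_nonneg[of "j + 1"] by linarith
  then have "real_of_int (level j) + 1 \<le> real_of_int (level (j + 1))"
    by (metis of_int_1 of_int_add of_int_le_iff)
  then show ?thesis using offset_unit[of j] offset_unit[of "j + 1"] by (simp add: node_def)
qed

lemma node_strict_mono: "strict_mono node"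
proof (rule strict_monoI)
  fix i j :: int assume "i < j"
  have "node i < node (i + 1 + int n)" for n
  proof (induction n)
    case (Suc n)
    then show ?case using node_less_succ[of "i + 1 + int n"] by (simp add: add_ac)
  qed (simp add: node_less_succ)
  from this[of "nat (j - i - 1)"] \<open>i < j\<close> show "node i < node j" by simp
qed

text \<open>One number per node, so that the domination principle can be applied with the integers
  as index set. Splitting it into single samples later costs only factors depending on
  \<open>m\<close> and \<open>p\<close>.\<close>

definition samples :: "(int \<Rightarrow> complex) \<Rightarrow> int \<Rightarrow> real" where
  "samples c j = (\<Sum>s\<le>\<mu> j. norm (nderiv s (series c) (node j)))"

lemma samples_nonneg: "samples c j \<ge> 0"
  by (simp add: samples_def sum_nonneg)

lemma sample_le: "s \<le> \<mu> j \<Longrightarrow> norm (nderiv s (series c) (node j)) \<le> samples c j"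
  unfolding samples_def by (intro member_le_sum) auto

lemma sample_eq:
  assumes "s < m"
  shows "nderiv s (series c) (node j) =
    (\<Sum>i<m. c (level j - int i) * complex_of_real (nderiv s \<phi> (offset j + real i)))"
  unfolding node_def by (rule series_nderiv(1)[OF offset_unit assms])

text \<open>Within one period levels differ by at most \<open>period * m\<close>, and the alive
  coefficients lie at most \<open>m\<close> below the level; the sum covers every dependence of
  coefficients on samples of the same period.\<close>

definition width :: int where "width = int period * int m + int m"

definition near :: "int \<Rightarrow> int set" where "near j = {l. \<bar>l - level j\<bar> \<le> width}"

lemma width_nonneg: "width \<ge> 0" and width_ge: "int m \<le> width"
  by (simp_all add: width_def)

lemma near_eq: "near j = {level j - width..level j + width}"
  by (auto simp: near_def)

lemma finite_near: "finite (near j)" and card_near: "card (near j) = nat (2 * width + 1)"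
  by (auto simp: near_eq)

text \<open>Two nodes near the same coefficient have levels at most \<open>2 * width\<close> apart,
  and \<open>2 * width + 1\<close> periods would raise the level by more.\<close>

lemma near_spread:
  assumes "l \<in> near i" "l \<in> near j"
  shows "j < i + (2 * width + 1) * int period"
proof (rule ccontr)
  assume "\<not> ?thesis"
  then have "level (i + int (nat (2 * width + 1)) * int period) \<le> level j"
    using width_nonneg by (intro level_mono) auto
  then have "level i + (2 * width + 1) \<le> level j"
    using level_growth[of i "nat (2 * width + 1)"] width_nonneg by simp
  then show False using assms by (auto simp: near_def)
qed

lemma finite_near_inv: "finite {j. l \<in> near j}"
  and card_near_inv: "card {j. l \<in> near j} \<le> nat (2 * ((2 * width + 1) * int period))"
proof -
  define D where "D = (2 * width + 1) * int period"
  have "finite {j. l \<in> near j} \<and> card {j. l \<in> near j} \<le> nat (2 * D)"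
  proof (cases "{j. l \<in> near j} = {}")
    case False
    then obtain i where i: "l \<in> near i" by auto
    have "j \<in> {i - D..<i + D}" if "l \<in> near j" for j
      using near_spread[OF i that] near_spread[OF that i] by (auto simp: D_def)
    then have sub: "{j. l \<in> near j} \<subseteq> {i - D..<i + D}" by auto
    then have "card {j. l \<in> near j} \<le> card {i - D..<i + D}" by (intro card_mono) auto
    then show ?thesis using sub finite_subset by auto
  qed simp
  then show "finite {j. l \<in> near j}"
    "card {j. l \<in> near j} \<le> nat (2 * ((2 * width + 1) * int period))"
    by (simp_all only: D_def)
qed

text \<open>Each sample is a combination of \<open>m\<close> alive coefficients. Its weights are
  bounded uniformly because the offsets form a finite set.\<close>

lemma samples_upper: "\<exists>C\<ge>0. \<forall>c j. samples c j \<le> C * (\<Sum>l\<in>near j. norm (c l))"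
proof -
  define Os where "Os = z ` {..<K} \<union> y ` {..<m}"
  have Os: "finite Os" "offset j \<in> Os" for j using mult by (auto simp: Os_def offset_def)
  define C where "C = (\<Sum>t\<in>Os. \<Sum>s<m. \<Sum>i<m. \<bar>nderiv s \<phi> (t + real i)\<bar>)"
  have C0: "C \<ge> 0" unfolding C_def by (intro sum_nonneg) auto
  have C: "\<bar>nderiv s \<phi> (offset j + real i)\<bar> \<le> C" if "s < m" "i < m" for s i j
  proof -
    have "\<bar>nderiv s \<phi> (offset j + real i)\<bar> \<le> (\<Sum>i<m. \<bar>nderiv s \<phi> (offset j + real i)\<bar>)"
      using that by (intro member_le_sum[of i]) auto
    also have "\<dots> \<le> (\<Sum>s<m. \<Sum>i<m. \<bar>nderiv s \<phi> (offset j + real i)\<bar>)"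
      using that by (intro member_le_sum[of s "{..<m}" "\<lambda>s. \<Sum>i<m. \<bar>nderiv s \<phi> (offset j + real i)\<bar>"])
        (auto intro: sum_nonneg)
    also have "\<dots> \<le> C"
      unfolding C_def using Os
      by (intro member_le_sum[of "offset j" Os "\<lambda>t. \<Sum>s<m. \<Sum>i<m. \<bar>nderiv s \<phi> (t + real i)\<bar>"])
        (auto intro!: sum_nonneg)
    finally show ?thesis .
  qed
  have "samples c j \<le> (real m * C) * (\<Sum>l\<in>near j. norm (c l))" for c j
  proof -
    have sub: "(\<lambda>i. level j - int i) ` {..<m} \<subseteq> near j" using width_ge by (auto simp: near_def)
    have "norm (nderiv s (series c) (node j)) \<le> C * (\<Sum>l\<in>near j. norm (c l))" if "s \<le> \<mu> j" for s
    proof -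
      have s: "s < m" using that mult[of j] by simp
      have "norm (nderiv s (series c) (node j)) \<le> (\<Sum>i<m. C * norm (c (level j - int i)))"
        unfolding sample_eq[OF s]
      proof (intro sum_norm_le)
        fix i assume "i \<in> {..<m}"
        then have "norm (c (level j - int i)) * \<bar>nderiv s \<phi> (offset j + real i)\<bar>
            \<le> norm (c (level j - int i)) * C" using C[OF s] by (intro mult_left_mono) auto
        then show "norm (c (level j - int i) * complex_of_real (nderiv s \<phi> (offset j + real i)))
            \<le> C * norm (c (level j - int i))" by (simp add: norm_mult mult.commute)
      qed
      also have "\<dots> = C * (\<Sum>l\<in>(\<lambda>i. level j - int i) ` {..<m}. norm (c l))"
        by (subst sum.reindex) (auto simp: inj_on_def sum_distrib_left)
      also have "\<dots> \<le> C * (\<Sum>l\<in>near j. norm (c l))"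
        using C0 sub finite_near by (intro mult_left_mono sum_mono2) auto
      finally show ?thesis .
    qed
    then have "samples c j \<le> real (card {..\<mu> j}) * (C * (\<Sum>l\<in>near j. norm (c l)))"
      unfolding samples_def by (intro sum_bounded_above) auto
    also have "\<dots> \<le> real m * (C * (\<Sum>l\<in>near j. norm (c l)))"
      using mult[of j] C0 by (intro mult_right_mono) (auto intro!: mult_nonneg_nonneg sum_nonneg)
    finally show ?thesis by (simp add: mult.assoc)
  qed
  then show ?thesis using C0 by (intro exI[of _ "real m * C"]) auto
qed

section \<open>Recovering the coefficients from the samples of one period\<close>

definition block :: "(int \<Rightarrow> complex) \<Rightarrow> int \<Rightarrow> real" where
  "block c q = (\<Sum>r<period. samples c (q * int period + int r))"

lemma block_nonneg: "block c q \<ge> 0"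
  unfolding block_def by (intro sum_nonneg samples_nonneg)

lemma samples_le_block: "r < period \<Longrightarrow> samples c (q * int period + int r) \<le> block c q"
  unfolding block_def by (intro member_le_sum) (auto simp: samples_nonneg)

lemma level_restart: "r < K \<Longrightarrow> level (q * int period + int r) = level (q * int period)"
proof (induction r)
  case (Suc r)
  have "r + 1 < period" using Suc.prems by (simp add: period_def)
  then have "phase (q * int period + int r + 1) = Suc r"
    using phase_eq[of "Suc r" q] by (simp add: add_ac)
  then have "step (q * int period + int r + 1) = 0" using Suc.prems by (simp add: step_def)
  then show ?case using Suc level_succ[of "q * int period + int r"] by (simp add: add_ac)
qed simp

text \<open>All \<open>K\<close> restart nodes of a block have the same level, so the dual weights
  apply directly to the values of the series there.\<close>

lemma block_restart:
  "\<exists>C\<ge>0. \<forall>c q. \<forall>i<m. norm (c (level (q * int period) - int i)) \<le> C * block c q"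
proof -
  define C where "C = (\<Sum>i<m. \<Sum>r<K. \<bar>b i r\<bar>)"
  have "norm (c (level (q * int period) - int i)) \<le> C * block c q" if i: "i < m" for c q i
  proof -
    let ?j = "\<lambda>r. q * int period + int r" and ?L = "level (q * int period)"
    have F: "series c (node (?j r)) = (\<Sum>k<m. c (?L - int k) * complex_of_real (\<phi> (z r + real k)))"
      if "r < K" for r
      using sample_eq[of 0 c "?j r"] m_pos level_restart[OF that] phase_eq[of r q] that
      by (simp add: offset_def period_def)
    have Fle: "norm (series c (node (?j r))) \<le> block c q" if "r < K" for r
      using sample_le[of 0 "?j r" c] samples_le_block[of r c q] that by (simp add: period_def)
    have "(\<Sum>r<K. complex_of_real (b i r) * series c (node (?j r)))
       = (\<Sum>r<K. \<Sum>k<m. complex_of_real (b i r) * (c (?L - int k) * complex_of_real (\<phi> (z r + real k))))"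
      by (intro sum.cong refl) (simp add: F sum_distrib_left)
    also have "\<dots> = (\<Sum>k<m. c (?L - int k) * complex_of_real (\<Sum>r<K. b i r * \<phi> (z r + real k)))"
      by (subst sum.swap) (simp add: sum_distrib_left mult_ac)
    also have "\<dots> = (\<Sum>k<m. if i = k then c (?L - int k) else 0)"
      using z_dual[OF i] by (intro sum.cong refl) auto
    also have "\<dots> = c (?L - int i)" using i by simp
    finally have "norm (c (?L - int i)) = norm (\<Sum>r<K. complex_of_real (b i r) * series c (node (?j r)))"
      by simp
    also have "\<dots> \<le> (\<Sum>r<K. \<bar>b i r\<bar> * block c q)"
      using Fle by (intro sum_norm_le) (simp add: norm_mult mult_left_mono)
    also have "\<dots> = (\<Sum>r<K. \<bar>b i r\<bar>) * block c q" by (simp add: sum_distrib_right)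
    also have "\<dots> \<le> C * block c q"
      unfolding C_def using i block_nonneg
      by (intro mult_right_mono member_le_sum[of i "{..<m}" "\<lambda>i. \<Sum>r<K. \<bar>b i r\<bar>"]) (auto intro!: sum_nonneg)
    finally show ?thesis .
  qed
  moreover have "C \<ge> 0" unfolding C_def by (intro sum_nonneg) auto
  ultimately show ?thesis by blast
qed

text \<open>With n the multiplicity of the new node, the Hermite weights applied to its samples give
  a new coefficient plus a combination of alive coefficients of index greater than n, and these were
  known before. \<open>B1\<close> bounds the weights and \<open>B2\<close> the coupling to the known
  coefficients.\<close>

lemma block_advance:
  "\<exists>B1 B2. B1 \<ge> 0 \<and> B2 \<ge> 0 \<and> (\<forall>c j C. phase (j + 1) \<ge> K \<longrightarrow> C \<ge> 0 \<longrightarrow>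
     (\<forall>i<m. norm (c (level j - int i)) \<le> C) \<longrightarrow>
     (\<forall>i<m. norm (c (level (j + 1) - int i)) \<le> B1 * samples c (j + 1) + (B2 + 1) * C))"
proof -
  define e where "e n i k = (\<Sum>s\<le>n. \<beta> n i s * nderiv s \<phi> (y n + real k))" for n i k
  define B1 where "B1 = (\<Sum>n<m. \<Sum>i<m. \<Sum>s\<le>n. \<bar>\<beta> n i s\<bar>)"
  define B2 where "B2 = (\<Sum>n<m. \<Sum>i<m. \<Sum>k<m. \<bar>e n i k\<bar>)"
  have B10: "B1 \<ge> 0" unfolding B1_def by (intro sum_nonneg) auto
  have B20: "B2 \<ge> 0" unfolding B2_def by (intro sum_nonneg) auto
  have B1: "(\<Sum>s\<le>n. \<bar>\<beta> n i s\<bar>) \<le> B1" if "n < m" "i < m" for n i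
  proof -
    have "(\<Sum>s\<le>n. \<bar>\<beta> n i s\<bar>) \<le> (\<Sum>i<m. \<Sum>s\<le>n. \<bar>\<beta> n i s\<bar>)"
      using that by (intro member_le_sum[of i "{..<m}" "\<lambda>i. \<Sum>s\<le>n. \<bar>\<beta> n i s\<bar>"]) (auto intro!: sum_nonneg)
    also have "\<dots> \<le> B1" unfolding B1_def
      using that by (intro member_le_sum[of n "{..<m}" "\<lambda>n. \<Sum>i<m. \<Sum>s\<le>n. \<bar>\<beta> n i s\<bar>"]) (auto intro!: sum_nonneg)
    finally show ?thesis .
  qed
  have B2: "(\<Sum>k<m. \<bar>e n i k\<bar>) \<le> B2" if "n < m" "i < m" for n i
  proof -
    have "(\<Sum>k<m. \<bar>e n i k\<bar>) \<le> (\<Sum>i<m. \<Sum>k<m. \<bar>e n i k\<bar>)"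
      using that by (intro member_le_sum[of i "{..<m}" "\<lambda>i. \<Sum>k<m. \<bar>e n i k\<bar>"]) (auto intro!: sum_nonneg)
    also have "\<dots> \<le> B2" unfolding B2_def
      using that by (intro member_le_sum[of n "{..<m}" "\<lambda>n. \<Sum>i<m. \<Sum>k<m. \<bar>e n i k\<bar>"]) (auto intro!: sum_nonneg)
    finally show ?thesis .
  qed
  have "norm (c (level (j + 1) - int i)) \<le> B1 * samples c (j + 1) + (B2 + 1) * C"
    if ph: "phase (j + 1) \<ge> K" and C0: "C \<ge> 0" and known: "\<forall>i<m. norm (c (level j - int i))
        \<le> C" and i: "i < m"
    for c j C i
  proof -
    define n where "n = \<mu> (j + 1)"
    have n: "n < m" using mult by (simp add: n_def)
    let ?L = "level (j + 1)"
    have L: "?L = level j + int n + 1" using level_succ[of j] ph K_pos by (simp add: step_def n_def)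
    have old: "norm (c (?L - int k)) \<le> C" if "n < k" "k < m" for k
    proof -
      \<comment> \<open>The level has risen by \<open>n + 1\<close>, so the alive coefficient number
        \<open>k\<close> beyond \<open>n\<close> was number \<open>k - n - 1\<close> before.\<close>
      have "?L - int k = level j - int (k - n - 1)" using L that by simp
      then show ?thesis using known[rule_format, of "k - n - 1"] that by (simp only:)
    qed
    show ?thesis
    proof (cases "n < i")
      case True
      have "norm (c (?L - int i)) \<le> C" using old[OF True i] .
      also have "\<dots> \<le> B1 * samples c (j + 1) + (B2 + 1) * C"
        using B10 B20 C0 samples_nonneg[of c "j + 1"] by (simp add: distrib_right)
      finally show ?thesis .
    next
      case False
      then have i': "i \<le> n" by simp
      let ?f = "\<lambda>s. nderiv s (series c) (node (j + 1))"
      have e_eq: "e n i k = (if i = k then 1 else 0)" if "k \<le> n" for k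
        unfolding e_def using n i' that by (rule y_dual)
      have off: "offset (j + 1) = y n" using ph by (simp add: offset_def n_def)
      define X where "X = (\<Sum>s\<le>n. complex_of_real (\<beta> n i s) * ?f s)"
      \<comment> \<open>The contribution of the known coefficients; for \<open>k \<le> n\<close>
        duality leaves nothing but the wanted one.\<close>
      define Y where "Y = (\<Sum>k<m. if n < k then c (?L - int k) * complex_of_real (e n i k) else 0)"
      have "X
        = (\<Sum>s\<le>n. \<Sum>k<m. complex_of_real (\<beta> n i s) * (c (?L - int k) * complex_of_real (nderiv s \<phi> (y n + real k))))"
        unfolding X_def
      proof (intro sum.cong refl)
        fix s assume "s \<in> {..n}"
        then have "s < m" using n by simp
        then show "complex_of_real (\<beta> n i s) * ?f s =
          (\<Sum>k<m. complex_of_real (\<beta> n i s) * (c (?L - int k) * complex_of_real (nderiv s \<phi> (y n + real k))))"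
          by (simp only: sample_eq off sum_distrib_left)
      qed
      also have "\<dots> = (\<Sum>k<m. c (?L - int k) * complex_of_real (e n i k))"
        unfolding e_def by (subst sum.swap) (simp add: sum_distrib_left mult_ac)
      also have "\<dots> = (\<Sum>k<m. (if k = i then c (?L - int k) else 0)
            + (if n < k then c (?L - int k) * complex_of_real (e n i k) else 0))"
        using e_eq i' by (intro sum.cong refl) auto
      also have "\<dots> = c (?L - int i) + Y"
        unfolding sum.distrib Y_def using i by simp
      finally have "c (?L - int i) = X - Y" by simp
      then have "norm (c (?L - int i)) \<le> norm X + norm Y" by (simp only: norm_triangle_ineq4)
      moreover have "norm X \<le> (\<Sum>s\<le>n. \<bar>\<beta> n i s\<bar> * samples c (j + 1))"
        unfolding X_def by (intro sum_norm_le) (auto simp: norm_mult n_def intro!: mult_left_mono sample_le)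
      moreover have "\<dots> \<le> B1 * samples c (j + 1)"
        unfolding sum_distrib_right[symmetric] by (intro mult_right_mono B1 n i samples_nonneg)
      moreover have "norm Y \<le> (\<Sum>k<m. \<bar>e n i k\<bar> * C)"
        unfolding Y_def
      proof (intro sum_norm_le)
        fix k assume k: "k \<in> {..<m}"
        show "norm (if n < k then c (?L - int k) * complex_of_real (e n i k) else 0) \<le> \<bar>e n i k\<bar> * C"
        proof (cases "n < k")
          case True
          then have "norm (c (?L - int k)) \<le> C" using old k by simp
          then have "\<bar>e n i k\<bar> * norm (c (?L - int k)) \<le> \<bar>e n i k\<bar> * C" by (intro mult_left_mono) auto
          then show ?thesis using True by (simp add: norm_mult mult.commute)
        qed (use C0 in simp)
      qed
      moreover have "\<dots> \<le> B2 * C"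
        unfolding sum_distrib_right[symmetric] by (intro mult_right_mono B2 n i C0)
      moreover have "(B2 + 1) * C = B2 * C + C" by (simp add: distrib_right)
      ultimately show ?thesis using C0 by linarith
    qed
  qed
  with B10 B20 show ?thesis by blast
qed

text \<open>The recursion starts at the last restart node, at phase \<open>K - 1\<close>. The
  constant grows with \<open>n\<close>, but \<open>n\<close> is limited by the period, and the
  constant depends neither on the block nor on the coefficients.\<close>

lemma block_bound:
  assumes "K - 1 + n < period"
  shows "\<exists>C\<ge>0. \<forall>c q. \<forall>i<m. norm (c (level (q * int period + int (K - 1 + n)) - int i)) \<le> C * block c q"
  using assms
proof (induction n)
  case 0
  show ?case using block_restart level_restart[of "K - 1"] K_pos by simp
next
  case (Suc n)
  then obtain C where C: "C \<ge> 0"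
    "\<And>c q i. i < m \<Longrightarrow> norm (c (level (q * int period + int (K - 1 + n)) - int i)) \<le> C * block c q"
    by auto
  from block_advance obtain B1 B2 where B: "B1 \<ge> 0" "B2 \<ge> 0" and adv: "\<forall>c j C. phase (j + 1) \<ge> K
      \<longrightarrow> C \<ge> 0 \<longrightarrow>
     (\<forall>i<m. norm (c (level j - int i)) \<le> C) \<longrightarrow>
     (\<forall>i<m. norm (c (level (j + 1) - int i)) \<le> B1 * samples c (j + 1) + (B2 + 1) * C)" by blast
  have "norm (c (level (q * int period + int (K - 1 + Suc n)) - int i))
      \<le> (B1 + (B2 + 1) * C) * block c q"
    if "i < m" for c q i
  proof -
    let ?j = "q * int period + int (K - 1 + n)"
    have j1: "?j + 1 = q * int period + int (K - 1 + Suc n)" by simp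
    have "phase (?j + 1) = K - 1 + Suc n" unfolding j1 using Suc.prems by (rule phase_eq)
    then have "phase (?j + 1) \<ge> K" by simp
    moreover have "C * block c q \<ge> 0" using C(1) block_nonneg by simp
    moreover have "\<forall>i<m. norm (c (level ?j - int i)) \<le> C * block c q" using C(2) by blast
    ultimately have "norm (c (level (?j + 1) - int i))
        \<le> B1 * samples c (?j + 1) + (B2 + 1) * (C * block c q)"
      using adv that by blast
    also have "B1 * samples c (?j + 1) \<le> B1 * block c q"
      unfolding j1 using B(1) Suc.prems by (intro mult_left_mono samples_le_block)
    finally show ?thesis unfolding j1 by (simp add: algebra_simps)
  qed
  moreover have "B1 + (B2 + 1) * C \<ge> 0" using B C(1) by simp
  ultimately show ?case by blast
qed

text \<open>Levels are unbounded in both directions and never jump by more than \<open>m\<close>, so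
  every coefficient is alive at some node; it remains to place that node where the recursion already
  gives a bound.\<close>

lemma level_covers: "\<exists>j. K - 1 \<le> phase j \<and> l \<le> level j \<and> level j < l + int m"
proof -
  define N where "N = nat (\<bar>level 0\<bar> + \<bar>l\<bar> + 1)"
  \<comment> \<open>Far enough to the left for its level to be below \<open>l\<close>.\<close>
  define a where "a = - (int N * int period)"
  have "level a + int N \<le> level 0"
    using level_growth[of a N] by (simp add: a_def)
  then have a: "level a < l" by (simp add: N_def)
  have "l \<le> level (a + int (nat (l - level a)) * int period)"
    using level_growth[of a "nat (l - level a)"] a by simp
  then have ex: "\<exists>n. l \<le> level (a + int n)" by (metis of_nat_mult)
  define n where "n = (LEAST n. l \<le> level (a + int n))"
  have n: "l \<le> level (a + int n)" unfolding n_def using ex by (rule LeastI_ex)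
  have "n \<noteq> 0" using n a by (metis add.right_neutral not_le of_nat_0)
  then have "\<not> l \<le> level (a + int (n - 1))"
    unfolding n_def by (intro not_less_Least) simp
  moreover have eq: "a + int (n - 1) + 1 = a + int n" using \<open>n \<noteq> 0\<close> by simp
  ultimately have upper: "level (a + int n) < l + int m"
    using level_succ[of "a + int (n - 1)", unfolded eq] step_le[of "a + int n"] by linarith
  show ?thesis
  proof (cases "K - 1 \<le> phase (a + int n)")
    case True
    then show ?thesis using n upper by blast
  next
    case False
    obtain q where q: "a + int n = q * int period + int (phase (a + int n))" using decompose by blast
    \<comment> \<open>A node inside a restart is replaced by the last restart node of the block,
      which has the same level.\<close>
    let ?j = "q * int period + int (K - 1)"
    have "level ?j = level (a + int n)"
      using level_restart[of "K - 1" q] level_restart[of "phase (a + int n)" q] K_pos False q by simp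
    moreover have "phase ?j = K - 1" using K_pos by (intro phase_eq) (simp add: period_def)
    ultimately show ?thesis using n upper by (metis order_refl)
  qed
qed

text \<open>A coefficient is bounded by the samples of the one block in which
  \<open>level_covers\<close> finds it, and \<open>width\<close> was chosen so that the whole block
  is near it. Summing over the finitely many positions in a period gives a common constant.\<close>

lemma samples_lower: "\<exists>C\<ge>0. \<forall>c l. norm (c l) \<le> C * (\<Sum>j | l \<in> near j. samples c j)"
proof -
  have "\<exists>C. \<forall>n. K - 1 + n < period \<longrightarrow> C n \<ge> 0 \<and>
     (\<forall>c q. \<forall>i<m. norm (c (level (q * int period + int (K - 1 + n)) - int i)) \<le> C n * block c q)"
    using block_bound by metis
  then obtain C where C: "\<And>n. K - 1 + n < period \<Longrightarrow> C n \<ge> 0"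
    "\<And>n c q i. K - 1 + n < period \<Longrightarrow> i < m \<Longrightarrow>
       norm (c (level (q * int period + int (K - 1 + n)) - int i)) \<le> C n * block c q" by blast
  define D where "D = (\<Sum>n<period. \<bar>C n\<bar>)"
  have D0: "D \<ge> 0" by (simp add: D_def sum_nonneg)
  have "norm (c l) \<le> D * (\<Sum>j | l \<in> near j. samples c j)" for c l
  proof -
    obtain j where j: "K - 1 \<le> phase j" "l \<le> level j" "level j < l + int m" using level_covers by blast
    obtain q where q: "j = q * int period + int (phase j)" using decompose by blast
    define n where "n = phase j - (K - 1)"
    have n: "K - 1 + n = phase j" using j by (simp add: n_def)
    have np: "K - 1 + n < period" using n phase_less by simp
    have l: "level j - int (nat (level j - l)) = l" and "nat (level j - l) < m" using j by auto
    from C(2)[OF np this(2), of c q] have "norm (c l) \<le> C n * block c q"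
      unfolding n q[symmetric] l .
    also have "\<dots> \<le> D * block c q"
    proof (intro mult_right_mono block_nonneg)
      have "\<bar>C n\<bar> \<le> D" unfolding D_def using np by (intro member_le_sum) auto
      then show "C n \<le> D" by simp
    qed
    also have "block c q = (\<Sum>i\<in>(\<lambda>r. q * int period + int r) ` {..<period}. samples c i)"
      unfolding block_def by (subst sum.reindex) (auto simp: inj_on_def)
    also have "\<dots> \<le> (\<Sum>j | l \<in> near j. samples c j)"
    proof (intro sum_mono2 finite_near_inv samples_nonneg)
      have "\<bar>l - level (q * int period + int r)\<bar> \<le> width" if "r < period" for r
      proof -
        have "\<bar>level (q * int period + int r) - level j\<bar> \<le> int period * int m"
          using that phase_less[of j] by (intro level_diff) (subst q, simp)
        then show ?thesis using j by (simp add: width_def)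
      qed
      then show "(\<lambda>r. q * int period + int r) ` {..<period} \<subseteq> {j. l \<in> near j}" by (auto simp: near_def)
    qed
    finally show ?thesis using D0 by (simp add: mult_left_mono)
  qed
  with D0 show ?thesis by blast
qed

end

section \<open>The sampling inequalities for all exponents\<close>

context sampling_scheme begin

lemma samples_size_le:
  "\<exists>D>0. \<forall>c. lp_size p (samples c) \<le> ennreal D * lp_size p (\<lambda>l. norm (c l))"
proof -
  from samples_upper obtain C where C: "C \<ge> 0"
    "\<And>c j. samples c j \<le> C * (\<Sum>l\<in>near j. norm (c l))" by blast
  have "\<exists>D>0. \<forall>u v. (\<forall>a. 0 \<le> u a) \<longrightarrow> (\<forall>b. 0 \<le> v b) \<longrightarrow> (\<forall>b. v b \<le> C * (\<Sum>a\<in>near b. u a)) \<longrightarrow>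
       lp_size p v \<le> ennreal D * lp_size p u"
    by (rule lp_size_local_bound[OF C(1) finite_near eq_refl[OF card_near] finite_near_inv card_near_inv])
  then obtain D where D: "D > 0" "\<forall>u v. (\<forall>a. 0 \<le> u a) \<longrightarrow> (\<forall>b. 0 \<le> v b) \<longrightarrow>
       (\<forall>b. v b \<le> C * (\<Sum>a\<in>near b. u a)) \<longrightarrow> lp_size p v \<le> ennreal D * lp_size p u" by blast
  show ?thesis
    using D(1) by (intro exI[of _ D] conjI allI D(2)[rule_format]) (simp_all add: samples_nonneg C(2))
qed

text \<open>The same domination principle with the nearness relation reversed: both multiplicities
  of overlap are bounded.\<close>

lemma samples_size_ge:
  "\<exists>D>0. \<forall>c. lp_size p (\<lambda>l. norm (c l)) \<le> ennreal D * lp_size p (samples c)"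
proof -
  from samples_lower obtain C where C: "C \<ge> 0"
    "\<And>c l. norm (c l) \<le> C * (\<Sum>j | l \<in> near j. samples c j)" by blast
  have "\<exists>D>0. \<forall>u v. (\<forall>a. 0 \<le> u a) \<longrightarrow> (\<forall>b. 0 \<le> v b) \<longrightarrow> (\<forall>b. v b \<le> C * (\<Sum>j\<in>{j. b \<in> near j}. u j)) \<longrightarrow>
       lp_size p v \<le> ennreal D * lp_size p u"
    by (rule lp_size_local_bound[OF C(1) finite_near_inv card_near_inv, where ?K2.0
        = "nat (2 * width + 1)"])
      (simp_all add: finite_near card_near)
  then obtain D where D: "D > 0" "\<forall>u v. (\<forall>a. 0 \<le> u a) \<longrightarrow> (\<forall>b. 0 \<le> v b) \<longrightarrow>
       (\<forall>b. v b \<le> C * (\<Sum>j\<in>{j. b \<in> near j}. u j)) \<longrightarrow> lp_size p v \<le> ennreal D * lp_size p u" by blast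
  show ?thesis
    using D(1) by (intro exI[of _ D] conjI allI D(2)[rule_format]) (simp_all add: samples_nonneg C(2))
qed

text \<open>The middle quantity of the sampling inequality, indexed by the integers instead of the
  nodes.\<close>

definition sample_size :: "ennreal \<Rightarrow> (int \<Rightarrow> complex) \<Rightarrow> ennreal" where
  "sample_size p c =
     (if p = \<infinity> then (SUP j. SUP s\<in>{0..\<mu> j}. ennreal (norm (nderiv s (series c) (node j))))
      else (\<Sum>\<^sub>\<infinity>j\<in>UNIV. \<Sum>s=0..\<mu> j. ennreal (norm (nderiv s (series c) (node j)) powr enn2real p)))"

lemma sample_size_upper: "sample_size p c \<le> ennreal (real m) * lp_size p (samples c)"
proof (cases "p = \<infinity>")
  case True
  have "ennreal (norm (nderiv s (series c) (node j)))
      \<le> ennreal (real m) * (SUP j. ennreal (samples c j))"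
    if "s \<le> \<mu> j" for s j
  proof -
    have "ennreal (norm (nderiv s (series c) (node j))) \<le> 1 * ennreal (samples c j)"
      using sample_le[OF that] by (simp add: ennreal_leI)
    also have "\<dots> \<le> ennreal (real m) * (SUP j. ennreal (samples c j))"
      using m_pos by (intro mult_mono SUP_upper) (auto simp flip: ennreal_1 intro!: ennreal_leI)
    finally show ?thesis .
  qed
  then show ?thesis using True by (auto simp: sample_size_def lp_size_def intro!: SUP_least)
next
  case False
  have "(\<Sum>s=0..\<mu> j. ennreal (norm (nderiv s (series c) (node j)) powr enn2real p))
      \<le> ennreal (real m) * ennreal (samples c j powr enn2real p)" for j
  proof -
    have "(\<Sum>s=0..\<mu> j. ennreal (norm (nderiv s (series c) (node j)) powr enn2real p))
      \<le> (\<Sum>s=0..\<mu> j. ennreal (samples c j powr enn2real p))"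
      using sample_le by (intro sum_mono ennreal_leI powr_mono2) auto
    also have "\<dots> = of_nat (\<mu> j + 1) * ennreal (samples c j powr enn2real p)" by simp
    also have "\<dots> \<le> of_nat m * ennreal (samples c j powr enn2real p)"
      using mult[of j] by (intro mult_right_mono) (auto simp del: of_nat_add of_nat_Suc)
    finally show ?thesis by (simp only: ennreal_of_nat_eq_real_of_nat)
  qed
  then show ?thesis using False by (auto simp: sample_size_def lp_size_def intro!: infsum_le_cmult_ennreal)
qed

lemma sample_size_lower:
  "\<exists>D>0. \<forall>c. lp_size p (samples c) \<le> ennreal D * sample_size p c"
proof (cases "p = \<infinity>")
  case True
  have "ennreal (samples c j) \<le> ennreal (real m) * sample_size p c" for c j
  proof -
    have "ennreal (samples c j) = (\<Sum>s\<le>\<mu> j. ennreal (norm (nderiv s (series c) (node j))))"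
      by (simp add: samples_def sum_ennreal)
    also have "\<dots> \<le> (\<Sum>s\<le>\<mu> j. sample_size p c)"
    proof (intro sum_mono)
      fix s assume s: "s \<in> {..\<mu> j}"
      have "ennreal (norm (nderiv s (series c) (node j))) \<le>
          (SUP s\<in>{0..\<mu> j}. ennreal (norm (nderiv s (series c) (node j))))"
        using s by (intro SUP_upper) auto
      also have "\<dots> \<le> sample_size p c"
        unfolding sample_size_def using True by (auto intro: SUP_upper)
      finally show "ennreal (norm (nderiv s (series c) (node j))) \<le> sample_size p c" .
    qed
    also have "\<dots> = of_nat (\<mu> j + 1) * sample_size p c" by simp
    also have "\<dots> \<le> of_nat m * sample_size p c"
      using mult[of j] by (intro mult_right_mono) (auto simp del: of_nat_add of_nat_Suc)
    finally show ?thesis by (simp only: ennreal_of_nat_eq_real_of_nat)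
  qed
  then have "lp_size p (samples c) \<le> ennreal (real m) * sample_size p c" for c
    using True by (auto simp: lp_size_def intro!: SUP_least)
  then show ?thesis using m_pos by (intro exI[of _ "real m"]) simp
next
  case False
  define q where "q = enn2real p"
  have q: "q \<ge> 0" by (simp add: q_def)
  have "ennreal (samples c j powr q) \<le> ennreal (real m powr q) *
      (\<Sum>s=0..\<mu> j. ennreal (norm (nderiv s (series c) (node j)) powr q))" for c j
  proof -
    have "samples c j powr q \<le> real (card {..\<mu> j}) powr q * (\<Sum>s\<le>\<mu> j. norm (nderiv s (series c) (node j)) powr q)"
      unfolding samples_def using q by (intro sum_powr_le) auto
    also have "\<dots> \<le> real m powr q * (\<Sum>s\<le>\<mu> j. norm (nderiv s (series c) (node j)) powr q)"
      using mult[of j] q by (intro mult_right_mono powr_mono2 sum_nonneg) auto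
    finally have "ennreal (samples c j powr q)
        \<le> ennreal (real m powr q * (\<Sum>s\<le>\<mu> j. norm (nderiv s (series c) (node j)) powr q))"
      by (rule ennreal_leI)
    also have "\<dots> = ennreal (real m powr q) * (\<Sum>s\<le>\<mu> j. ennreal (norm (nderiv s (series c) (node j)) powr q))"
      by (simp add: ennreal_mult sum_nonneg sum_ennreal)
    finally show ?thesis by (simp only: atLeast0AtMost)
  qed
  then have "lp_size p (samples c) \<le> ennreal (real m powr q) * sample_size p c" for c
    using False by (auto simp: sample_size_def lp_size_def q_def intro!: infsum_le_cmult_ennreal)
  moreover have "real m powr q > 0" using m_pos by simp
  ultimately show ?thesis by blast
qed

text \<open>Both bounds pass through the coefficients: function, coefficients, samples, and back.
  Each comparison is available in both directions.\<close>

lemma Lp_size_equiv_sample_size: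
  "\<exists>A>0. \<exists>B>0. \<forall>c. ennreal A * Lp_size p (series c) \<le> sample_size p c \<and>
     sample_size p c \<le> ennreal B * Lp_size p (series c)"
proof -
  obtain D1 where D1: "D1 > 0" "\<And>c. Lp_size p (series c) \<le> ennreal D1 * lp_size p (\<lambda>l. norm (c l))"
    using Lp_upper[of p] by blast
  obtain D2 where D2: "D2 > 0" "\<And>c. lp_size p (\<lambda>l. norm (c l)) \<le> ennreal D2 * Lp_size p (series c)"
    using Lp_lower[of p] by blast
  obtain D3 where D3: "D3 > 0" "\<And>c. lp_size p (samples c) \<le> ennreal D3 * lp_size p (\<lambda>l. norm (c l))"
    using samples_size_le[of p] by blast
  obtain D4 where D4: "D4 > 0" "\<And>c. lp_size p (\<lambda>l. norm (c l)) \<le> ennreal D4 * lp_size p (samples c)"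
    using samples_size_ge[of p] by blast
  obtain D5 where D5: "D5 > 0" "\<And>c. lp_size p (samples c) \<le> ennreal D5 * sample_size p c"
    using sample_size_lower[of p] by blast
  have trans: "x \<le> ennreal (a * b) * t" if "x \<le> ennreal a * y" "y \<le> ennreal b * t" "a > 0" "b > 0"
    for x y t :: ennreal and a b :: real
  proof -
    have "x \<le> ennreal a * (ennreal b * t)"
      using that(1) mult_left_mono[OF that(2), of "ennreal a"] by simp
    then show ?thesis using that(3,4) by (simp add: ennreal_mult mult.assoc)
  qed
  let ?E = "D1 * (D4 * D5)"
  have E: "?E > 0" using D1(1) D4(1) D5(1) by simp
  have "ennreal (1 / ?E) * Lp_size p (series c) \<le> sample_size p c" for c
  proof -
    have "Lp_size p (series c) \<le> ennreal ?E * sample_size p c"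
      using trans[OF D1(2) trans[OF D4(2) D5(2)]] D1(1) D4(1) D5(1) by simp
    then have "ennreal (1 / ?E) * Lp_size p (series c)
        \<le> ennreal (1 / ?E) * (ennreal ?E * sample_size p c)"
      by (intro mult_left_mono) auto
    also have "\<dots> = sample_size p c"
      unfolding mult.assoc[symmetric] using E by (subst ennreal_mult[symmetric]) auto
    finally show ?thesis .
  qed
  moreover have "sample_size p c \<le> ennreal (real m * (D3 * D2)) * Lp_size p (series c)" for c
    using trans[OF sample_size_upper trans[OF D3(2) D2(2)]] D3(1) D2(1) m_pos by simp
  moreover have "1 / ?E > 0" "real m * (D3 * D2) > 0" using E D3(1) D2(1) m_pos by auto
  ultimately show ?thesis by blast
qed

lemma node_sampling_set:
  assumes "\<And>j. \<mu>X (node j) = \<mu> j"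
  shows "sampling_set p m \<phi> (range node) \<mu>X"
proof -
  obtain A B where AB: "A > 0" "B > 0"
    "\<And>c. ennreal A * Lp_size p (series c) \<le> sample_size p c"
    "\<And>c. sample_size p c \<le> ennreal B * Lp_size p (series c)"
    using Lp_size_equiv_sample_size[of p] by blast
  have dv: "deriv_val m s f (node j) = nderiv s f (node j)" for s f j
    using node_not_Ints by (simp add: deriv_val_def)
  have inj: "inj node" using node_strict_mono by (rule strict_mono_imp_inj_on)
  have f: "\<exists>c. f = series c" if "f \<in> Vp p \<phi>" for f
    using that unfolding Vp_def series_def by blast
  have inf: "(SUP x\<in>range node. SUP s\<in>{0..\<mu>X x}. ennreal (norm (deriv_val m s (series c) x)))
      = sample_size p c"
    if "p = \<infinity>" for c
    using that by (simp add: sample_size_def assms dv image_image)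
  have fin: "(\<Sum>\<^sub>\<infinity>x\<in>range node. \<Sum>s=0..\<mu>X x. ennreal (norm (deriv_val m s (series c) x) powr enn2real p)) = sample_size p c"
    if "p \<noteq> \<infinity>" for c
    using that by (simp add: sample_size_def assms dv infsum_reindex[OF inj] o_def)
  show ?thesis
    unfolding sampling_set_def Let_def
  proof (rule exI[of _ A], rule exI[of _ B], intro conjI AB(1,2) ballI)
    fix f assume "f \<in> Vp p \<phi>"
    then obtain c where c: "f = series c" using f by blast
    show "if p = \<infinity> then
        ennreal A * esssup lborel (\<lambda>x. ennreal (norm (f x))) \<le>
          (SUP x\<in>range node. SUP s\<in>{0..\<mu>X x}. ennreal (norm (deriv_val m s f x))) \<and>
        (SUP x\<in>range node. SUP s\<in>{0..\<mu>X x}. ennreal (norm (deriv_val m s f x))) \<le>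
          ennreal B * esssup lborel (\<lambda>x. ennreal (norm (f x)))
      else
        ennreal A * (\<integral>\<^sup>+x. ennreal (norm (f x) powr enn2real p) \<partial>lborel) \<le>
          (\<Sum>\<^sub>\<infinity>x\<in>range node. \<Sum>s=0..\<mu>X x. ennreal (norm (deriv_val m s f x) powr enn2real p)) \<and>
        (\<Sum>\<^sub>\<infinity>x\<in>range node. \<Sum>s=0..\<mu>X x. ennreal (norm (deriv_val m s f x) powr enn2real p)) \<le>
          ennreal B * (\<integral>\<^sup>+x. ennreal (norm (f x) powr enn2real p) \<partial>lborel)"
    proof (cases "p = \<infinity>")
      case True
      then show ?thesis
        using AB(3,4)[of c] unfolding c inf[OF True] by (simp add: Lp_size_def)
    next
      case False
      then show ?thesis
        using AB(3,4)[of c] unfolding c fin[OF False] by (simp add: Lp_size_def)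
    qed
  qed
qed

section \<open>The density of the nodes\<close>

lemma step_sum_add: "step_sum (j + int n) = step_sum j + (\<Sum>r<n. step (j + int r))"
proof (induction n)
  case (Suc n)
  have "step_sum (j + int (Suc n)) = step_sum (j + int n) + step (j + int n)"
    using step_sum_succ[of "j + int n"] by (simp add: add_ac)
  with Suc show ?case by simp
qed simp

text \<open>At nodes after the restart, weight and step coincide. The excess is at most
  \<open>m\<close> for each of the \<open>K\<close> restart nodes, and it is paid for by the
  \<open>T\<close> other nodes, each of which has step at least 1.\<close>

lemma block_weight:
  assumes "\<eta> \<ge> 0" "real K * real m \<le> \<eta> * real T"
  shows "(\<Sum>r<period. 1 + real (\<mu> (q * int period + int r)))
     \<le> (1 + \<eta>) * real_of_int (\<Sum>r<period. step (q * int period + int r))"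
proof -
  let ?j = "\<lambda>r. q * int period + int r"
  let ?S = "real_of_int (\<Sum>r<period. step (?j r))"
  have "1 + real (\<mu> (?j r)) \<le> real_of_int (step (?j r)) + (if r < K then real m else 0)"
      if "r < period" for r
    using mult[of "?j r"] phase_eq[OF that, of q] K_pos by (auto simp: step_def)
  then have "(\<Sum>r<period. 1 + real (\<mu> (?j r)))
      \<le> (\<Sum>r<period. real_of_int (step (?j r)) + (if r < K then real m else 0))"
    by (intro sum_mono) auto
  also have "\<dots> = ?S + (\<Sum>r<period. if r < K then real m else 0)" by (simp add: sum.distrib)
  also have "(\<Sum>r<period. if r < K then real m else 0) = real K * real m"
  proof -
    have "(\<Sum>r<period. if r < K then real m else 0) = (\<Sum>r<K. real m)"
      by (intro sum.mono_neutral_cong_right) (auto simp: period_def)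
    then show ?thesis by simp
  qed
  also have "\<dots> \<le> \<eta> * real T" by (rule assms)
  also have "\<dots> \<le> \<eta> * ?S"
  proof (intro mult_left_mono assms)
    have "real T = (\<Sum>r\<in>{K..<period}. 1)" by (simp add: period_def)
    also have "\<dots> \<le> (\<Sum>r\<in>{K..<period}. real_of_int (step (?j r)))"
      using phase_eq[of _ q] K_pos by (intro sum_mono) (auto simp: step_def)
    also have "\<dots> \<le> (\<Sum>r<period. real_of_int (step (?j r)))"
      using step_nonneg by (intro sum_mono2) auto
    finally show "real T \<le> ?S" by simp
  qed
  finally show ?thesis by (simp add: distrib_right)
qed

lemma prefix_weight:
  assumes "\<eta> \<ge> 0" "real K * real m \<le> \<eta> * real T"
  shows "(\<Sum>r<q * period. 1 + real (\<mu> (int r))) \<le> (1 + \<eta>) * real_of_int (step_sum (int (q * period)))"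
proof (induction q)
  case 0
  then show ?case by (simp add: step_sum_def)
next
  case (Suc q)
  have "(\<Sum>r<Suc q * period. 1 + real (\<mu> (int r))) = (\<Sum>r<q * period. 1 + real (\<mu> (int r)))
      + (\<Sum>r<period. 1 + real (\<mu> (int q * int period + int r)))"
    using sum.atLeastLessThan_concat[of 0 "q * period" "q * period + period" "\<lambda>r. 1 + real (\<mu> (int r))"]
      sum.shift_bounds_nat_ivl[of "\<lambda>r. 1 + real (\<mu> (int r))" 0 "q * period" period]
    by (simp add: lessThan_atLeast0 add_ac)
  moreover have "step_sum (int (Suc q * period))
      = step_sum (int (q * period)) + (\<Sum>r<period. step (int q * int period + int r))"
    using step_sum_add[of "int (q * period)" period] by (simp add: add_ac)
  ultimately show ?case
    using Suc block_weight[OF assms, of "int q"] by (simp add: distrib_left)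
qed

text \<open>The window is covered by the first full periods whose total length exceeds its right
  end; the minimal number of them overshoots by less than a period, at most
  \<open>period * m\<close>. The window starts at 1 because nodes with negative index lie below
  1.\<close>

lemma window_weight:
  assumes "\<eta> \<ge> 0" "real K * real m \<le> \<eta> * real T" "R \<ge> 0" "\<And>j. \<mu>X (node j) = \<mu> j"
  shows "(\<Sum>\<^sub>\<infinity>x\<in>range node \<inter> {1..2 * R + 1}. of_nat (1 + \<mu>X x))
    \<le> ennreal ((1 + \<eta>) * (2 * R + 1 + real period * real m))"
proof -
  define Q where "Q q \<longleftrightarrow> 2 * R + 1 < real_of_int (step_sum (int (q * period)))" for q
  have "\<exists>q. Q q"
  proof -
    define N where "N = nat (\<lceil>2 * R + 1\<rceil> + 1)"
    have "step_sum (int (N * period)) = level (-1 + int N * int period)" by (simp add: level_def)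
    moreover have "level (-1) + int N \<le> level (-1 + int N * int period)" by (rule level_growth)
    moreover have "level (-1) = 0" by (simp add: level_def step_sum_def)
    ultimately have "int N \<le> step_sum (int (N * period))" by simp
    then have "real N \<le> real_of_int (step_sum (int (N * period)))" by linarith
    moreover have "2 * R + 1 < real N" using assms(3) by (simp add: N_def) linarith
    ultimately show ?thesis unfolding Q_def by (intro exI[of _ N]) simp
  qed
  define q where "q = (LEAST q. Q q)"
  have q: "Q q" unfolding q_def using \<open>\<exists>q. Q q\<close> by (rule LeastI_ex)
  have "\<not> Q 0" using assms(3) by (simp add: Q_def step_sum_def)
  then have "q \<noteq> 0" using q by metis
  then have "\<not> Q (q - 1)" unfolding q_def by (intro not_less_Least) simp
  then have prev: "real_of_int (step_sum (int ((q - 1) * period))) \<le> 2 * R + 1" by (simp add: Q_def)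
  have "int (q * period) = int ((q - 1) * period) + int period"
    using \<open>q \<noteq> 0\<close> by (cases q) (simp_all add: algebra_simps)
  then have "step_sum (int (q * period)) \<le> step_sum (int ((q - 1) * period)) + int period * int m"
    using level_add(2)[of "int ((q - 1) * period) - 1" period] by (simp add: level_def)
  then have "real_of_int (step_sum (int (q * period))) \<le>
      real_of_int (step_sum (int ((q - 1) * period)) + int period * int m)"
    by (simp only: of_int_le_iff)
  then have tq: "real_of_int (step_sum (int (q * period))) \<le> 2 * R + 1 + real period * real m"
    using prev unfolding of_int_add of_int_mult of_int_of_nat_eq by linarith
  have sub: "range node \<inter> {1..2 * R + 1} \<subseteq> (\<lambda>r. node (int r)) ` {..<q * period}"
  proof
    fix x assume "x \<in> range node \<inter> {1..2 * R + 1}"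
    then obtain j where j: "x = node j" "1 \<le> node j" "node j \<le> 2 * R + 1" by auto
    have "0 \<le> j"
    proof (rule ccontr)
      assume "\<not> 0 \<le> j"
      then have "level j \<le> level (-1)" by (intro level_mono) simp
      then have "level j \<le> 0" by (simp add: level_def step_sum_def)
      then have "real_of_int (level j) \<le> 0" by simp
      then show False using j(2) offset_unit[of j] by (simp add: node_def)
    qed
    moreover have "j < int (q * period)"
    proof (rule ccontr)
      assume "\<not> j < int (q * period)"
      then have "level (int (q * period) - 1) \<le> level j" by (intro level_mono) simp
      then have "step_sum (int (q * period)) \<le> level j" by (simp add: level_def)
      then have "real_of_int (step_sum (int (q * period))) \<le> real_of_int (level j)" by simp
      then show False using q j(3) offset_unit[of j] by (simp add: node_def Q_def)
    qed
    ultimately show "x \<in> (\<lambda>r. node (int r)) ` {..<q * period}"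
      using j(1) by (intro image_eqI[of _ _ "nat j"]) (auto simp: nat_less_iff)
  qed
  have "(\<Sum>\<^sub>\<infinity>x\<in>range node \<inter> {1..2 * R + 1}. of_nat (1 + \<mu>X x) :: ennreal)
      \<le> (\<Sum>\<^sub>\<infinity>x\<in>(\<lambda>r. node (int r)) ` {..<q * period}. of_nat (1 + \<mu>X x))"
    by (rule infsum_mono_neutral) (use sub in auto)
  also have "\<dots> = (\<Sum>r<q * period. of_nat (1 + \<mu> (int r)))"
  proof -
    have "inj_on (\<lambda>r. node (int r)) {..<q * period}"
      using strict_mono_eq[OF node_strict_mono] by (auto simp: inj_on_def)
    then show ?thesis by (subst infsum_finite, simp, subst sum.reindex) (simp_all add: assms(4))
  qed
  also have "\<dots> = ennreal (\<Sum>r<q * period. 1 + real (\<mu> (int r)))"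
    by (subst sum_ennreal[symmetric]) (auto simp: ennreal_of_nat_eq_real_of_nat simp flip: ennreal_plus intro!: sum.cong)
  also have "\<dots> \<le> ennreal ((1 + \<eta>) * (2 * R + 1 + real period * real m))"
    using assms(1)
    by (intro ennreal_leI[OF order_trans[OF prefix_weight[OF assms(1,2)] mult_left_mono[OF tq]]]) simp
  finally show ?thesis .
qed

text \<open>For an upper bound one window for each \<open>R\<close> is enough, since the density
  takes an infimum over centres; the centre \<open>R + 1\<close> gives the window treated
  before.\<close>

lemma node_lower_density:
  assumes \<eta>: "\<eta> > 0" "real K * real m \<le> \<eta> * real T" and \<mu>X: "\<And>j. \<mu>X (node j) = \<mu> j"
  shows "lower_density (range node) \<mu>X \<le> ennreal (1 + 2 * \<eta>)"
proof -
  define E where "E = 1 + real period * real m"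
  \<comment> \<open>From here on the boundary term satisfies
    \<open>(1 + \<eta>) * E \<le> 2 * \<eta> * R\<close>, so it raises the bound from
    \<open>1 + \<eta>\<close> to at most \<open>1 + 2 * \<eta>\<close>.\<close>
  define R0 where "R0 = (1 + \<eta>) * E / (2 * \<eta>) + 1"
  have E: "E \<ge> 0" by (simp add: E_def)
  have R0: "R0 > 0" using \<eta> E by (simp add: R0_def add_nonneg_pos)
  have "(INF y. (\<Sum>\<^sub>\<infinity>x\<in>range node \<inter> {y - R..y + R}. of_nat (1 + \<mu>X x)) / ennreal (2 * R))
      \<le> ennreal (1 + 2 * \<eta>)" if R: "R \<ge> R0" for R
  proof -
    have R1: "R > 0" using R R0 by simp
    have "(INF y. (\<Sum>\<^sub>\<infinity>x\<in>range node \<inter> {y - R..y + R}. of_nat (1 + \<mu>X x)) / ennreal (2 * R))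
      \<le> (\<Sum>\<^sub>\<infinity>x\<in>range node \<inter> {(R + 1) - R..(R + 1) + R}. of_nat (1 + \<mu>X x)) / ennreal (2 * R)"
      by (rule INF_lower) simp
    also have "{(R + 1) - R..(R + 1) + R} = {1..2 * R + 1}" by auto
    also have "(\<Sum>\<^sub>\<infinity>x\<in>range node \<inter> {1..2 * R + 1}. of_nat (1 + \<mu>X x)) / ennreal (2 * R)
        \<le> ennreal ((1 + \<eta>) * (2 * R + E)) / ennreal (2 * R)"
      using window_weight[of \<eta> R \<mu>X] \<eta> R1 \<mu>X
      by (intro divide_right_mono_ennreal) (simp add: E_def add_ac)
    also have "\<dots> = ennreal ((1 + \<eta>) * (2 * R + E) / (2 * R))"
      using R1 \<eta> E by (intro divide_ennreal) auto
    also have "\<dots> \<le> ennreal (1 + 2 * \<eta>)"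
    proof (rule ennreal_leI)
      have "(1 + \<eta>) * E / (2 * \<eta>) \<le> R" using R by (simp add: R0_def)
      then have "(1 + \<eta>) * E \<le> R * (2 * \<eta>)" using \<eta> by (simp add: pos_divide_le_eq)
      then have "(1 + \<eta>) * (2 * R + E) \<le> (1 + 2 * \<eta>) * (2 * R)" by (simp add: algebra_simps)
      then show "(1 + \<eta>) * (2 * R + E) / (2 * R) \<le> 1 + 2 * \<eta>" using R1 by (simp add: pos_divide_le_eq)
    qed
    finally show ?thesis .
  qed
  then have "eventually (\<lambda>R. (INF y. (\<Sum>\<^sub>\<infinity>x\<in>range node \<inter> {y - R..y + R}. of_nat (1 + \<mu>X x)) / ennreal (2 * R))
      \<le> ennreal (1 + 2 * \<eta>)) at_top"
    by (rule eventually_at_top_linorderI)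
  then have "lower_density (range node) \<mu>X \<le> Liminf at_top (\<lambda>R::real. ennreal (1 + 2 * \<eta>))"
    unfolding lower_density_def by (rule Liminf_mono)
  then show ?thesis by (simp add: Liminf_const)
qed

end

theorem theorem1p2:
  fixes m :: nat and w :: "nat \<Rightarrow> real \<Rightarrow> real" and \<phi> :: "real \<Rightarrow> real"
    and \<mu> :: "int \<Rightarrow> nat" and \<epsilon> :: real
  assumes "m \<ge> 1"
    and "PEB_weights m w"
    and "PEB_spline m w \<phi>"
    and "\<epsilon> > 0"
    and "\<forall>j. \<mu> j \<in> {0..m - 1}"
  shows "\<exists>(x :: int \<Rightarrow> real) (\<mu>X :: real \<Rightarrow> nat).
           strict_mono x \<and>
           (\<forall>j. \<mu>X (x j) = \<mu> j) \<and>
           (\<forall>p::ennreal. 1 \<le> p \<longrightarrow> sampling_set p m \<phi> (range x) \<mu>X) \<and>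
           lower_density (range x) \<mu>X < 1 + ennreal \<epsilon>"
proof -
  interpret shift_generator m \<phi>
    using assms(1-3) by (rule PEB_spline_shift_generator)
  obtain K z b where restart: "restart_points K z b" using ex_restart_points by blast
  have "\<forall>n. \<exists>y \<beta>. n < m \<longrightarrow> y \<in> {0<..<1} \<and> (\<forall>i\<le>n. \<forall>k\<le>n.
     (\<Sum>s\<le>n. \<beta> i s * nderiv s \<phi> (y + real k)) = (if i = k then 1 else 0))"
    using hermite_point by blast
  from choice[OF this] obtain y where "\<forall>n. \<exists>\<beta>. n < m \<longrightarrow> y n \<in> {0<..<1} \<and> (\<forall>i\<le>n. \<forall>k\<le>n.
     (\<Sum>s\<le>n. \<beta> i s * nderiv s \<phi> (y n + real k)) = (if i = k then 1 else 0))" ..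
  from choice[OF this] obtain \<beta> where y: "\<forall>n. n < m \<longrightarrow> y n \<in> {0<..<1} \<and> (\<forall>i\<le>n. \<forall>k\<le>n.
     (\<Sum>s\<le>n. \<beta> n i s * nderiv s \<phi> (y n + real k)) = (if i = k then 1 else 0))" ..
  \<comment> \<open>The density bound is \<open>1 + 2 * \<eta>\<close>; a third of
    \<open>\<epsilon>\<close> makes the final inequality strict.\<close>
  define \<eta> where "\<eta> = \<epsilon> / 3"
  have \<eta>: "\<eta> > 0" using assms(4) by (simp add: \<eta>_def)
  define T where "T = nat \<lceil>real K * real m / \<eta>\<rceil> + 1"
  have T: "real K * real m \<le> \<eta> * real T"
  proof -
    have "real K * real m / \<eta> \<le> real T" unfolding T_def by linarith
    then show ?thesis using \<eta> by (simp add: pos_divide_le_eq mult.commute)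
  qed
  have \<mu>: "\<mu> j < m" for j using assms(1,5)
      by (metis Suc_diff_1 atLeastAtMost_iff le_imp_less_Suc less_eq_Suc_le One_nat_def)
  interpret sampling_scheme m \<phi> K T z b y \<beta> \<mu>
    by unfold_locales (use restart y \<mu> in \<open>auto simp: T_def\<close>)
  \<comment> \<open>The nodes are distinct, so the prescribed sequence transfers to a function on
    the line; its values off the nodes are irrelevant.\<close>
  define \<mu>X where "\<mu>X x = \<mu> (inv node x)" for x
  have \<mu>X: "\<mu>X (node j) = \<mu> j" for j
    using node_strict_mono by (simp add: \<mu>X_def strict_mono_imp_inj_on inv_f_f)
  have "lower_density (range node) \<mu>X \<le> ennreal (1 + 2 * \<eta>)"
    using \<eta> T \<mu>X by (rule node_lower_density)
  also have "\<dots> < ennreal (1 + \<epsilon>)" using assms(4) by (intro ennreal_lessI) (auto simp: \<eta>_def)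
  also have "\<dots> = 1 + ennreal \<epsilon>" using assms(4) by simp
  finally have "lower_density (range node) \<mu>X < 1 + ennreal \<epsilon>" .
  then show ?thesis
    using node_strict_mono \<mu>X node_sampling_set by (intro exI[of _ node] exI[of _ \<mu>X]) simp
qed

end
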